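(* Let $K$ be a field with $\mathrm{char}(K)\neq2$, with a group $U$ of roots of unity that contains $\{\pm1\}$ but no primitive $4$-th root of unity (thus including the case $U\simeq C_2$), and let $\mathcal{G}=\mathrm{GA}_2(K)$. A CR element $f\in\mathcal{G}$ is reversible with a reversor $r$ of order $4$ if and only if $f$ is conjugate (in $\mathcal{G}$) to the cyclically reduced normal form $$e_m\circ\cdots\circ a_1\circ e_1\circ R_1\circ e_1^{-1}\circ a_1^{-1}\circ\cdots\circ e_m^{-1}\circ R_2.$$ Here, $R_1=R=\begin{pmatrix}0&-1\\1&0\end{pmatrix}\in\mathcal{A}\setminus\mathcal{B}$ and $R_2=\begin{pmatrix}\alpha&-(\alpha^2+1)/\gamma\\ \gamma&-\alpha\end{pmatrix}\in\mathcal{A}\setminus\mathcal{B}$ (since $\gamma\neq0$), the latter including $R_2=R$ via $\alpha=0$ and $\gamma=1$. Moreover, $m\ge1$, the $a_i$ are in $\mathcal{I}$, each $e_i\in\mathcal{J}$, written $x'=x+y^2P_i(y),\ y'=y$, must have $P_i(y)$ odd (i.e. $P_i(-y)=-P_i(y)$), and $e_1$ and $e_m$ must appear. It follows that $f$ necessarily has $\det(\mathrm{d}f)=1$ and has a fixed point. Also, if $f'$ is a cyclically reduced element conjugate to $f$, then $\mathrm{pol\,deg}(f')=(n_m,\ldots,n_1,n_1,\ldots,n_m)$ where the $n_i$ are odd integers $\ge3$, and $f'$ commutes with $x'=-x+u,\ y'=-y+v$, with some $u,v\in K$.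
   Context: $\mathcal{G}=\mathrm{GA}_2(K)$ is the group, under composition, of polynomial automorphisms of the affine plane over $K$: maps $x'=P(x,y),\ y'=Q(x,y)$ with $P,Q\in K[x,y]$ that have a polynomial inverse; elements are distinguished by their polynomials. A matrix in $\mathrm{GL}(2,K)$ is identified with the corresponding linear map. $C_2$ is the cyclic group of order $2$. A reversor of $f$ is an element $r\in\mathcal{G}$ with $rfr^{-1}=f^{-1}$; $f$ is reversible if it has a reversor. $\mathrm{d}f$ is the Jacobian matrix; its determinant is a nonzero constant of $K$. Let $\mathcal{A}\subset\mathcal{G}$ be the subgroup of affine maps $\boldsymbol{x}\mapsto M\boldsymbol{x}+\boldsymbol{a}$ ($M\in\mathrm{GL}(2,K)$, $\boldsymbol{a}\in K^2$), $\mathcal{E}\subset\mathcal{G}$ the subgroup of elementary maps $x'=\alpha x+P(y),\ y'=\beta y+v$ ($P\in K[y]$, $\alpha,\beta,v\in K$, $\alpha\beta\neq0$), and $\mathcal{B}=\mathcal{A}\cap\mathcal{E}$. Put $\mathcal{I}=\left\{\begin{pmatrix}0&1\\1&\beta\end{pmatrix}\mid\beta\in K\right\}\subset\mathcal{A}\setminus\mathcal{B}$ and $\mathcal{J}=\{x'=x+y^2P(y),\ y'=y\mid 0\neq P\in K[y]\}\subset\mathcal{E}\setminus\mathcal{B}$. Every $g\in\mathcal{G}$ has a unique representation (its normal form) $g=b\circ a_m\circ e_m\circ\cdots\circ a_1\circ e_1$ with $m\ge1$, $b\in\mathcal{B}$, $a_i\in\mathcal{I}$, $e_i\in\mathcal{J}$,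 where $a_m$ and/or $e_1$ are allowed to be missing. The length of $g$ is the number of factors from $\mathcal{I}$ and $\mathcal{J}$ in it; for $g\notin\mathcal{B}$ it equals the number of factors in any expression of $g$ as a composition alternating between $\mathcal{A}\setminus\mathcal{B}$ and $\mathcal{E}\setminus\mathcal{B}$. An element is cyclically reduced if its length is even and $>0$. A CR element is an element of $\mathcal{G}$ that is conjugate in $\mathcal{G}$ to a cyclically reduced element. For $g\in\mathcal{G}\setminus\mathcal{A}$ in normal form, the poly-degree is $\mathrm{pol\,deg}(g)=(\deg e_m,\ldots,\deg e_2,\deg e_1)$, where the last entry is dropped if $e_1$ is missing, and the degree of $x'=x+y^2P(y),\ y'=y$ is $2+\deg P$.
   Formalization: For a general cyclically reduced conjugate f', pol deg(f') equals (n_m,…,n_1,n_1,…,n_m) only up to a cyclic rotation (conjugating by e_2 can give (3,3,5,5)); the unrotated equality is stated for the displayed normal form. *)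

theory Defs
  imports "HOL-Algebra.Multiplicative_Group" "HOL-Analysis.Analysis"
begin

text \<open>
  \<open>K[x,y]\<close> is represented as \<open>K[x][y]\<close>: in an \<open>'a poly poly\<close> the outer variable is \<open>y\<close> and
  the coefficients are polynomials in \<open>x\<close>. Maps are pairs of formal polynomials, so that over
  a finite field different polynomials give different maps.
\<close>

type_synonym 'a pmap = "'a poly poly \<times> 'a poly poly"

definition const2 :: "'a::comm_ring_1 \<Rightarrow> 'a poly poly" where
  "const2 c = [:[:c:]:]"

definition X2 :: "'a::comm_ring_1 poly poly" where
  "X2 = [:[:0, 1:]:]"

definition Y2 :: "'a::comm_ring_1 poly poly" where
  "Y2 = [:0, 1:]"

definition in_y :: "'a::comm_ring_1 poly \<Rightarrow> 'a poly poly" where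
  "in_y P = map_poly (\<lambda>c. [:c:]) P"

text \<open>Substitution \<open>P(A, B)\<close> of two polynomials for \<open>x\<close> and \<open>y\<close>.\<close>

definition subst_x :: "'a::comm_ring_1 poly \<Rightarrow> 'a poly poly \<Rightarrow> 'a poly poly" where
  "subst_x q A = poly (map_poly const2 q) A"

definition subst2 :: "'a::comm_ring_1 poly poly \<Rightarrow> 'a pmap \<Rightarrow> 'a poly poly" where
  "subst2 P g = poly (map_poly (\<lambda>q. subst_x q (fst g)) P) (snd g)"

definition pmap_comp :: "'a::comm_ring_1 pmap \<Rightarrow> 'a pmap \<Rightarrow> 'a pmap" where
  "pmap_comp f g = (subst2 (fst f) g, subst2 (snd f) g)"

definition pmap_id :: "'a::comm_ring_1 pmap" where
  "pmap_id = (X2, Y2)"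

definition End2 :: "'a::comm_ring_1 pmap monoid" where
  "End2 = \<lparr>carrier = UNIV, monoid.mult = pmap_comp, one = pmap_id\<rparr>"

definition GA2 :: "'a::field pmap monoid" where
  "GA2 = units_of End2"

definition eval_pmap :: "'a::comm_ring_1 pmap \<Rightarrow> 'a \<times> 'a \<Rightarrow> 'a \<times> 'a" where
  "eval_pmap f p =
     (poly (poly (fst f) [:snd p:]) (fst p), poly (poly (snd f) [:snd p:]) (fst p))"

definition has_fixed_point :: "'a::comm_ring_1 pmap \<Rightarrow> bool" where
  "has_fixed_point f \<longleftrightarrow> (\<exists>p. eval_pmap f p = p)"

text \<open>\<open>map_poly pderiv\<close> is \<open>\<partial>/\<partial>x\<close> and \<open>pderiv\<close> is \<open>\<partial>/\<partial>y\<close>.\<close>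

definition jacobian_matrix :: "'a::field pmap \<Rightarrow> 'a poly poly ^ 2 ^ 2" where
  "jacobian_matrix f = vector [vector [map_poly pderiv (fst f), pderiv (fst f)],
                        vector [map_poly pderiv (snd f), pderiv (snd f)]]"

definition affine_map :: "'a::field ^ 2 ^ 2 \<Rightarrow> 'a ^ 2 \<Rightarrow> 'a pmap" where
  "affine_map M a =
     (const2 (M $ 1 $ 1) * X2 + const2 (M $ 1 $ 2) * Y2 + const2 (a $ 1),
      const2 (M $ 2 $ 1) * X2 + const2 (M $ 2 $ 2) * Y2 + const2 (a $ 2))"

definition linear_map :: "'a::field ^ 2 ^ 2 \<Rightarrow> 'a pmap" where
  "linear_map M = affine_map M 0"

definition matrix22 :: "'a::field \<Rightarrow> 'a \<Rightarrow> 'a \<Rightarrow> 'a \<Rightarrow> 'a ^ 2 ^ 2" where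
  "matrix22 a b c d = vector [vector [a, b], vector [c, d]]"

definition affine_maps :: "'a::field pmap set" where
  "affine_maps = {affine_map M a | M a. invertible M}"

definition elementary_map :: "'a::field \<Rightarrow> 'a poly \<Rightarrow> 'a \<Rightarrow> 'a \<Rightarrow> 'a pmap" where
  "elementary_map \<alpha> P \<beta> v = (const2 \<alpha> * X2 + in_y P, const2 \<beta> * Y2 + const2 v)"

definition elementary_maps :: "'a::field pmap set" where
  "elementary_maps = {elementary_map \<alpha> P \<beta> v | \<alpha> P \<beta> v. \<alpha> * \<beta> \<noteq> 0}"

definition basic_maps :: "'a::field pmap set" where
  "basic_maps = affine_maps \<inter> elementary_maps"

definition I_maps :: "'a::field pmap set" where
  "I_maps = {linear_map (matrix22 0 1 1 \<beta>) | \<beta>. True}"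

definition shear :: "'a::field poly \<Rightarrow> 'a pmap" where
  "shear P = (X2 + Y2 ^ 2 * in_y P, Y2)"

definition J_maps :: "'a::field pmap set" where
  "J_maps = {shear P | P. P \<noteq> 0}"

definition odd_poly :: "'a::comm_ring_1 poly \<Rightarrow> bool" where
  "odd_poly P \<longleftrightarrow> pcompose P [:0, -1:] = - P"

definition odd_J_maps :: "'a::field pmap set" where
  "odd_J_maps = {shear P | P. P \<noteq> 0 \<and> odd_poly P}"

definition J_degree :: "'a::field pmap \<Rightarrow> nat" where
  "J_degree e = (THE d. \<exists>P. P \<noteq> 0 \<and> e = shear P \<and> d = 2 + degree P)"

text \<open>
  A list \<open>[g\<^sub>1, \<dots>, g\<^sub>n]\<close> stands for \<open>g\<^sub>1 \<circ> \<dots> \<circ> g\<^sub>n\<close>. A normal form is a map in \<open>basic_maps\<close>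
  followed by an alternating list; whether the list begins with a map in \<open>I_maps\<close> and ends
  with one in \<open>J_maps\<close> is left open, so the first and last factors may be missing.
\<close>

definition comp_list :: "'a::field pmap list \<Rightarrow> 'a pmap" where
  "comp_list ws = foldr (\<lambda>g h. g \<otimes>\<^bsub>GA2\<^esub> h) ws \<one>\<^bsub>GA2\<^esub>"

definition alternating :: "'a::field pmap list \<Rightarrow> bool" where
  "alternating ws \<longleftrightarrow> set ws \<subseteq> I_maps \<union> J_maps \<and>
     successively (\<lambda>g h. (g \<in> I_maps \<and> h \<in> J_maps) \<or> (g \<in> J_maps \<and> h \<in> I_maps)) ws"

definition is_normal_form :: "'a::field pmap \<Rightarrow> 'a pmap \<times> 'a pmap list \<Rightarrow> bool" where
  "is_normal_form g nf \<longleftrightarrow> fst nf \<in> basic_maps \<and> alternating (snd nf) \<and>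
     g = fst nf \<otimes>\<^bsub>GA2\<^esub> comp_list (snd nf)"

definition normal_form :: "'a::field pmap \<Rightarrow> 'a pmap \<times> 'a pmap list" where
  "normal_form g = (THE nf. is_normal_form g nf)"

definition nf_length :: "'a::field pmap \<Rightarrow> nat" where
  "nf_length g = length (snd (normal_form g))"

definition pol_deg :: "'a::field pmap \<Rightarrow> nat list" where
  "pol_deg g = map J_degree (filter (\<lambda>h. h \<in> J_maps) (snd (normal_form g)))"

definition cyclically_reduced :: "'a::field pmap \<Rightarrow> bool" where
  "cyclically_reduced g \<longleftrightarrow> g \<in> carrier GA2 \<and> even (nf_length g) \<and> nf_length g > 0"

definition conjugate :: "'a::field pmap \<Rightarrow> 'a pmap \<Rightarrow> bool" where
  "conjugate f g \<longleftrightarrow> f \<in> carrier GA2 \<and> g \<in> carrier GA2 \<and>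
     (\<exists>h \<in> carrier GA2. g = h \<otimes>\<^bsub>GA2\<^esub> f \<otimes>\<^bsub>GA2\<^esub> inv\<^bsub>GA2\<^esub> h)"

definition CR_element :: "'a::field pmap \<Rightarrow> bool" where
  "CR_element f \<longleftrightarrow> (\<exists>g. cyclically_reduced g \<and> conjugate f g)"

definition reversor :: "'a::field pmap \<Rightarrow> 'a pmap \<Rightarrow> bool" where
  "reversor f r \<longleftrightarrow> r \<in> carrier GA2 \<and> r \<otimes>\<^bsub>GA2\<^esub> f \<otimes>\<^bsub>GA2\<^esub> inv\<^bsub>GA2\<^esub> r = inv\<^bsub>GA2\<^esub> f"

definition has_reversor_of_order_4 :: "'a::field pmap \<Rightarrow> bool" where
  "has_reversor_of_order_4 f \<longleftrightarrow> (\<exists>r. reversor f r \<and> group.ord GA2 r = 4)"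

definition roots_of_unity :: "'a::field set" where
  "roots_of_unity = {z. \<exists>n>0. z ^ n = 1}"

definition primitive_root_of_unity :: "nat \<Rightarrow> 'a::field \<Rightarrow> bool" where
  "primitive_root_of_unity n z \<longleftrightarrow> n > 0 \<and> z ^ n = 1 \<and> (\<forall>k. 0 < k \<and> k < n \<longrightarrow> z ^ k \<noteq> 1)"

definition R1 :: "'a::field pmap" where
  "R1 = linear_map (matrix22 0 (-1) 1 0)"

definition R2 :: "'a::field \<Rightarrow> 'a \<Rightarrow> 'a pmap" where
  "R2 \<alpha> \<gamma> = linear_map (matrix22 \<alpha> (- (\<alpha>\<^sup>2 + 1) / \<gamma>) \<gamma> (- \<alpha>))"

text \<open>The list \<open>e\<^sub>m, a\<^sub>m\<^sub>-\<^sub>1, e\<^sub>m\<^sub>-\<^sub>1, \<dots>, a\<^sub>1, e\<^sub>1\<close>.\<close>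

definition half_word :: "nat \<Rightarrow> (nat \<Rightarrow> 'a pmap) \<Rightarrow> (nat \<Rightarrow> 'a pmap) \<Rightarrow> 'a::field pmap list" where
  "half_word m a e = e m # concat (map (\<lambda>i. [a i, e i]) (rev [1..<m]))"

definition reversible_form ::
    "nat \<Rightarrow> (nat \<Rightarrow> 'a pmap) \<Rightarrow> (nat \<Rightarrow> 'a pmap) \<Rightarrow> 'a \<Rightarrow> 'a \<Rightarrow> 'a::field pmap" where
  "reversible_form m a e \<alpha> \<gamma> =
     comp_list (half_word m a e @ [R1] @ map (\<lambda>g. inv\<^bsub>GA2\<^esub> g) (rev (half_word m a e)) @ [R2 \<alpha> \<gamma>])"

definition admissible :: "nat \<Rightarrow> (nat \<Rightarrow> 'a pmap) \<Rightarrow> (nat \<Rightarrow> 'a pmap) \<Rightarrow> 'a::field \<Rightarrow> bool" where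
  "admissible m a e \<gamma> \<longleftrightarrow> 1 \<le> m \<and> (\<forall>i\<in>{1..<m}. a i \<in> I_maps) \<and>
     (\<forall>i\<in>{1..m}. e i \<in> odd_J_maps) \<and> \<gamma> \<noteq> 0"

text \<open>The list \<open>n\<^sub>m, \<dots>, n\<^sub>1, n\<^sub>1, \<dots>, n\<^sub>m\<close>.\<close>

definition mirror_list :: "nat \<Rightarrow> (nat \<Rightarrow> nat) \<Rightarrow> nat list" where
  "mirror_list m n = map n (rev [1..<Suc m]) @ map n [1..<Suc m]"

definition neg_map :: "'a::field \<Rightarrow> 'a \<Rightarrow> 'a pmap" where
  "neg_map u v = (- X2 + const2 u, - Y2 + const2 v)"

lemma poly_map_poly_pCons:
  assumes "h 0 = (0::'b::comm_ring_1)"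
  shows "poly (map_poly h (pCons c p)) A = h c + A * poly (map_poly h p) A"
  using assms by (simp add: map_poly_pCons)

lemma poly_map_poly_add:
  fixes h :: "'a::comm_ring_1 \<Rightarrow> 'b::comm_ring_1"
  assumes "h 0 = 0" and "\<And>a b. h (a + b) = h a + h b"
  shows "poly (map_poly h (p + q)) A = poly (map_poly h p) A + poly (map_poly h q) A"
proof -
  have "map_poly h (p + q) = map_poly h p + map_poly h q"
    by (rule poly_eqI) (simp add: coeff_map_poly assms)
  then show ?thesis by simp
qed

lemma poly_map_poly_mult:
  fixes h :: "'a::comm_ring_1 \<Rightarrow> 'b::comm_ring_1"
  assumes "h 0 = 0" and "\<And>a b. h (a + b) = h a + h b" and "\<And>a b. h (a * b) = h a * h b"
  shows "poly (map_poly h (p * q)) A = poly (map_poly h p) A * poly (map_poly h q) A"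
proof (induction p)
  case 0
  then show ?case by simp
next
  case (pCons c p)
  have "map_poly h (smult c q) = smult (h c) (map_poly h q)"
    by (rule poly_eqI) (simp add: coeff_map_poly assms)
  then show ?case
    by (simp add: poly_map_poly_add[of h, OF assms(1,2)] poly_map_poly_pCons[of h, OF assms(1)]
        pCons.IH assms(1) algebra_simps)
qed

lemma const2_simps [simp]:
  "const2 0 = 0" "const2 1 = 1" "const2 (a + b) = const2 a + const2 b"
  "const2 (a * b) = const2 a * const2 b"
  by (auto simp: const2_def one_pCons)

lemma subst_x_simps [simp]:
  "subst_x 0 A = 0" "subst_x 1 A = 1" "subst_x (p + q) A = subst_x p A + subst_x q A"
  "subst_x (p * q) A = subst_x p A * subst_x q A"
  "subst_x (pCons c p) A = const2 c + A * subst_x p A"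
  by (simp_all add: subst_x_def poly_map_poly_add poly_map_poly_mult poly_map_poly_pCons)

lemma subst2_simps [simp]:
  "subst2 0 g = 0" "subst2 1 g = 1" "subst2 (P + Q) g = subst2 P g + subst2 Q g"
  "subst2 (P * Q) g = subst2 P g * subst2 Q g"
  "subst2 (pCons q P) g = subst_x q (fst g) + snd g * subst2 P g"
  by (simp_all add: subst2_def poly_map_poly_add poly_map_poly_mult poly_map_poly_pCons)

lemma subst2_const2 [simp]: "subst2 (const2 c) g = const2 c"
  by (simp add: const2_def)

lemma subst2_subst_x: "subst2 (subst_x q A) k = subst_x q (subst2 A k)"
  by (induction q) simp_all

lemma subst2_subst2: "subst2 (subst2 P g) k = subst2 P (pmap_comp g k)"
  by (induction P) (simp_all add: subst2_subst_x, simp_all add: pmap_comp_def)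

lemma subst2_id: "subst2 P pmap_id = P"
proof -
  have x: "subst_x q X2 = [:q:]" for q :: "'a poly"
    by (induction q) (simp_all add: X2_def const2_def)
  show ?thesis
    by (induction P) (simp_all add: x pmap_id_def Y2_def)
qed

lemma subst2_vars: "subst2 X2 g = fst g" "subst2 Y2 g = snd g"
  by (simp_all add: X2_def Y2_def)

lemma monoid_End2: "Group.monoid End2"
  by (rule monoidI)
    (auto simp: End2_def pmap_comp_def subst2_subst2 subst2_id subst2_vars,
      auto simp: pmap_id_def subst2_vars)

lemma group_GA2: "group GA2"
  unfolding GA2_def by (rule monoid.units_group[OF monoid_End2])

end

theory Submission
  imports Defs
begin

text \<open>
  Let \<open>u \<mapsto> P, v \<mapsto> Q\<close> be an automorphism of \<open>K[x,y]\<close> with inverse \<open>x \<mapsto> S, y \<mapsto> T\<close>, and let \<open>m\<close> be the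
  \<open>y\<close>-degree of \<open>P\<close>. Counting linearly independent monomials \<open>u\<^sup>b v\<^sup>c\<close> shows that \<open>m\<close> is also the
  \<open>v\<close>-degree of \<open>S\<close>, that the leading coefficients of \<open>P\<close> and \<open>S\<close> are constants, and that
  \<open>deg\<^sub>y G(P, Q) \<ge> m deg\<^sub>u (lc\<^sub>v G)\<close> for every \<open>G\<close>. Applied to both directions, this bound makes
  the polynomials \<open>G\<close> of \<open>v\<close>-degree less than \<open>m\<close> with \<open>deg\<^sub>y G(P, Q) < m\<close> an \<open>m\<close>-dimensional space with
  constant leading coefficients. For \<open>m \<ge> 2\<close> it therefore contains some \<open>\<kappa> v + g(u)\<close>, and replacing
  \<open>(P, Q)\<close> by \<open>(\<kappa> Q + g(P), P)\<close> lowers the degree. This proves the theorem of Jung and van der Kulk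
  over any field.

  In the amalgamated product of the affine and the elementary maps, an element of finite order is
  conjugate to an element of a factor, and conjugate cyclically reduced elements are, up to conjugation by
  \<open>basic_maps\<close>, rotations of each other. If \<open>r\<close> is a reversor of order four of
  \<open>f\<close>, then so is \<open>r f\<close>, and \<open>(r f)\<^sup>2 = r\<^sup>2\<close>. The
  elementary maps contain no elements of order four because \<open>K\<close> has no square root of
  \<open>- 1\<close>; so \<open>r\<close> and \<open>r f\<close> are conjugates of affine maps whose
  squares are conjugates of \<open>- 1\<close>, and \<open>f = r\<^sup>-\<^sup>1 (r f)\<close> is the
  product of two such maps with a common square.
\<close>

section \<open>Degrees of a pair of inverse polynomial maps\<close>

text \<open>The counting uses only dimensions and leading coefficients, never points of the plane or
  division by integers, so it works over finite fields and in every characteristic. The hypotheses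
  on \<open>K\<close> enter through affine maps of order four. Their linear part \<open>M\<close>
  has \<open>M^4 = 1\<close>, and as \<open>det M\<close> is no square root of \<open>-1\<close>,
  \<open>det (M^2) = 1\<close>; this leaves \<open>M^2 = -1\<close>, that is trace 0 and determinant
  1, the shape of \<open>R2\<close>. Moreover \<open>(1 - M) (1 + M) = 2\<close> is invertible,
  which yields fixed points and removes translations. The basis \<open>e1, M e1\<close> turns
  \<open>M\<close> into \<open>R1\<close> and is triangular, so one of the two factors can be
  normalised completely, by pushing a basic map leftward through the word between the factors. It
  ends up in the other factor, which therefore keeps two parameters \<open>\<alpha>\<close> and
  \<open>\<gamma>\<close>. After that the word carries \<open>-1\<close> to an affine point
  reflection, and a shear commutes with \<open>-1\<close> exactly if its \<open>P\<close> is odd: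
  this is the source of the parity condition, and of the symmetry that every cyclically reduced
  conjugate retains.\<close>

lemma nontrivial_dependency:
  fixes f :: "'i \<Rightarrow> 'j \<Rightarrow> 'a::idom"
  assumes "finite J" "finite I" "card J < card I"
  shows "\<exists>c. (\<exists>i\<in>I. c i \<noteq> 0) \<and> (\<forall>j\<in>J. (\<Sum>i\<in>I. c i * f i j) = 0)"
  using assms
proof (induction J arbitrary: I f rule: finite_induct)
  case empty
  then have "I \<noteq> {}" by auto
  then show ?case by (intro exI[of _ "\<lambda>_. 1"]) auto
next
  case (insert j J)
  show ?case
  proof (cases "\<forall>i\<in>I. f i j = 0")
    case True
    have "card J < card I" using insert by simp
    then obtain c where c: "\<exists>i\<in>I. c i \<noteq> 0" "\<forall>j\<in>J. (\<Sum>i\<in>I. c i * f i j) = 0"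
      using insert.IH[of I f] insert.prems by blast
    then show ?thesis using True by (intro exI[of _ c]) auto
  next
    case False
    then obtain i0 where i0: "i0 \<in> I" "f i0 j \<noteq> 0" by auto
    \<comment> \<open>Elimination by cross-multiplication instead of division, because the
      coefficients will also come from \<open>K[x]\<close>. Column \<open>j\<close> of the new rows
      vanishes.\<close>
    define g where "g i k = f i0 j * f i k - f i j * f i0 k" for i k
    have "card J < card (I - {i0})"
      using insert i0 by simp
    then obtain c where c: "\<exists>i\<in>I - {i0}. c i \<noteq> 0"
        "\<forall>k\<in>J. (\<Sum>i\<in>I - {i0}. c i * g i k) = 0"
      using insert.IH[of "I - {i0}" g] insert.prems by blast
    define c' where "c' i = (if i = i0 then - (\<Sum>i\<in>I - {i0}. c i * f i j) else c i * f i0 j)" for i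
    have split: "(\<Sum>i\<in>I. c' i * f i k) =
        (\<Sum>i\<in>I - {i0}. c i * f i0 j * f i k) - (\<Sum>i\<in>I - {i0}. c i * f i j) * f i0 k" for k
    proof -
      have "(\<Sum>i\<in>I. c' i * f i k) = c' i0 * f i0 k + (\<Sum>i\<in>I - {i0}. c' i * f i k)"
        using insert.prems i0 by (simp add: sum.remove)
      also have "(\<Sum>i\<in>I - {i0}. c' i * f i k) = (\<Sum>i\<in>I - {i0}. c i * f i0 j * f i k)"
        by (intro sum.cong) (auto simp: c'_def)
      finally show ?thesis by (simp add: c'_def)
    qed
    have "(\<Sum>i\<in>I. c' i * f i j) = 0"
      unfolding split by (simp add: sum_distrib_left mult_ac)
    moreover have "(\<Sum>i\<in>I. c' i * f i k) = 0" if "k \<in> J" for k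
    proof -
      have "(\<Sum>i\<in>I. c' i * f i k) = (\<Sum>i\<in>I - {i0}. c i * g i k)"
        unfolding split g_def by (simp add: sum_distrib_left sum_subtractf algebra_simps)
      then show ?thesis using c that by simp
    qed
    moreover have "\<exists>i\<in>I. c' i \<noteq> 0"
      using c i0 by (auto simp: c'_def)
    ultimately show ?thesis by (intro exI[of _ c']) auto
  qed
qed

text \<open>The coefficients of \<open>H\<close> are digits in base \<open>S\<close>. As every digit
  has degree below \<open>degree S\<close>, the term with the highest power of \<open>S\<close>
  outweighs all others, and neither its degree nor its leading coefficient is disturbed.\<close>

lemma poly_digits_degree:
  fixes S :: "'a::idom poly" and H :: "'a poly poly"
  assumes "degree S > 0" and "\<And>i. degree (coeff H i) < degree S" and "H \<noteq> 0"
  shows "degree (poly H S) = degree S * degree H + degree (lead_coeff H) \<and>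
    lead_coeff (poly H S) = lead_coeff (lead_coeff H) * lead_coeff S ^ degree H"
  using assms(2,3)
proof (induction H)
  case 0
  then show ?case by simp
next
  case (pCons h H)
  have dh: "degree h < degree S" using pCons.prems(1)[of 0] by simp
  have dH: "degree (coeff H i) < degree S" for i using pCons.prems(1)[of "Suc i"] by simp
  show ?case
  proof (cases "H = 0")
    case True
    then show ?thesis by simp
  next
    case False
    note IH = pCons.IH[OF dH False]
    have S0: "S \<noteq> 0" using assms(1) by auto
    have "lead_coeff (poly H S) \<noteq> 0"
      using IH False S0 by auto
    then have n0: "poly H S \<noteq> 0" by auto
    have d: "degree (S * poly H S) = degree S + degree (poly H S)"
      using S0 n0 by (simp add: degree_mult_eq)
    then have lt: "degree h < degree (S * poly H S)" using dh by simp
    have "degree (h + S * poly H S) = degree (S * poly H S)"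
      using lt by (simp add: degree_add_eq_right)
    moreover have "lead_coeff (h + S * poly H S) = lead_coeff (S * poly H S)"
      using lt by (simp add: degree_add_eq_right coeff_eq_0)
    moreover have "lead_coeff (S * poly H S) = lead_coeff S * lead_coeff (poly H S)"
      by (rule lead_coeff_mult)
    ultimately have A: "degree (poly (pCons h H) S) = degree S + degree (poly H S)"
      "lead_coeff (poly (pCons h H) S) = lead_coeff S * lead_coeff (poly H S)"
      using d by (simp_all only: poly_pCons)
    have B: "degree (pCons h H) = Suc (degree H)" using False by simp
    have "degree (poly (pCons h H) S) = degree S + (degree S * degree H + degree (lead_coeff H))"
      by (rule trans[OF A(1)]) (simp only: conjunct1[OF IH])
    moreover have "lead_coeff (poly (pCons h H) S) =
        lead_coeff S * (lead_coeff (lead_coeff H) * lead_coeff S ^ degree H)"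
      by (rule trans[OF A(2)]) (simp only: conjunct2[OF IH])
    ultimately show ?thesis
      by (simp only: B coeff_pCons_Suc mult_Suc_right power_Suc mult_ac add_ac)
  qed
qed

text \<open>Repeated division by \<open>S\<close>. The coefficients only form a domain, so each
  division is a pseudo-division, and the inverse \<open>k\<close> of the leading coefficient cancels
  the factor that it introduces.\<close>

lemma poly_digits_exist:
  fixes S G :: "'a::idom poly"
  assumes "degree S > 0" and k: "lead_coeff S * k = 1"
  shows "\<exists>H. (\<forall>i. degree (coeff H i) < degree S) \<and> poly H S = G"
proof (induction "degree G" arbitrary: G rule: less_induct)
  case less
  show ?case
  proof (cases "degree G < degree S")
    case True
    then show ?thesis using assms(1)
      by (intro exI[of _ "[:G:]"]) (auto simp: coeff_pCons split: nat.split)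
  next
    case False
    have S0: "S \<noteq> 0" using assms(1) by auto
    obtain q r where qr: "pseudo_divmod G S = (q, r)" by (cases "pseudo_divmod G S")
    define n where "n = Suc (degree G) - degree S"
    from pseudo_divmod[OF S0 qr]
    have e: "smult (lead_coeff S ^ n) G = S * q + r" and r: "r = 0 \<or> degree r < degree S"
      by (auto simp: n_def)
    define q' r' where "q' = smult (k ^ n) q" and "r' = smult (k ^ n) r"
    have "smult (k ^ n) (smult (lead_coeff S ^ n) G) = S * q' + r'"
      unfolding e q'_def r'_def by (simp add: smult_add_right)
    moreover have "k ^ n * lead_coeff S ^ n = 1"
      using k by (metis mult.commute power_mult_distrib power_one)
    ultimately have G: "G = S * q' + r'" by simp
    have r': "degree r' < degree S" using r assms(1) by (auto simp: r'_def)
    have q0: "q' \<noteq> 0" using G r' False by auto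
    then have d: "degree (S * q') = degree S + degree q'" using S0 by (simp add: degree_mult_eq)
    then have "degree G = degree S + degree q'"
      using G r' by (simp add: degree_add_eq_left)
    then have "degree q' < degree G" using assms(1) by simp
    from less[OF this] obtain H where H: "\<forall>i. degree (coeff H i) < degree S" "poly H S = q'" by auto
    then show ?thesis using r' G
      by (intro exI[of _ "pCons r' H"]) (auto simp: coeff_pCons split: nat.split)
  qed
qed

section \<open>Substitution and pairs of inverse maps\<close>

lemma subst2_sum: "subst2 (sum f I) g = (\<Sum>i\<in>I. subst2 (f i) g)"
  by (induction I rule: infinite_finite_induct) simp_all

lemma subst2_power: "subst2 (P ^ n) g = subst2 P g ^ n"
  by (induction n) simp_all

lemma subst2_uminus: "subst2 (- P) g = - subst2 P g"
  using subst2_simps(3)[of P "- P" g] by (simp add: eq_neg_iff_add_eq_0 add.commute)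

lemma subst2_diff: "subst2 (P - Q) g = subst2 P g - subst2 Q g"
  using subst2_simps(3)[of P "- Q" g] by (simp add: subst2_uminus)

lemma subst2_monom:
  "subst2 (monom (monom a b) c) g = const2 a * fst g ^ b * snd g ^ c"
proof -
  have "subst_x (monom a b) A = const2 a * A ^ b" for A :: "'a poly poly"
    by (induction b) (auto simp: monom_0 monom_Suc mult_ac)
  then show ?thesis by (induction c) (auto simp: monom_0 monom_Suc mult_ac)
qed

lemma subst2_const_poly: "subst2 [:a:] g = subst_x a (fst g)"
  by simp

definition inverse_pair :: "'a::comm_ring_1 pmap \<Rightarrow> 'a pmap \<Rightarrow> bool" where
  "inverse_pair p q \<longleftrightarrow> pmap_comp p q = pmap_id \<and> pmap_comp q p = pmap_id"

lemma inverse_pair_sym: "inverse_pair p q \<Longrightarrow> inverse_pair q p"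
  by (simp add: inverse_pair_def)

lemma inverse_pairD:
  assumes "inverse_pair p q"
  shows "subst2 (subst2 G p) q = G" "subst2 (subst2 G q) p = G"
    "subst2 (fst p) q = X2" "subst2 (snd p) q = Y2" "subst2 (fst q) p = X2" "subst2 (snd q) p = Y2"
  using assms by (auto simp: inverse_pair_def subst2_subst2 subst2_id)
    (auto simp: pmap_comp_def pmap_id_def)

section \<open>Degree bounds from counting monomials\<close>

lemma degree_mult_power_le:
  fixes P Q :: "'a::comm_ring_1 poly"
  shows "degree (P ^ b * Q ^ c) \<le> b * degree P + c * degree Q"
  by (meson add_mono degree_mult_le degree_power_le mult.commute le_trans
      order.trans[OF degree_mult_le] degree_power_le[of P b, unfolded mult.commute[of "degree P"]]
      degree_power_le[of Q c, unfolded mult.commute[of "degree Q"]])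

lemma coeff_monom_box:
  "coeff (coeff (\<Sum>(b, c)\<in>{..<B} \<times> {..<M}. monom (monom (k (b, c)) b) c) c') b' =
    (if b' < B \<and> c' < M then k (b', c') else 0)"
proof -
  have "coeff (coeff (\<Sum>(b, c)\<in>{..<B} \<times> {..<M}. monom (monom (k (b, c)) b) c) c') b' =
      (\<Sum>i\<in>{..<B} \<times> {..<M}. if i = (b', c') then k (b', c') else 0)"
    unfolding coeff_sum by (intro sum.cong) (auto split: if_splits)
  then show ?thesis by (subst (asm) sum.delta) auto
qed

text \<open>For \<open>p = (P, Q)\<close> and \<open>q = (S, T)\<close> a sum of terms
  \<open>\<alpha>(x) P^b Q^c\<close> pulls back to the sum of the
  \<open>\<alpha>(S) u^b v^c\<close>. Sorted by powers of \<open>S\<close>, its coefficients have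
  \<open>v\<close>-degree below \<open>M\<close>, so they are digits in base \<open>S\<close> and
  cannot cancel. The polynomial \<open>l\<close> in \<open>u\<close> is the leading coefficient of
  the top digit. In particular the products are independent over \<open>K[x]\<close>.\<close>

lemma box_pullback:
  fixes \<alpha> :: "nat \<times> nat \<Rightarrow> 'a::field poly"
  assumes inv: "inverse_pair p q"
    and S: "degree (fst q) > 0" and M: "M \<le> degree (fst q)"
    and nz: "\<exists>i \<in> {..<B} \<times> {..<M}. \<alpha> i \<noteq> 0"
  shows "\<exists>l N. l \<noteq> 0 \<and> degree l < B \<and>
    lead_coeff (subst2 (\<Sum>(b, c)\<in>{..<B} \<times> {..<M}. smult (\<alpha> (b, c)) (fst p ^ b * snd p ^ c)) q)
      = l * lead_coeff (fst q) ^ N"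
proof -
  let ?I = "{..<B} \<times> {..<M}" and ?S = "fst q"
  \<comment> \<open>\<open>H\<close> has one more variable, which will be replaced by
    \<open>S\<close>: its coefficient number \<open>t\<close> collects the coefficients number
    \<open>t\<close> of all \<open>\<alpha> (b, c)\<close>.\<close>
  define H where "H = (\<Sum>(b, c)\<in>?I. smult (monom (monom 1 b) c) (map_poly const2 (\<alpha> (b, c))))"
  have "subst2 (\<Sum>(b, c)\<in>?I. smult (\<alpha> (b, c)) (fst p ^ b * snd p ^ c)) q =
      (\<Sum>(b, c)\<in>?I. subst_x (\<alpha> (b, c)) ?S * (monom (monom 1 b) c))"
  proof -
    have "subst2 (smult (\<alpha> (b, c)) (fst p ^ b * snd p ^ c)) q
        = subst_x (\<alpha> (b, c)) ?S * (monom (monom 1 b) c)" for b c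
    proof -
      have "subst2 (fst p ^ b * snd p ^ c) q = monom (monom 1 b) c"
        using inverse_pairD(1)[OF inv, of "monom (monom 1 b) c"] by (simp add: subst2_monom)
      moreover have "smult (\<alpha> (b, c)) (fst p ^ b * snd p ^ c) = [:\<alpha> (b, c):] * (fst p ^ b * snd p ^ c)"
        by simp
      ultimately show ?thesis by (simp only: subst2_simps(4) subst2_const_poly)
    qed
    then show ?thesis by (simp only: subst2_sum case_prod_unfold)
  qed
  also have "\<dots> = poly H ?S"
    unfolding H_def by (simp add: poly_sum subst_x_def case_prod_unfold mult.commute)
  finally have W: "subst2 (\<Sum>(b, c)\<in>?I. smult (\<alpha> (b, c)) (fst p ^ b * snd p ^ c)) q = poly H ?S" .
  have cH: "coeff H t = (\<Sum>(b, c)\<in>?I. monom (monom (coeff (\<alpha> (b, c)) t) b) c)" for t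
    unfolding H_def
    by (simp add: coeff_sum case_prod_unfold coeff_map_poly const2_def smult_monom mult.commute)
  have cc: "coeff (coeff (coeff H t) c) b = (if b < B \<and> c < M then coeff (\<alpha> (b, c)) t else 0)" for t b c
    unfolding cH by (rule coeff_monom_box)
  have Mpos: "M > 0" using nz by auto
  have dH: "degree (coeff H t) < M" for t
  proof -
    have "coeff (coeff H t) c = 0" if "c \<ge> M" for c
      using that by (intro poly_eqI) (simp add: cc)
    then show ?thesis using Mpos by (meson coeff_eq_0 degree_lessI not_less)
  qed
  have H0: "H \<noteq> 0"
  proof
    assume "H = 0"
    then have "coeff (\<alpha> (b, c)) t = 0" if "b < B" "c < M" for b c t
      using cc[of t c b] that by simp
    then show False using nz by (auto simp: poly_eq_iff)
  qed
  define l where "l = lead_coeff (lead_coeff H)"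
  have l0: "l \<noteq> 0" using H0 by (simp add: l_def)
  have "degree l < B"
  proof -
    have "coeff l b = 0" if "b \<ge> B" for b
      using that unfolding l_def by (simp add: cc)
    then show ?thesis using l0 by (metis leading_coeff_0_iff not_less)
  qed
  moreover have "lead_coeff (poly H ?S) = l * lead_coeff ?S ^ degree H"
    unfolding l_def using poly_digits_degree[OF S _ H0] dH M by (meson order_less_le_trans)
  ultimately show ?thesis using l0 W by metis
qed

text \<open>
  The products \<open>P\<^sup>b Q\<^sup>c\<close> with \<open>b < B\<close>, \<open>c < deg S\<close> are linearly independent over \<open>K[x]\<close>, and their number
  must not exceed a bound for their \<open>y\<close>-degrees that grows like \<open>B deg P\<close>.
\<close>

lemma inverse_degree_le:
  fixes p q :: "'a::field pmap"
  assumes inv: "inverse_pair p q"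
  shows "degree (fst q) \<le> degree (fst p)"
proof (rule ccontr)
  assume lt: "\<not> ?thesis"
  define M m n where "M = degree (fst q)" and "m = degree (fst p)" and "n = degree (snd p)"
  \<comment> \<open>With \<open>N = (M - 1) * n\<close> there are
    \<open>B * M \<ge> (N + 2) * (m + 1)\<close> products, more than the
    \<open>E + 1 = (N + 1) * m + N + 1\<close> coefficients that they can have.\<close>
  define B where "B = (M - 1) * n + 2"
  define E where "E = (B - 1) * m + (M - 1) * n"
  let ?I = "{..<B} \<times> {..<M}"
  have Mm: "M \<ge> m + 1" using lt by (simp add: M_def m_def)
  have "B * (m + 1) \<le> B * M" using Mm by (rule mult_le_mono2)
  moreover have "(B - 1) * m + (M - 1) * n + 1 < B * (m + 1)"
  proof -
    have "(K + 2 - 1) * m + K + 1 < (K + 2) * (m + 1)" for K :: nat by simp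
    then show ?thesis by (simp only: B_def)
  qed
  ultimately have "card {..E} < card ?I" by (simp add: E_def)
  from nontrivial_dependency[OF _ _ this, of "\<lambda>(b, c) j. coeff (fst p ^ b * snd p ^ c) j"]
  obtain \<alpha> where a: "\<exists>i\<in>?I. \<alpha> i \<noteq> 0"
    "\<forall>j\<le>E. (\<Sum>i\<in>?I. \<alpha> i * (case i of (b, c) \<Rightarrow> \<lambda>j. coeff (fst p ^ b * snd p ^ c) j) j) = 0" by auto
  define Z where "Z = (\<Sum>(b, c)\<in>?I. smult (\<alpha> (b, c)) (fst p ^ b * snd p ^ c))"
  have "coeff Z j = 0" for j
  proof (cases "j \<le> E")
    case True
    then show ?thesis using a(2) by (simp add: Z_def coeff_sum case_prod_unfold)
  next
    case False
    have "coeff (fst p ^ b * snd p ^ c) j = 0" if "b < B" "c < M" for b c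
    proof -
      have "degree (fst p ^ b * snd p ^ c) \<le> b * m + c * n"
        unfolding m_def n_def by (rule degree_mult_power_le)
      also have "\<dots> \<le> E" unfolding E_def
        using that by (intro add_mono mult_le_mono1) auto
      finally show ?thesis using False by (intro coeff_eq_0) simp
    qed
    then show ?thesis by (auto simp: Z_def coeff_sum case_prod_unfold intro!: sum.neutral)
  qed
  then have "Z = 0" by (intro poly_eqI) simp
  moreover have "\<exists>l N. l \<noteq> 0 \<and> degree l < B \<and> lead_coeff (subst2 Z q) = l * lead_coeff (fst q) ^ N"
    unfolding Z_def using box_pullback[OF inv _ _ a(1)] Mm by (simp add: M_def)
  ultimately show False using Mm by (auto simp: M_def)
qed

lemma inverse_degree_eq:
  fixes p q :: "'a::field pmap"
  assumes "inverse_pair p q"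
  shows "degree (fst q) = degree (fst p)"
  using inverse_degree_le[OF assms] inverse_degree_le[OF inverse_pair_sym[OF assms]] by simp

lemma degree_subst_x:
  fixes a :: "'a::field poly"
  assumes "degree S > 0"
  shows "degree (subst_x a S) = degree S * degree a"
proof (cases "a = 0")
  case False
  have "degree (map_poly const2 a) = degree a"
    by (rule degree_map_poly) (auto simp: const2_def)
  moreover have "degree (coeff (map_poly const2 a) i) = 0" for i
    by (simp add: coeff_map_poly const2_def)
  moreover have "map_poly const2 a \<noteq> 0"
    using False by (metis coeff_0 coeff_map_poly const2_def const2_simps(1) leading_coeff_0_iff pCons_eq_0_iff)
  ultimately show ?thesis
    using poly_digits_degree[of S "map_poly const2 a"] assms by (simp add: subst_x_def)
qed simp

text \<open>
  Modulo a nonconstant leading coefficient \<open>a(x)\<close> of \<open>P\<close> the degree of \<open>P\<close> drops, whereas \<open>a(S)\<close> has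
  \<open>v\<close>-degree \<open>deg a deg S\<close>; the same count, now over \<open>K\<close> and modulo \<open>a\<close>, is contradictory.
\<close>

lemma inverse_lead_coeff_const:
  fixes p q :: "'a::field pmap"
  assumes inv: "inverse_pair p q" and pos: "degree (fst p) > 0"
  shows "degree (lead_coeff (fst p)) = 0"
proof (rule ccontr)
  assume "degree (lead_coeff (fst p)) \<noteq> 0"
  define P Q a where "P = fst p" and "Q = snd p" and "a = lead_coeff P"
  define m n al where "m = degree P" and "n = degree Q" and "al = degree a"
  have al: "al > 0" using \<open>degree (lead_coeff (fst p)) \<noteq> 0\<close> by (simp add: al_def a_def P_def)
  have m: "m > 0" using pos by (simp add: m_def P_def)
  have degS: "degree (fst q) = m"
    using inverse_degree_eq[OF inv] by (simp add: m_def P_def)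
  define P0 where "P0 = P - [:a:] * monom 1 m"
  have P0: "degree P0 \<le> m - 1"
  proof -
    have "coeff P0 j = 0" if "j > m - 1" for j
      using that m by (cases "j = m") (auto simp: P0_def a_def m_def coeff_eq_0)
    then show ?thesis using degree_le by blast
  qed
  \<comment> \<open>With coefficients in \<open>K\<close> the box may be wider than
    \<open>degree (fst q) = m\<close>, since independence over \<open>K\<close> is immediate from
    the inverse map. Each coefficient at a power of \<open>y\<close> costs \<open>al\<close>
    equations, one for every coefficient of its residue modulo \<open>a\<close>.\<close>
  define M where "M = al * m"
  define E where "E = (M * n + 1) * (m - 1) + M * n"
  define B where "B = M * n + 2"
  let ?I = "{..<B} \<times> {..<M}" and ?J = "{..E} \<times> {..<al}"
  have "E + 1 < B * m"
    using m unfolding E_def B_def by (cases m) (auto simp: algebra_simps)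
  then have "(E + 1) * al < B * m * al"
    using al by (intro mult_strict_right_mono) simp_all
  moreover have "card ?J = (E + 1) * al" "card ?I = B * m * al"
    by (simp_all add: M_def)
  ultimately have "card ?J < card ?I" by (simp only:)
  from nontrivial_dependency[OF _ _ this,
      of "\<lambda>(b, c) (j, i). coeff (coeff (P0 ^ b * Q ^ c) j mod a) i"]
  obtain k where k: "\<exists>i\<in>?I. k i \<noteq> 0"
    and k0: "\<And>j i. j \<le> E \<Longrightarrow> i < al \<Longrightarrow>
      (\<Sum>(b, c)\<in>?I. k (b, c) * coeff (coeff (P0 ^ b * Q ^ c) j mod a) i) = 0"
    by (auto simp: case_prod_unfold)
  define Z0 where "Z0 = (\<Sum>(b, c)\<in>?I. smult [:k (b, c):] (P0 ^ b * Q ^ c))"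
  define Z where "Z = (\<Sum>(b, c)\<in>?I. smult [:k (b, c):] (P ^ b * Q ^ c))"
  have "a dvd coeff Z0 j" for j
  proof (cases "j \<le> E")
    case True
    have mods: "(\<Sum>i\<in>A. g i) mod a = (\<Sum>i\<in>A. g i mod a)" for g :: "nat \<times> nat \<Rightarrow> 'a poly" and A
      by (induction A rule: infinite_finite_induct) (simp_all add: poly_mod_add_left)
    have "coeff Z0 j mod a = (\<Sum>(b, c)\<in>?I. smult (k (b, c)) (coeff (P0 ^ b * Q ^ c) j mod a))"
      by (simp add: Z0_def coeff_sum case_prod_unfold mods mod_smult_left)
    also have "\<dots> = 0"
    proof (rule poly_eqI)
      fix i
      show "coeff (\<Sum>(b, c)\<in>?I. smult (k (b, c)) (coeff (P0 ^ b * Q ^ c) j mod a)) i = coeff 0 i"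
      proof (cases "i < al")
        case True
        then show ?thesis using k0[OF \<open>j \<le> E\<close> True] by (simp add: coeff_sum case_prod_unfold)
      next
        case False
        have "degree (g mod a) < al" for g using al degree_mod_less'[of a g]
          by (metis al_def degree_0 degree_mod_less less_numeral_extra(3))
        then have "coeff (g mod a) i = 0" for g using False by (meson coeff_eq_0 le_trans not_less)
        then show ?thesis by (simp add: coeff_sum case_prod_unfold)
      qed
    qed
    finally show ?thesis by (simp add: dvd_eq_mod_eq_0)
  next
    case False
    have "coeff (P0 ^ b * Q ^ c) j = 0" if "b < B" "c < M" for b c
    proof -
      have "degree (P0 ^ b * Q ^ c) \<le> b * degree P0 + c * n"
        unfolding n_def by (rule degree_mult_power_le)
      also have "\<dots> \<le> (M * n + 1) * (m - 1) + M * n"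
        using that P0 by (intro add_mono mult_le_mono) (auto simp: B_def)
      finally show ?thesis using False by (intro coeff_eq_0) (simp add: E_def)
    qed
    then have "coeff Z0 j = 0" by (auto simp: Z0_def coeff_sum case_prod_unfold intro!: sum.neutral)
    then show ?thesis by simp
  qed
  then have "[:a:] dvd Z0" by (simp add: const_poly_dvd_iff)
  moreover have "[:a:] dvd Z - Z0"
  proof -
    have "[:a:] dvd P ^ b - P0 ^ b" for b
    proof -
      have "P - P0 dvd P ^ b - P0 ^ b"
        by (simp add: power_diff_sumr2)
      moreover have "[:a:] dvd P - P0"
        unfolding P0_def by (metis diff_diff_eq2 add_diff_cancel_left' dvd_triv_left)
      ultimately show ?thesis by (rule dvd_trans[rotated])
    qed
    then have "[:a:] dvd smult [:k (b, c):] ((P ^ b - P0 ^ b) * Q ^ c)" for b c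
      by (simp add: dvd_smult)
    then have "[:a:] dvd (\<Sum>(b, c)\<in>?I. smult [:k (b, c):] ((P ^ b - P0 ^ b) * Q ^ c))"
      by (auto simp: case_prod_unfold intro!: dvd_sum)
    also have "\<dots> = Z - Z0"
      by (simp add: Z_def Z0_def sum_subtractf[symmetric] case_prod_unfold left_diff_distrib smult_diff_right)
    finally show ?thesis .
  qed
  ultimately have "[:a:] dvd Z" using dvd_add[of "[:a:]" "Z - Z0" Z0] by simp
  then obtain V where V: "Z = [:a:] * V" by (rule dvdE)
  let ?W = "\<Sum>(b, c)\<in>?I. monom (monom (k (b, c)) b) c"
  have W: "subst2 Z q = ?W"
  proof -
    have "subst2 (smult [:k (b, c):] (P ^ b * Q ^ c)) q = monom (monom (k (b, c)) b) c" for b c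
    proof -
      have "smult [:k (b, c):] (P ^ b * Q ^ c) = subst2 (monom (monom (k (b, c)) b) c) p"
        by (simp add: subst2_monom P_def Q_def const2_def mult.assoc)
      then show ?thesis using inverse_pairD(1)[OF inv] by simp
    qed
    then show ?thesis by (simp only: Z_def subst2_sum case_prod_unfold)
  qed
  note cW = coeff_monom_box[of k B M]
  have W0: "?W \<noteq> 0"
  proof
    assume "?W = 0"
    then have "k (b, c) = 0" if "b < B" "c < M" for b c
      using cW[of c b] that by simp
    then show False using k by auto
  qed
  have "degree ?W < M"
  proof -
    have "coeff ?W c = 0" if "c \<ge> M" for c
      using that by (intro poly_eqI) (simp add: cW)
    then show ?thesis using W0 by (meson leading_coeff_0_iff not_less)
  qed
  moreover have "degree ?W \<ge> M"
  proof -
    have e: "?W = subst_x a (fst q) * subst2 V q"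
      using W V by (simp only: subst2_simps(4) subst2_const_poly)
    then have "degree ?W = degree (subst_x a (fst q)) + degree (subst2 V q)"
      using W0 by (metis degree_mult_eq mult_eq_0_iff)
    then show ?thesis
      using degree_subst_x[of "fst q" a] degS m by (simp add: M_def al_def mult.commute)
  qed
  ultimately show False by simp
qed

text \<open>
  Otherwise the products \<open>P\<^sup>b Q\<^sup>c\<close> with \<open>b < deg (lc G)\<close>, \<open>c < deg S\<close> are linearly dependent over \<open>K[x]\<close>
  modulo \<open>G(P, Q)\<close>. Pulled back, this is a multiple of \<open>G\<close> whose leading coefficient is too small.
\<close>

lemma degree_ge_lead_coeff:
  fixes p q :: "'a::field pmap"
  assumes inv: "inverse_pair p q" and G0: "G \<noteq> 0"
  shows "degree (fst p) * degree (lead_coeff G) \<le> degree (subst2 G p)"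
proof (rule ccontr)
  assume lt: "\<not> ?thesis"
  define m B d where "m = degree (fst p)" and "B = degree (lead_coeff G)" and "d = degree (subst2 G p)"
  have lt: "d < B * m" using lt by (simp add: m_def B_def d_def mult.commute)
  then have m: "m > 0" and B: "B > 0" by (auto intro: Nat.gr0I)
  have S: "degree (fst q) = m" using inverse_degree_eq[OF inv] by (simp add: m_def)
  have lS: "degree (lead_coeff (fst q)) = 0"
    using inverse_lead_coeff_const[OF inverse_pair_sym[OF inv]] S m by simp
  let ?G = "subst2 G p" and ?I = "{..<B} \<times> {..<m}"
  have G'0: "?G \<noteq> 0"
    using inverse_pairD(1)[OF inv, of G] G0 by auto
  \<comment> \<open>Pseudo-division, since \<open>?G\<close> need not have an invertible leading
    coefficient in \<open>y\<close>; the multipliers \<open>a i\<close> obtained below are nonzero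
    elements of \<open>K[x]\<close> and only rescale the dependency.\<close>
  let ?r = "\<lambda>(b, c). pseudo_mod (fst p ^ b * snd p ^ c) ?G"
  have "card {..<d} < card ?I" using lt by simp
  from nontrivial_dependency[OF _ _ this, of "\<lambda>i j. coeff (?r i) j"]
  obtain k where k: "\<exists>i\<in>?I. k i \<noteq> 0" and k0: "\<And>j. j < d \<Longrightarrow> (\<Sum>i\<in>?I. k i * coeff (?r i) j) = 0"
    by auto
  have "\<forall>i. \<exists>a q. a \<noteq> 0 \<and> smult a (case i of (b, c) \<Rightarrow> fst p ^ b * snd p ^ c) = ?G * q + ?r i"
    using pseudo_mod(1)[OF G'0] by (auto split: prod.split)
  then obtain a h where a: "\<And>i. a i \<noteq> 0"
    "\<And>i. smult (a i) (case i of (b, c) \<Rightarrow> fst p ^ b * snd p ^ c) = ?G * h i + ?r i"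
    by metis
  define \<alpha> where "\<alpha> i = k i * a i" for i
  have \<alpha>: "\<exists>i\<in>?I. \<alpha> i \<noteq> 0" using k a(1) by (auto simp: \<alpha>_def)
  define Z where "Z = (\<Sum>(b, c)\<in>?I. smult (\<alpha> (b, c)) (fst p ^ b * snd p ^ c))"
  have "Z = (\<Sum>i\<in>?I. smult (k i) (smult (a i) (case i of (b, c) \<Rightarrow> fst p ^ b * snd p ^ c)))"
    by (simp add: Z_def \<alpha>_def case_prod_unfold)
  also have "\<dots> = ?G * (\<Sum>i\<in>?I. smult (k i) (h i)) + (\<Sum>i\<in>?I. smult (k i) (?r i))"
    unfolding a(2) by (simp add: smult_add_right sum.distrib sum_distrib_left)
  also have "(\<Sum>i\<in>?I. smult (k i) (?r i)) = 0"
  proof (rule poly_eqI)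
    fix j
    show "coeff (\<Sum>i\<in>?I. smult (k i) (?r i)) j = coeff 0 j"
    proof (cases "j < d")
      case True
      then show ?thesis using k0 by (simp add: coeff_sum)
    next
      case False
      have "coeff (?r i) j = 0" for i
        using pseudo_mod(2)[OF G'0] False
        by (cases i) (metis (mono_tags, lifting) case_prod_conv coeff_0 coeff_eq_0 d_def
            linorder_not_less order_less_le_trans)
      then show ?thesis by (simp add: coeff_sum)
    qed
  qed
  finally have Z: "Z = ?G * (\<Sum>i\<in>?I. smult (k i) (h i))" by simp
  obtain l N where l: "l \<noteq> 0" "degree l < B" "lead_coeff (subst2 Z q) = l * lead_coeff (fst q) ^ N"
    using box_pullback[OF inv _ _ \<alpha>] S m unfolding Z_def by auto
  have "lead_coeff (fst q) \<noteq> 0" using S m by auto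
  then have nz: "lead_coeff (subst2 Z q) \<noteq> 0" using l by simp
  have "degree (lead_coeff (subst2 Z q)) < B"
  proof -
    have "degree (lead_coeff (fst q) ^ N) = 0"
      using lS by (metis degree_power_le le_zero_eq mult_zero_left)
    then show ?thesis using l by (metis add.right_neutral degree_mult_le le_less_trans)
  qed
  moreover have "degree (lead_coeff (subst2 Z q)) \<ge> B"
  proof -
    define C where "C = lead_coeff (subst2 (\<Sum>i\<in>?I. smult (k i) (h i)) q)"
    have e: "lead_coeff (subst2 Z q) = lead_coeff G * C"
      unfolding Z C_def by (simp only: subst2_simps(4) inverse_pairD(1)[OF inv] lead_coeff_mult)
    then have "C \<noteq> 0" using nz by (metis mult_zero_right)
    then show ?thesis unfolding e B_def using G0 by (simp add: degree_mult_eq)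
  qed
  ultimately show False by (rule leD[THEN notE, rotated])
qed

lemma subst2_poly:
  "subst2 (poly H S) p = (\<Sum>t\<le>degree H. subst2 (coeff H t) p * subst2 S p ^ t)"
  by (simp add: poly_altdef subst2_sum subst2_power)

lemma X2_power: "X2 ^ t = [:monom 1 t:]"
  by (induction t) (simp_all add: X2_def monom_Suc monom_0 one_pCons mult_ac)

text \<open>
  The digit comes from the \<open>S\<close>-adic expansion of \<open>T\<^sup>e\<close>: all digits have constant leading coefficients
  after substitution, so no cancellation occurs between different powers of \<open>S\<close>.
\<close>

lemma digit_of_degree:
  fixes p q :: "'a::field pmap"
  assumes inv: "inverse_pair p q" and m: "degree (fst p) > 0"
  shows "\<exists>w. degree w < degree (fst p) \<and> degree (subst2 w p) = e \<and> subst2 w p \<noteq> 0"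
proof -
  define m where "m = degree (fst p)"
  have m: "m > 0" using assms by (simp add: m_def)
  have S: "degree (fst q) = m" using inverse_degree_eq[OF inv] by (simp add: m_def)
  have "degree (lead_coeff (fst q)) = 0"
    using inverse_lead_coeff_const[OF inverse_pair_sym[OF inv]] S m by simp
  then obtain s where s: "lead_coeff (fst q) = [:s:]" by (metis degree_eq_zeroE)
  have "s \<noteq> 0" using s S m by auto
  then have "lead_coeff (fst q) * [:1 / s:] = 1" by (simp add: s one_pCons)
  from poly_digits_exist[OF _ this, of "subst2 (monom 1 e) q"] S m
  obtain H where H: "\<And>t. degree (coeff H t) < m" "poly H (fst q) = subst2 (monom 1 e) q" by auto
  define g where "g t = subst2 (coeff H t) p" for t
  have "monom 1 e = subst2 (poly H (fst q)) p" using inverse_pairD(2)[OF inv] H(2) by simp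
  also have "\<dots> = (\<Sum>t\<le>degree H. g t * X2 ^ t)"
    by (simp add: subst2_poly inverse_pairD(5)[OF inv] g_def)
  also have "\<dots> = (\<Sum>t\<le>degree H. smult (monom 1 t) (g t))"
    by (simp add: X2_power)
  finally have sum: "monom 1 e = (\<Sum>t\<le>degree H. smult (monom 1 t) (g t))" .
  define T where "T = {t. t \<le> degree H \<and> g t \<noteq> 0}"
  have "finite T" by (simp add: T_def)
  have "T \<noteq> {}"
  proof
    assume "T = {}"
    then have "monom (1 :: 'a poly) e = 0" unfolding sum by (auto simp: T_def intro!: sum.neutral)
    then show False by simp
  qed
  define E where "E = Max ((\<lambda>t. degree (g t)) ` T)"
  have "E \<in> (\<lambda>t. degree (g t)) ` T"
    unfolding E_def using \<open>finite T\<close> \<open>T \<noteq> {}\<close> by (intro Max_in) auto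
  then obtain t0 where t0: "t0 \<in> T" "degree (g t0) = E" by auto
  have lc: "degree (coeff (g t) E) = 0" for t
  proof (cases "t \<in> T \<and> degree (g t) = E")
    case True
    \<comment> \<open>Under the inverse substitution \<open>g t\<close> becomes a digit, of
      \<open>v\<close>-degree below \<open>m\<close>; the bound for the inverse pair then leaves no
      room for a nonconstant leading coefficient.\<close>
    then have "m * degree (lead_coeff (g t)) \<le> degree (subst2 (g t) q)"
      using degree_ge_lead_coeff[OF inverse_pair_sym[OF inv], of "g t"] S by (auto simp: T_def)
    also have "\<dots> < m" using H(1) by (simp add: g_def inverse_pairD[OF inv])
    finally show ?thesis using True m by simp
  next
    case False
    have "coeff (g t) E = 0"
    proof (cases "t \<in> T")
      case True
      then have "degree (g t) \<le> E" unfolding E_def using \<open>finite T\<close> by simp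
      then show ?thesis using False True by (intro coeff_eq_0) simp
    next
      case False
      then show ?thesis
        by (cases "t \<le> degree H") (simp_all add: T_def g_def coeff_eq_0)
    qed
    then show ?thesis by simp
  qed
  have "coeff (coeff (monom (1 :: 'a poly) e) E) t0 =
      (\<Sum>t\<le>degree H. coeff (monom 1 t * coeff (g t) E) t0)"
    unfolding sum by (simp add: coeff_sum)
  also have "\<dots> = (\<Sum>t\<le>degree H. if t = t0 then coeff (coeff (g t) E) 0 else 0)"
  proof (rule sum.cong[OF refl])
    fix t
    obtain c where c: "coeff (g t) E = [:c:]" using lc[of t] by (metis degree_eq_zeroE)
    have "monom 1 t * coeff (g t) E = monom c t" "coeff (coeff (g t) E) 0 = c"
      by (simp_all add: c smult_monom)
    then show "coeff (monom 1 t * coeff (g t) E) t0 = (if t = t0 then coeff (coeff (g t) E) 0 else 0)"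
      by (simp only: coeff_monom)
  qed
  also have "\<dots> = coeff (coeff (g t0) E) 0"
    using t0 by (simp add: T_def)
  also have "\<dots> \<noteq> 0"
  proof -
    have "coeff (g t0) E \<noteq> 0" using t0 by (auto simp: T_def)
    then show ?thesis using lc[of t0] by (metis leading_coeff_0_iff)
  qed
  finally have "E = e" by (auto split: if_splits)
  then show ?thesis using t0 H(1)
    by (intro exI[of _ "coeff H t0"]) (auto simp: g_def T_def m_def)
qed

section \<open>Lowering the degree by an elementary step\<close>

lemma poly_of_degree_1:
  assumes "degree p = 1"
  shows "p = [:coeff p 0, lead_coeff p:]"
proof (rule poly_eqI)
  fix n
  show "coeff p n = coeff [:coeff p 0, lead_coeff p:] n"
  proof (cases "n \<le> 1")
    case True
    then show ?thesis using assms by (auto simp: le_Suc_eq)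
  next
    case False
    then have "coeff [:coeff p 0, lead_coeff p:] n = 0" by (intro coeff_eq_0) auto
    then show ?thesis using False assms by (simp add: coeff_eq_0)
  qed
qed

text \<open>The \<open>m\<close> polynomials \<open>w e\<close> with \<open>e < m\<close> have
  distinct degrees after substitution, so a nontrivial combination \<open>G\<close> stays nonzero of
  degree below \<open>m\<close>, and its leading coefficient is constant by
  \<open>degree_ge_lead_coeff\<close>. Asking the coefficients of \<open>G\<close> at
  \<open>v^j\<close> to vanish at \<open>u = 0\<close> for all \<open>j \<noteq> 1\<close> costs
  \<open>m - 1\<close> equations, as \<open>1 < m\<close>; a nonzero constant can then lead only at
  \<open>v^1\<close>.\<close>

lemma degree_reduction:
  fixes p q :: "'a::field pmap"
  assumes inv: "inverse_pair p q" and m2: "degree (fst p) \<ge> 2"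
  shows "\<exists>\<kappa> g. \<kappa> \<noteq> 0 \<and> degree (const2 \<kappa> * snd p + subst_x g (fst p)) < degree (fst p)"
proof -
  define m where "m = degree (fst p)"
  have m: "m \<ge> 2" using m2 by (simp add: m_def)
  have "\<forall>e. \<exists>w. degree w < m \<and> degree (subst2 w p) = e \<and> subst2 w p \<noteq> 0"
    using digit_of_degree[OF inv] m by (simp add: m_def)
  then obtain w where w': "\<forall>e. degree (w e) < m \<and> degree (subst2 (w e) p) = e \<and> subst2 (w e) p \<noteq> 0"
    by (rule choice[THEN exE])
  have w: "degree (w e) < m" "degree (subst2 (w e) p) = e" "subst2 (w e) p \<noteq> 0" for e
    using spec[OF w', of e] by blast+
  have "card ({..<m} - {1}) < card {..<m}" using m by (intro card_Diff1_less) simp_all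
  from nontrivial_dependency[OF _ _ this, of "\<lambda>e j. coeff (coeff (w e) j) 0"]
  obtain c where c': "\<exists>e\<in>{..<m}. c e \<noteq> 0"
    and c0': "\<forall>j\<in>{..<m} - {1}. (\<Sum>e<m. c e * coeff (coeff (w e) j) 0) = 0"
    by blast
  have c: "\<exists>e<m. c e \<noteq> 0" using c' by blast
  have c0: "(\<Sum>e<m. c e * coeff (coeff (w e) j) 0) = 0" if "j < m" "j \<noteq> 1" for j
    using c0' that by blast
  define G where "G = (\<Sum>e<m. const2 (c e) * w e)"
  have sG: "subst2 G p = (\<Sum>e<m. const2 (c e) * subst2 (w e) p)"
    by (simp only: G_def subst2_sum subst2_simps(4) subst2_const2)
  have coG: "coeff (subst2 G p) j = (\<Sum>e<m. smult (c e) (coeff (subst2 (w e) p) j))" for j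
    by (simp add: sG coeff_sum const2_def)
  define C where "C = {e. e < m \<and> c e \<noteq> 0}"
  have C: "finite C" "C \<noteq> {}" using c by (auto simp: C_def)
  define e0 where "e0 = Max C"
  have e0: "e0 \<in> C" unfolding e0_def using C by (rule Max_in)
  have "coeff (subst2 G p) e0 = (\<Sum>e<m. if e = e0 then smult (c e) (coeff (subst2 (w e) p) e) else 0)"
    unfolding coG
  proof (rule sum.cong[OF refl])
    fix e assume e: "e \<in> {..<m}"
    have "c e = 0" if "e > e0"
    proof (rule ccontr)
      assume "c e \<noteq> 0"
      then have "e \<in> C" using e by (simp add: C_def)
      then have "e \<le> e0" unfolding e0_def by (rule Max_ge[OF C(1)])
      then show False using that by simp
    qed
    moreover have "e < e0 \<Longrightarrow> coeff (subst2 (w e) p) e0 = 0" using w(2)[of e] by (simp add: coeff_eq_0)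
    ultimately show "smult (c e) (coeff (subst2 (w e) p) e0) =
        (if e = e0 then smult (c e) (coeff (subst2 (w e) p) e) else 0)"
      by (cases e e0 rule: linorder_cases) auto
  qed
  also have "\<dots> = smult (c e0) (coeff (subst2 (w e0) p) e0)" using e0 by (simp add: C_def)
  also have "\<dots> \<noteq> 0" using e0 w(2,3)[of e0] by (metis (mono_tags, lifting) C_def leading_coeff_0_iff mem_Collect_eq smult_eq_0_iff)
  finally have sG0: "subst2 G p \<noteq> 0" by auto
  have dsG: "degree (subst2 G p) < m"
  proof -
    have "coeff (subst2 G p) j = 0" if "j \<ge> m" for j
      unfolding coG using that w(2) by (intro sum.neutral) (auto intro!: coeff_eq_0)
    then show ?thesis using sG0 by (meson leading_coeff_0_iff not_less)
  qed
  have G0: "G \<noteq> 0" using sG0 by auto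
  have "m * degree (lead_coeff G) < m"
    using degree_ge_lead_coeff[OF inv G0, folded m_def] dsG by (rule le_less_trans)
  then have "degree (lead_coeff G) = 0" by simp
  then obtain l where l: "lead_coeff G = [:l:]" by (metis degree_eq_zeroE)
  have l0: "l \<noteq> 0" using l G0 by auto
  have "degree G < m"
  proof -
    have "coeff G j = 0" if "j \<ge> m" for j
    proof -
      have "coeff (w e) j = 0" for e using w(1)[of e] that by (intro coeff_eq_0) simp
      then show ?thesis by (simp add: G_def coeff_sum const2_def)
    qed
    then show ?thesis using G0 by (meson leading_coeff_0_iff not_less)
  qed
  moreover have "coeff (coeff G (degree G)) 0 \<noteq> 0" using l l0 by simp
  moreover have "coeff (coeff G j) 0 = (\<Sum>e<m. c e * coeff (coeff (w e) j) 0)" for j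
    by (simp add: G_def coeff_sum const2_def)
  ultimately have "degree G = 1" using c0 by metis
  then obtain g where "G = [:g, [:l:]:]"
    using poly_of_degree_1[of G] l by metis
  then have "subst2 G p = const2 l * snd p + subst_x g (fst p)" by simp
  then show ?thesis using dsG l0 by (intro exI[of _ l] exI[of _ g]) (simp add: m_def)
qed

section \<open>The group of automorphisms and its generators\<close>

abbreviation GA2_mult :: "'a::field pmap \<Rightarrow> 'a pmap \<Rightarrow> 'a pmap" (infixl "\<star>" 70) where
  "f \<star> g \<equiv> f \<otimes>\<^bsub>GA2\<^esub> g"

abbreviation ginv :: "'a::field pmap \<Rightarrow> 'a pmap" where
  "ginv f \<equiv> inv\<^bsub>GA2\<^esub> f"

lemma GA2_simps [simp]:
  "x \<star> y = pmap_comp x y" "\<one>\<^bsub>GA2\<^esub> = pmap_id"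
  by (simp_all add: GA2_def units_of_mult units_of_one End2_def)

lemma carrier_GA2: "p \<in> carrier GA2 \<longleftrightarrow> (\<exists>q. inverse_pair p q)"
  unfolding GA2_def units_of_carrier Units_def End2_def inverse_pair_def by auto

interpretation GA2: group GA2
  by (rule group_GA2)

lemma inverse_pair_carrier: "inverse_pair p q \<Longrightarrow> p \<in> carrier GA2"
  unfolding carrier_GA2 by blast

lemma inverse_pair_inv:
  assumes "inverse_pair p q"
  shows "ginv p = q"
proof (rule GA2.inv_equality)
  show "q \<star> p = \<one>\<^bsub>GA2\<^esub>" using assms by (simp add: inverse_pair_def)
  show "p \<in> carrier GA2" "q \<in> carrier GA2"
    using assms inverse_pair_sym unfolding carrier_GA2 by blast+
qed

lemma pmap_comp_assoc: "pmap_comp (pmap_comp f g) h = pmap_comp f (pmap_comp g h)"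
  by (simp add: pmap_comp_def subst2_subst2)

lemma pmap_comp_id [simp]: "pmap_comp pmap_id g = g" "pmap_comp g pmap_id = g"
  by (simp_all add: pmap_comp_def subst2_id) (simp_all add: pmap_id_def subst2_vars)

lemma inverse_pair_comp:
  assumes "inverse_pair p q" "inverse_pair p' q'"
  shows "inverse_pair (pmap_comp p p') (pmap_comp q' q)"
  using assms unfolding inverse_pair_def
  by (metis pmap_comp_assoc pmap_comp_id(1))

text \<open>Affine maps given by their six entries, so that composition and equality become
  arithmetic in \<open>K\<close>, without the vector types of \<open>affine_map\<close>.\<close>

definition aff :: "'a \<Rightarrow> 'a \<Rightarrow> 'a \<Rightarrow> 'a \<Rightarrow> 'a \<Rightarrow> 'a \<Rightarrow> 'a::field pmap" where
  "aff a b c d u v = (const2 a * X2 + const2 b * Y2 + const2 u, const2 c * X2 + const2 d * Y2 + const2 v)"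

lemma const2_uminus: "const2 (- a) = - const2 a"
  by (simp add: const2_def)

lemma pmap_comp_aff:
  "pmap_comp (aff a b c d u v) g =
    (const2 a * fst g + const2 b * snd g + const2 u, const2 c * fst g + const2 d * snd g + const2 v)"
  by (simp add: pmap_comp_def aff_def subst2_vars)

lemma aff_comp:
  "pmap_comp (aff a b c d u v) (aff a' b' c' d' u' v') =
    aff (a * a' + b * c') (a * b' + b * d') (c * a' + d * c') (c * b' + d * d')
      (a * u' + b * v' + u) (c * u' + d * v' + v)"
  by (simp add: pmap_comp_aff) (simp add: aff_def algebra_simps)

lemma aff_expand:
  "aff a b c d u v = ([:[:u, a:], [:b:]:], [:[:v, c:], [:d:]:])"
  by (simp add: aff_def const2_def X2_def Y2_def)

lemma aff_eq_iff:
  "aff a b c d u v = aff a' b' c' d' u' v' \<longleftrightarrow>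
    a = a' \<and> b = b' \<and> c = c' \<and> d = d' \<and> u = u' \<and> v = v'"
  by (auto simp: aff_expand)

lemma pmap_id_aff: "pmap_id = aff 1 0 0 1 0 0"
  by (simp add: pmap_id_def aff_def)

lemma affine_map_aff:
  "affine_map M w = aff (M $ 1 $ 1) (M $ 1 $ 2) (M $ 2 $ 1) (M $ 2 $ 2) (w $ 1) (w $ 2)"
  by (simp add: affine_map_def aff_def)

lemma linear_map_matrix22: "linear_map (matrix22 a b c d) = aff a b c d 0 0"
  by (simp add: linear_map_def affine_map_aff matrix22_def)

lemma affine_maps_aff: "affine_maps = {aff a b c d u v | a b c d u v. a * d - b * c \<noteq> 0}"
proof (intro equalityI subsetI)
  fix f :: "'a pmap" assume "f \<in> affine_maps"
  then obtain M w where "f = affine_map M w" "invertible M" by (auto simp: affine_maps_def)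
  then show "f \<in> {aff a b c d u v | a b c d u v. a * d - b * c \<noteq> 0}"
    unfolding affine_map_aff invertible_det_nz det_2 by blast
next
  fix f :: "'a pmap" assume "f \<in> {aff a b c d u v | a b c d u v. a * d - b * c \<noteq> 0}"
  then obtain a b c d u v where f: "f = aff a b c d u v" "a * d - b * c \<noteq> 0" by blast
  have "f = affine_map (matrix22 a b c d) (vector [u, v])"
    by (simp add: f affine_map_aff matrix22_def)
  moreover have "invertible (matrix22 a b c d)"
    using f(2) by (simp add: invertible_det_nz det_2 matrix22_def)
  ultimately show "f \<in> affine_maps" by (auto simp: affine_maps_def)
qed

lemma aff_in_affine_maps: "a * d - b * c \<noteq> 0 \<Longrightarrow> aff a b c d u v \<in> affine_maps"
  unfolding affine_maps_aff by blast

definition inv_aff :: "'a \<Rightarrow> 'a \<Rightarrow> 'a \<Rightarrow> 'a \<Rightarrow> 'a \<Rightarrow> 'a \<Rightarrow> 'a::field pmap" where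
  "inv_aff a b c d u v = (let D = a * d - b * c in
    aff (d / D) (- b / D) (- c / D) (a / D) ((b * v - d * u) / D) ((c * u - a * v) / D))"

lemma inverse_pair_aff:
  assumes "a * d - b * c \<noteq> 0"
  shows "inverse_pair (aff a b c d u v) (inv_aff a b c d u v)"
  unfolding inverse_pair_def inv_aff_def Let_def aff_comp pmap_id_aff aff_eq_iff
proof (intro conjI)
  show "a * (d / (a * d - b * c)) + b * (- c / (a * d - b * c)) = 1"
    "a * (- b / (a * d - b * c)) + b * (a / (a * d - b * c)) = 0"
    "c * (d / (a * d - b * c)) + d * (- c / (a * d - b * c)) = 0"
    "c * (- b / (a * d - b * c)) + d * (a / (a * d - b * c)) = 1"
    "a * ((b * v - d * u) / (a * d - b * c)) + b * ((c * u - a * v) / (a * d - b * c)) + u = 0"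
    "c * ((b * v - d * u) / (a * d - b * c)) + d * ((c * u - a * v) / (a * d - b * c)) + v = 0"
    "d / (a * d - b * c) * a + - b / (a * d - b * c) * c = 1"
    "d / (a * d - b * c) * b + - b / (a * d - b * c) * d = 0"
    "- c / (a * d - b * c) * a + a / (a * d - b * c) * c = 0"
    "- c / (a * d - b * c) * b + a / (a * d - b * c) * d = 1"
    "d / (a * d - b * c) * u + - b / (a * d - b * c) * v + (b * v - d * u) / (a * d - b * c) = 0"
    "- c / (a * d - b * c) * u + a / (a * d - b * c) * v + (c * u - a * v) / (a * d - b * c) = 0"
    using assms by (simp_all add: divide_simps) (simp_all add: algebra_simps)
qed

section \<open>Calculus of elementary maps\<close>

lemma subst2_in_y: "subst2 (in_y P) g = subst_x P (snd g)"
  unfolding in_y_def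
  by (induction P) (simp_all add: map_poly_pCons)

lemma pmap_comp_elementary:
  "pmap_comp (elementary_map \<alpha> P \<beta> v) g =
    (const2 \<alpha> * fst g + subst_x P (snd g), const2 \<beta> * snd g + const2 v)"
  by (simp add: pmap_comp_def elementary_map_def subst2_vars subst2_in_y)

lemma in_y_eq: "in_y P = subst_x P Y2"
  using subst2_in_y[of P pmap_id] unfolding subst2_id by (simp add: pmap_id_def)

lemma subst_x_pcompose: "subst_x (pcompose P q) A = subst_x P (subst_x q A)"
  by (induction P) (simp_all add: pcompose_pCons)

lemma subst_x_uminus: "subst_x (- q) A = - subst_x q A"
  using subst_x_simps(3)[of q "- q" A] by (simp add: eq_neg_iff_add_eq_0 add.commute)

lemma subst_x_smult: "subst_x (smult c P) A = const2 c * subst_x P A"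
  by (induction P) (simp_all add: algebra_simps)

lemma elementary_comp:
  "pmap_comp (elementary_map \<alpha> P \<beta> v) (elementary_map \<alpha>' P' \<beta>' v') =
    elementary_map (\<alpha> * \<alpha>') (smult \<alpha> P' + pcompose P [:v', \<beta>':]) (\<beta> * \<beta>') (\<beta> * v' + v)"
  unfolding pmap_comp_elementary
  by (simp add: elementary_map_def in_y_eq subst_x_pcompose subst_x_smult algebra_simps)

lemma elementary_expand:
  "elementary_map \<alpha> P \<beta> v = ([:[:0, \<alpha>:]:] + map_poly (\<lambda>c. [:c:]) P, [:[:v:], [:\<beta>:]:])"
  by (simp add: elementary_map_def in_y_def const2_def X2_def Y2_def)

lemma coeff_in_y: "coeff (in_y P) i = [:coeff P i:]"
  by (simp add: in_y_def coeff_map_poly)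

lemma elementary_eq_iff:
  "elementary_map \<alpha> P \<beta> v = elementary_map \<alpha>' P' \<beta>' v' \<longleftrightarrow>
    \<alpha> = \<alpha>' \<and> P = P' \<and> \<beta> = \<beta>' \<and> v = v'"
proof
  assume e: "elementary_map \<alpha> P \<beta> v = elementary_map \<alpha>' P' \<beta>' v'"
  have f: "fst (elementary_map \<alpha> P \<beta> v) = [:[:0, \<alpha>:]:] + in_y P" for \<alpha> P \<beta> v
    by (simp add: elementary_expand in_y_def)
  have "[:[:0, \<alpha>:]:] + in_y P = [:[:0, \<alpha>':]:] + in_y P'"
    using arg_cong[OF e, of fst] by (simp only: f)
  then have *: "coeff (coeff ([:[:0, \<alpha>:]:] + in_y P) i) j = coeff (coeff ([:[:0, \<alpha>':]:] + in_y P') i) j" for i j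
    by simp
  have "\<alpha> = \<alpha>'" using *[of 0 1] by (simp add: coeff_in_y)
  moreover have "P = P'"
  proof (rule poly_eqI)
    fix i show "coeff P i = coeff P' i"
      using *[of i 0] by (cases i) (simp_all add: coeff_in_y)
  qed
  ultimately show "\<alpha> = \<alpha>' \<and> P = P' \<and> \<beta> = \<beta>' \<and> v = v'"
    using e by (simp add: elementary_expand)
qed simp

lemma pmap_id_elementary: "pmap_id = elementary_map 1 0 1 0"
  by (simp add: pmap_id_def elementary_map_def in_y_def)

lemma inverse_pair_elementary:
  assumes "\<alpha> * \<beta> \<noteq> 0"
  shows "inverse_pair (elementary_map \<alpha> P \<beta> v)
    (elementary_map (1 / \<alpha>) (smult (- 1 / \<alpha>) (pcompose P [:- v / \<beta>, 1 / \<beta>:])) (1 / \<beta>) (- v / \<beta>))"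
proof -
  have "pcompose (pcompose P [:- v / \<beta>, 1 / \<beta>:]) [:v, \<beta>:] = P"
    using assms by (simp add: pcompose_assoc[symmetric] pcompose_pCons)
  then show ?thesis using assms
    by (simp add: inverse_pair_def elementary_comp pmap_id_elementary elementary_eq_iff pcompose_smult pcompose_uminus)
qed

lemma affine_maps_carrier: "f \<in> affine_maps \<Longrightarrow> f \<in> carrier GA2"
  using inverse_pair_aff by (fastforce simp: affine_maps_aff intro: inverse_pair_carrier)

lemma elementary_maps_carrier: "f \<in> elementary_maps \<Longrightarrow> f \<in> carrier GA2"
  using inverse_pair_elementary by (fastforce simp: elementary_maps_def intro: inverse_pair_carrier)

lemma affine_subgroup: "subgroup affine_maps GA2"
proof (rule GA2.subgroupI)
  show "affine_maps \<subseteq> carrier GA2" using affine_maps_carrier by auto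
  show "affine_maps \<noteq> {}" using aff_in_affine_maps[of 1 1 0 0 0 0] by auto
next
  fix f :: "'a pmap" assume "f \<in> affine_maps"
  then obtain a b c d u v where f: "f = aff a b c d u v" "a * d - b * c \<noteq> 0"
    by (auto simp: affine_maps_aff)
  define D where "D = a * d - b * c"
  have "d / D * (a / D) - (- b / D) * (- c / D) = D / (D * D)"
    by (simp add: D_def diff_divide_distrib algebra_simps)
  then have "d / D * (a / D) - (- b / D) * (- c / D) \<noteq> 0" using f(2) by (simp add: D_def)
  then have "inv_aff a b c d u v \<in> affine_maps"
    unfolding inv_aff_def Let_def D_def by (rule aff_in_affine_maps)
  then show "ginv f \<in> affine_maps"
    using inverse_pair_inv[OF inverse_pair_aff[OF f(2)]] f(1) by simp
next
  fix f g :: "'a pmap" assume "f \<in> affine_maps" "g \<in> affine_maps"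
  then obtain a b c d u v a' b' c' d' u' v' where
    fg: "f = aff a b c d u v" "a * d - b * c \<noteq> 0" "g = aff a' b' c' d' u' v'" "a' * d' - b' * c' \<noteq> 0"
    by (auto simp: affine_maps_aff)
  have "(a * a' + b * c') * (c * b' + d * d') - (a * b' + b * d') * (c * a' + d * c')
      = (a * d - b * c) * (a' * d' - b' * c')" by (simp add: algebra_simps)
  then have "(a * a' + b * c') * (c * b' + d * d') - (a * b' + b * d') * (c * a' + d * c') \<noteq> 0"
    using fg by simp
  then show "f \<star> g \<in> affine_maps"
    unfolding fg GA2_simps aff_comp by (rule aff_in_affine_maps)
qed

lemma elementary_subgroup: "subgroup elementary_maps GA2"
proof (rule GA2.subgroupI)
  show "elementary_maps \<subseteq> carrier GA2" using elementary_maps_carrier by auto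
  have "elementary_map 1 0 1 0 \<in> elementary_maps" by (force simp: elementary_maps_def)
  then show "elementary_maps \<noteq> {}" by auto
next
  fix f :: "'a pmap" assume "f \<in> elementary_maps"
  then obtain \<alpha> P \<beta> v where f: "f = elementary_map \<alpha> P \<beta> v" "\<alpha> * \<beta> \<noteq> 0"
    by (auto simp: elementary_maps_def)
  have "ginv f = elementary_map (1 / \<alpha>) (smult (- 1 / \<alpha>) (pcompose P [:- v / \<beta>, 1 / \<beta>:])) (1 / \<beta>) (- v / \<beta>)"
    unfolding f(1) by (rule inverse_pair_inv[OF inverse_pair_elementary[OF f(2)]])
  moreover have "1 / \<alpha> * (1 / \<beta>) \<noteq> 0" using f by simp
  ultimately show "ginv f \<in> elementary_maps" unfolding elementary_maps_def by blast
next
  fix f g :: "'a pmap" assume "f \<in> elementary_maps" "g \<in> elementary_maps"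
  then obtain \<alpha> P \<beta> v \<alpha>' P' \<beta>' v' where
    fg: "f = elementary_map \<alpha> P \<beta> v" "\<alpha> * \<beta> \<noteq> 0" "g = elementary_map \<alpha>' P' \<beta>' v'" "\<alpha>' * \<beta>' \<noteq> 0"
    by (auto simp: elementary_maps_def)
  have "\<alpha> * \<alpha>' * (\<beta> * \<beta>') \<noteq> 0" using fg by simp
  then show "f \<star> g \<in> elementary_maps"
    unfolding fg GA2_simps elementary_comp elementary_maps_def by blast
qed

section \<open>Generation by affine and elementary maps\<close>

lemma comp_list_simps [simp]:
  "comp_list [] = pmap_id" "comp_list (w # ws) = pmap_comp w (comp_list ws)"
  by (simp_all add: comp_list_def)

lemma comp_list_append: "comp_list (ws @ ws') = pmap_comp (comp_list ws) (comp_list ws')"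
  by (induction ws) (simp_all add: pmap_comp_assoc)

definition tame :: "'a::field pmap \<Rightarrow> bool" where
  "tame p \<longleftrightarrow> (\<exists>ws. set ws \<subseteq> affine_maps \<union> elementary_maps \<and> p = comp_list ws)"

lemma tame_comp: "tame p \<Longrightarrow> tame p' \<Longrightarrow> tame (pmap_comp p p')"
  unfolding tame_def by (metis comp_list_append set_append Un_subset_iff)

lemma tame_letter: "w \<in> affine_maps \<union> elementary_maps \<Longrightarrow> tame w"
  unfolding tame_def by (intro exI[of _ "[w]"]) auto

lemma tame_elementary: "\<alpha> * \<beta> \<noteq> 0 \<Longrightarrow> tame (elementary_map \<alpha> P \<beta> v)"
  by (rule tame_letter) (auto simp: elementary_maps_def)

lemma tame_swap: "tame (aff 0 1 1 0 0 0)"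
  by (rule tame_letter) (simp add: aff_in_affine_maps)

lemma swap_swap: "pmap_comp (aff 0 1 1 0 0 0) (aff 0 1 1 0 0 0) = pmap_id"
  by (simp add: aff_comp pmap_id_aff)

lemma poly_mult_eq_1_const:
  fixes a b :: "'a::idom poly"
  assumes "b * a = 1"
  obtains c where "a = [:c:]" "c \<noteq> 0"
proof -
  have nz: "a \<noteq> 0" "b \<noteq> 0" using assms by auto
  then have "degree b + degree a = 0" using assms by (metis degree_1 degree_mult_eq)
  then obtain c where "a = [:c:]" by (metis add_is_0 degree_eq_zeroE)
  then show ?thesis using nz that by auto
qed

text \<open>If \<open>P\<close> depends on \<open>x\<close> alone, so does the first component of
  the inverse, and the identities of the inverse pair force \<open>P\<close> to have degree one in
  \<open>x\<close>, and \<open>Q\<close> to have degree one in \<open>y\<close> with a constant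
  leading coefficient. Exchanging the variables on both sides makes such a map elementary.\<close>

lemma tame_degree_0:
  fixes p q :: "'a::field pmap"
  assumes inv: "inverse_pair p q" and "degree (fst p) = 0"
  shows "tame p"
proof -
  obtain p0 where p0: "fst p = [:p0:]" using assms(2) by (metis degree_eq_zeroE)
  obtain s0 where s0: "fst q = [:s0:]" using assms(2) inverse_degree_eq[OF inv] by (metis degree_eq_zeroE)
  have sub: "subst_x c [:d:] = [:pcompose c d:]" for c d :: "'a poly"
    by (induction c) (simp_all add: pcompose_pCons const2_def)
  have "[:pcompose p0 s0:] = (X2 :: 'a poly poly)"
    using inverse_pairD(3)[OF inv] by (simp add: p0 s0 sub)
  then have "degree (pcompose p0 s0) = 1" by (simp add: X2_def)
  then have "degree p0 = 1" by (simp add: degree_pcompose)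
  then obtain \<alpha> \<beta> where ab: "p0 = [:\<beta>, \<alpha>:]" "\<alpha> \<noteq> 0"
    using poly_of_degree_1[of p0] by (metis degree_0 leading_coeff_0_iff zero_neq_one)
  have "subst2 T p = pcompose (map_poly (\<lambda>c. pcompose c p0) T) (snd p)" for T
    by (induction T) (simp_all add: map_poly_pCons pcompose_pCons p0 sub)
  then have Y: "pcompose (map_poly (\<lambda>c. pcompose c p0) (snd q)) (snd p) = Y2"
    using inverse_pairD(6)[OF inv] by simp
  let ?T = "map_poly (\<lambda>c. pcompose c p0) (snd q)"
  have "degree (pcompose ?T (snd p)) = 1" using Y by (simp add: Y2_def)
  then have d: "degree ?T = 1" "degree (snd p) = 1" by (simp_all add: degree_pcompose)
  have "lead_coeff ?T * lead_coeff (snd p) ^ degree ?T = 1"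
    using lead_coeff_comp[of "snd p" ?T] d(2) Y by (simp add: Y2_def)
  then have "lead_coeff ?T * lead_coeff (snd p) = 1" using d by simp
  then obtain c where c: "lead_coeff (snd p) = [:c:]" "c \<noteq> 0"
    by (rule poly_mult_eq_1_const)
  obtain q0 where q0: "snd p = [:q0, [:c:]:]"
    using poly_of_degree_1[OF d(2)] c by metis
  have q0X: "subst_x q0 X2 = [:q0:]" unfolding X2_def sub by (simp add: pcompose_pCons pcompose_idR)
  have "p = pmap_comp (aff 0 1 1 0 0 0) (pmap_comp (elementary_map c q0 \<alpha> \<beta>) (aff 0 1 1 0 0 0))"
    unfolding pmap_comp_aff pmap_comp_elementary
    by (rule prod_eqI; simp add: aff_def p0 q0 ab q0X; simp add: const2_def X2_def Y2_def)
  then show ?thesis using ab c by (metis tame_comp tame_swap tame_elementary mult_eq_0_iff)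
qed

lemma tame_inverse_pair:
  fixes p q :: "'a::field pmap"
  assumes "inverse_pair p q"
  shows "tame p"
  using assms
proof (induction "degree (fst p)" arbitrary: p q rule: less_induct)
  case less
  note inv = less.prems
  let ?sw = "aff 0 1 1 0 0 0 :: 'a pmap"
  have isw: "inverse_pair ?sw ?sw" by (simp add: inverse_pair_def swap_swap)
  consider "degree (fst p) = 0" | "degree (fst p) = 1" | "degree (fst p) \<ge> 2" by linarith
  then show ?case
  proof cases
    case 1
    then show ?thesis using tame_degree_0[OF inv] by simp
  next
    case 2
    have "degree (lead_coeff (fst p)) = 0" using inverse_lead_coeff_const[OF inv] 2 by simp
    then obtain a where a: "lead_coeff (fst p) = [:a:]" by (metis degree_eq_zeroE)
    have a0: "a \<noteq> 0" using a 2 by (metis degree_0 leading_coeff_0_iff pCons_0_0 zero_neq_one)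
    obtain p0 where p0: "fst p = [:p0, [:a:]:]"
      using poly_of_degree_1[OF 2] a by metis
    \<comment> \<open>Composed with the exchange this is \<open>(y, (x - p0(y)) / a)\<close>.
      Substituting it into \<open>p0(x) + a y\<close> leaves \<open>x\<close>, which is the case of
      degree 0.\<close>
    define E where "E = elementary_map (1 / a) (smult (- 1 / a) p0) 1 0"
    obtain E' where E': "inverse_pair E E'" "tame E'"
      using inverse_pair_elementary[of "1 / a" 1 "smult (- 1 / a) p0" 0] a0
        tame_elementary[of "1 / (1 / a)" "1 / 1"] unfolding E_def
      by (metis divide_eq_0_iff mult_eq_0_iff one_neq_zero)
    define \<epsilon> \<epsilon>' where "\<epsilon> = pmap_comp ?sw E" and "\<epsilon>' = pmap_comp E' ?sw"
    have e: "inverse_pair \<epsilon> \<epsilon>'" unfolding \<epsilon>_def \<epsilon>'_def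
      by (rule inverse_pair_comp[OF isw E'(1)])
    have te: "tame \<epsilon>'" unfolding \<epsilon>'_def by (intro tame_comp E' tame_swap)
    have "\<epsilon> = (Y2, const2 (1 / a) * X2 - const2 (1 / a) * subst_x p0 Y2)"
      unfolding \<epsilon>_def E_def pmap_comp_aff
      by (simp add: elementary_map_def in_y_eq subst_x_smult subst_x_uminus)
    then have "fst (pmap_comp p \<epsilon>) = X2"
      using a0 by (simp add: pmap_comp_def p0 algebra_simps) (simp add: const2_def pCons_one)
    then have "degree (fst (pmap_comp p \<epsilon>)) = 0" by (simp add: X2_def)
    then have "tame (pmap_comp p \<epsilon>)" using tame_degree_0[OF inverse_pair_comp[OF inv e]] by simp
    then have "tame (pmap_comp (pmap_comp p \<epsilon>) \<epsilon>')" by (rule tame_comp[OF _ te])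
    then show ?thesis using e by (simp add: pmap_comp_assoc inverse_pair_def)
  next
    case 3
    from degree_reduction[OF inv this] obtain \<kappa> g where k: "\<kappa> \<noteq> 0"
      "degree (const2 \<kappa> * snd p + subst_x g (fst p)) < degree (fst p)" by auto
    define E where "E = elementary_map \<kappa> g 1 0"
    obtain E' where E': "inverse_pair E E'" "tame E'"
      using inverse_pair_elementary[of \<kappa> 1 g 0] k
        tame_elementary[of "1 / \<kappa>" "1 / 1"] unfolding E_def
      by (metis divide_eq_0_iff mult_eq_0_iff one_neq_zero)
    define t t' where "t = pmap_comp E ?sw" and "t' = pmap_comp ?sw E'"
    have e: "inverse_pair t t'" unfolding t_def t'_def
      by (rule inverse_pair_comp[OF E'(1) isw])
    have te: "tame t'" unfolding t'_def by (intro tame_comp E' tame_swap)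
    have "fst (pmap_comp t p) = const2 \<kappa> * snd p + subst_x g (fst p)"
      unfolding t_def E_def pmap_comp_assoc unfolding pmap_comp_elementary
      by (simp add: pmap_comp_aff)
    then have "tame (pmap_comp t p)"
      using less.hyps[OF _ inverse_pair_comp[OF e inv]] k by simp
    then have "tame (pmap_comp t' (pmap_comp t p))" by (rule tame_comp[OF te])
    then show ?thesis using e by (simp add: pmap_comp_assoc[symmetric] inverse_pair_def)
  qed
qed

section \<open>Amalgamated products\<close>

lemma (in group) cancel_simps:
  assumes "x \<in> carrier G" "y \<in> carrier G"
  shows "x \<otimes> (inv x \<otimes> y) = y" "inv x \<otimes> (x \<otimes> y) = y"
  using assms by (simp_all flip: m_assoc)

lemma (in group) conj_pow:
  assumes "h \<in> carrier G" "x \<in> carrier G"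
  shows "(h \<otimes> x \<otimes> inv h) [^] (n::nat) = h \<otimes> x [^] n \<otimes> inv h"
proof (induction n)
  case 0
  then show ?case using assms by simp
next
  case (Suc n)
  then show ?case using assms by (simp add: m_assoc cancel_simps)
qed

lemma (in group) ord_conj:
  assumes h: "h \<in> carrier G" and x: "x \<in> carrier G"
  shows "ord (h \<otimes> x \<otimes> inv h) = ord x"
proof -
  have "h \<otimes> y \<otimes> inv h = \<one> \<longleftrightarrow> y = \<one>" if y: "y \<in> carrier G" for y
  proof
    assume "h \<otimes> y \<otimes> inv h = \<one>"
    moreover have "inv h \<otimes> (h \<otimes> y \<otimes> inv h) \<otimes> h = y" using h y by (simp add: m_assoc cancel_simps)
    ultimately show "y = \<one>" using h by simp
  qed (use h in simp)
  then have "(h \<otimes> x \<otimes> inv h) [^] n = \<one> \<longleftrightarrow> x [^] n = \<one>" for n :: nat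
    using assms by (simp add: conj_pow)
  then have "ord (h \<otimes> x \<otimes> inv h) dvd n \<longleftrightarrow> ord x dvd n" for n
    using assms by (simp flip: pow_eq_id)
  then show ?thesis by (metis dvd_antisym dvd_refl)
qed

lemma (in group) ord_4_iff:
  assumes x: "x \<in> carrier G"
  shows "ord x = 4 \<longleftrightarrow> x \<otimes> x \<otimes> (x \<otimes> x) = \<one> \<and> x \<otimes> x \<noteq> \<one>"
proof -
  have pow2: "x [^] (2::nat) = x \<otimes> x" using x by (simp add: numeral_2_eq_2)
  have pow4: "x [^] (4::nat) = x \<otimes> x \<otimes> (x \<otimes> x)"
    using nat_pow_mult[OF x, of 2 2] by (simp add: pow2)
  have "n = 4 \<longleftrightarrow> n dvd 4 \<and> \<not> n dvd 2" for n :: nat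
  proof
    assume n: "n dvd 4 \<and> \<not> n dvd 2"
    then have "n \<le> 4" by (auto intro: dvd_imp_le)
    then have "n \<in> {0, 1, 2, 3, 4}" by auto
    then show "n = 4" using n by auto
  qed auto
  from this[of "ord x"] show ?thesis
    using pow_eq_id[OF x, of 4] pow_eq_id[OF x, of 2] unfolding pow2 pow4 by (simp only:)
qed

text \<open>An internal amalgamated product of \<open>A\<close> and \<open>E\<close> over their
  intersection. \<open>T\<close> contains exactly one element of every right coset of
  \<open>A \<inter> E\<close> that consists of letters. A letter lies in exactly one of the two
  factors, so membership in \<open>A\<close> serves as its type.\<close>

locale amalgam = group G for G (structure) +
  fixes A E T :: "'a set"
  assumes A: "subgroup A G" and E: "subgroup E G"
    and T_letters: "T \<subseteq> (A - E) \<union> (E - A)"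
    and T_exists: "x \<in> (A - E) \<union> (E - A) \<Longrightarrow> \<exists>b \<in> A \<inter> E. \<exists>t \<in> T. x = b \<otimes> t"
    and T_unique: "\<lbrakk>t \<in> T; t' \<in> T; t \<otimes> inv t' \<in> A \<inter> E\<rbrakk> \<Longrightarrow> t = t'"
    and generated: "g \<in> carrier G \<Longrightarrow> \<exists>ws. set ws \<subseteq> A \<union> E \<and> g = foldr (\<otimes>) ws \<one>"
    and free: "\<lbrakk>ws \<noteq> []; set ws \<subseteq> (A - E) \<union> (E - A); successively (\<lambda>x y. (x \<in> A) \<noteq> (y \<in> A)) ws\<rbrakk>
      \<Longrightarrow> foldr (\<otimes>) ws \<one> \<notin> A \<inter> E"
begin

section \<open>Alternating words and their products\<close>

definition "wprod ws = foldr (\<otimes>) ws \<one>"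

definition "alt ws \<longleftrightarrow> set ws \<subseteq> (A - E) \<union> (E - A) \<and> successively (\<lambda>x y. (x \<in> A) \<noteq> (y \<in> A)) ws"

abbreviation "B \<equiv> A \<inter> E"

lemma B: "subgroup B G"
  using A E by (rule subgroups_Inter_pair)

lemma in_carrier: "x \<in> A \<Longrightarrow> x \<in> carrier G" "x \<in> E \<Longrightarrow> x \<in> carrier G"
  using A E by (auto dest: subgroup.mem_carrier)

declare cancel_simps [simp]

lemma wprod_simps [simp]: "wprod [] = \<one>" "wprod (x # xs) = x \<otimes> wprod xs"
  by (simp_all add: wprod_def)

lemma wprod_closed [simp]: "set ws \<subseteq> carrier G \<Longrightarrow> wprod ws \<in> carrier G"
  by (induction ws) auto

lemma wprod_append:
  "set xs \<subseteq> carrier G \<Longrightarrow> set ys \<subseteq> carrier G \<Longrightarrow> wprod (xs @ ys) = wprod xs \<otimes> wprod ys"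
  by (induction xs) (auto simp: m_assoc)

lemma alt_Nil [simp]: "alt []"
  by (simp add: alt_def)

lemma alt_carrier: "alt ws \<Longrightarrow> set ws \<subseteq> carrier G"
  by (auto simp: alt_def dest: in_carrier)

lemma alt_wprod_closed [simp]: "alt ws \<Longrightarrow> wprod ws \<in> carrier G"
  by (simp add: alt_carrier)

lemma alt_not_B: "alt ws \<Longrightarrow> ws \<noteq> [] \<Longrightarrow> wprod ws \<notin> B"
  unfolding wprod_def alt_def using free by blast

lemma alt_append:
  "alt (xs @ ys) \<longleftrightarrow> alt xs \<and> alt ys \<and> (xs = [] \<or> ys = [] \<or> (last xs \<in> A) \<noteq> (hd ys \<in> A))"
  by (auto simp: alt_def successively_append_iff)

lemma alt_Cons:
  "alt (x # ys) \<longleftrightarrow> x \<in> (A - E) \<union> (E - A) \<and> alt ys \<and> (ys = [] \<or> (x \<in> A) \<noteq> (hd ys \<in> A))"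
  by (auto simp: alt_def successively_Cons)

lemma alt_parity: "alt ws \<Longrightarrow> ws \<noteq> [] \<Longrightarrow> ((hd ws \<in> A) = (last ws \<in> A)) = odd (length ws)"
  by (induction ws) (auto simp: alt_Cons)

lemma letter_inv:
  assumes "x \<in> (A - E) \<union> (E - A)"
  shows "inv x \<in> (A - E) \<union> (E - A)" "inv x \<in> A \<longleftrightarrow> x \<in> A"
  using assms A E
  by (auto dest: subgroup.m_inv_closed) (metis in_carrier inv_inv subgroup.m_inv_closed)+

lemma alt_inv: "alt ws \<Longrightarrow> alt (map (\<lambda>x. inv x) (rev ws))"
proof (induction ws)
  case (Cons x xs)
  then have x: "x \<in> (A - E) \<union> (E - A)" and xs: "xs = [] \<or> (x \<in> A) \<noteq> (hd xs \<in> A)" "alt xs"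
    by (simp_all add: alt_Cons)
  have "last (map (\<lambda>x. inv x) (rev xs)) = inv (hd xs)" if "xs \<noteq> []"
    using that by (simp add: last_map last_rev)
  moreover have "inv (hd xs) \<in> A \<longleftrightarrow> hd xs \<in> A" if "xs \<noteq> []"
    using letter_inv(2)[of "hd xs"] xs(2) that by (cases xs) (auto simp: alt_Cons)
  ultimately show ?case using Cons x xs letter_inv[OF x] by (auto simp: alt_append alt_Cons)
qed simp

lemma wprod_inv: "set ws \<subseteq> carrier G \<Longrightarrow> wprod (map (\<lambda>x. inv x) (rev ws)) = inv (wprod ws)"
proof (induction ws)
  case (Cons x xs)
  then have "set (map (\<lambda>x. inv x) (rev xs)) \<subseteq> carrier G" by auto
  then show ?case using Cons by (simp add: wprod_append inv_mult_group)
qed simp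

lemma alt_last: "alt ws \<Longrightarrow> ws \<noteq> [] \<Longrightarrow> last ws \<in> (A - E) \<union> (E - A)"
  using last_in_set unfolding alt_def by blast

lemma B_letter_left:
  assumes "b \<in> B" "x \<in> (A - E) \<union> (E - A)"
  shows "b \<otimes> x \<in> (A - E) \<union> (E - A)" "b \<otimes> x \<in> A \<longleftrightarrow> x \<in> A"
proof -
  have b: "b \<in> A" "b \<in> E" "b \<in> carrier G" using assms(1) in_carrier by auto
  have x: "x \<in> carrier G" using assms(2) in_carrier by auto
  have i: "b \<otimes> x \<in> H \<longleftrightarrow> x \<in> H" if "subgroup H G" "b \<in> H" for H
    using that b x by (metis cancel_simps(2) subgroup.m_closed subgroup.m_inv_closed)
  show "b \<otimes> x \<in> (A - E) \<union> (E - A)" "b \<otimes> x \<in> A \<longleftrightarrow> x \<in> A"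
    using i[OF A b(1)] i[OF E b(2)] assms(2) by auto
qed

lemma B_letter_right:
  assumes "b \<in> B" "x \<in> (A - E) \<union> (E - A)"
  shows "x \<otimes> b \<in> (A - E) \<union> (E - A)" "x \<otimes> b \<in> A \<longleftrightarrow> x \<in> A"
proof -
  have b: "b \<in> A" "b \<in> E" "b \<in> carrier G" using assms(1) in_carrier by auto
  have x: "x \<in> carrier G" using assms(2) in_carrier by auto
  have i: "x \<otimes> b \<in> H \<longleftrightarrow> x \<in> H" if "subgroup H G" "b \<in> H" for H
    using that b x by (metis inv_closed m_assoc r_inv r_one subgroup.m_closed subgroup.m_inv_closed)
  show "x \<otimes> b \<in> (A - E) \<union> (E - A)" "x \<otimes> b \<in> A \<longleftrightarrow> x \<in> A"
    using i[OF A b(1)] i[OF E b(2)] assms(2) by auto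
qed

lemma alt_B_left:
  assumes "b \<in> B" "alt (x # xs)"
  shows "alt ((b \<otimes> x) # xs)" "wprod ((b \<otimes> x) # xs) = b \<otimes> wprod (x # xs)"
  using assms B_letter_left[of b x] alt_carrier[OF assms(2)]
  by (auto simp: alt_Cons m_assoc dest: in_carrier)

lemma alt_B_right:
  assumes "b \<in> B" "alt (xs @ [x])"
  shows "alt (xs @ [x \<otimes> b])" "wprod (xs @ [x \<otimes> b]) = wprod (xs @ [x]) \<otimes> b"
proof -
  have "b \<in> carrier G" "x \<in> carrier G" "set xs \<subseteq> carrier G"
    using assms(1) alt_carrier[OF assms(2)] in_carrier by auto
  then show "wprod (xs @ [x \<otimes> b]) = wprod (xs @ [x]) \<otimes> b" by (simp add: wprod_append m_assoc)
  show "alt (xs @ [x \<otimes> b])"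
    using assms B_letter_right[of b x] by (auto simp: alt_append alt_Cons)
qed

lemma same_type_mult:
  assumes "x \<in> (A - E) \<union> (E - A)" "y \<in> (A - E) \<union> (E - A)" "(x \<in> A) = (y \<in> A)" "x \<otimes> y \<notin> B"
  shows "x \<otimes> y \<in> (A - E) \<union> (E - A)" "x \<otimes> y \<in> A \<longleftrightarrow> x \<in> A"
  using assms subgroup.m_closed[OF A, of x y] subgroup.m_closed[OF E, of x y] by auto

lemma reduced_letter_mult:
  assumes c: "c \<in> A \<union> E" and ws: "alt ws"
  shows "\<exists>b \<in> B. \<exists>ws'. alt ws' \<and> c \<otimes> wprod ws = b \<otimes> wprod ws'"
proof (cases "c \<in> B")
  case True
  then show ?thesis using ws by blast
next
  case False
  then have cl: "c \<in> (A - E) \<union> (E - A)" using c by auto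
  have cc: "c \<in> carrier G" using c in_carrier by auto
  have one: "\<one> \<in> B" using B by (rule subgroup.one_closed)
  show ?thesis
  proof (cases ws)
    case Nil
    then have "alt [c]" "c \<otimes> wprod ws = \<one> \<otimes> wprod [c]" using cl cc by (simp_all add: alt_Cons)
    then show ?thesis using one by blast
  next
    case (Cons x xs)
    have x: "x \<in> (A - E) \<union> (E - A)" "x \<in> carrier G" "alt xs" "set xs \<subseteq> carrier G"
      using ws Cons alt_carrier[OF ws] by (auto simp: alt_Cons)
    consider "(c \<in> A) \<noteq> (x \<in> A)" | "(c \<in> A) = (x \<in> A)" "c \<otimes> x \<in> B" | "(c \<in> A) = (x \<in> A)" "c \<otimes> x \<notin> B"
      by blast
    then show ?thesis
    proof cases
      case 1
      then have "alt (c # ws)" "c \<otimes> wprod ws = \<one> \<otimes> wprod (c # ws)"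
        using cl cc ws Cons x by (auto simp: alt_Cons)
      then show ?thesis using one by blast
    next
      case 2
      have "c \<otimes> wprod ws = (c \<otimes> x) \<otimes> wprod xs" using Cons cc x by (simp add: m_assoc)
      then show ?thesis using 2 x by blast
    next
      case 3
      have "alt ((c \<otimes> x) # xs)"
        using same_type_mult[OF cl x(1) 3] ws Cons 3 by (auto simp: alt_Cons)
      moreover have "c \<otimes> wprod ws = \<one> \<otimes> wprod ((c \<otimes> x) # xs)"
        using Cons cc x by (simp add: m_assoc)
      ultimately show ?thesis using one by blast
    qed
  qed
qed

lemma reduced_exists:
  assumes "g \<in> carrier G"
  shows "\<exists>b \<in> B. \<exists>ws. alt ws \<and> g = b \<otimes> wprod ws"
proof -
  obtain cs where cs: "set cs \<subseteq> A \<union> E" "g = wprod cs"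
    using generated[OF assms] by (auto simp: wprod_def)
  have "\<exists>b \<in> B. \<exists>ws. alt ws \<and> wprod cs = b \<otimes> wprod ws"
    using cs(1)
  proof (induction cs)
    case Nil
    then show ?case using subgroup.one_closed[OF B] by (intro bexI[of _ \<one>] exI[of _ "[]"]) auto
  next
    case (Cons c cs)
    then obtain b ws where b: "b \<in> B" "alt ws" "wprod cs = b \<otimes> wprod ws" by auto
    have c: "c \<in> A \<union> E" using Cons.prems by simp
    then have cb: "c \<otimes> b \<in> A \<union> E"
      using b(1) subgroup.m_closed[OF A, of c b] subgroup.m_closed[OF E, of c b] by auto
    have "c \<otimes> wprod cs = (c \<otimes> b) \<otimes> wprod ws"
      using b c in_carrier by (auto simp: m_assoc)
    then show ?case using reduced_letter_mult[OF cb b(2)] by simp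
  qed
  then show ?thesis using cs by simp
qed

text \<open>Working from the right, the factor \<open>b\<close> left over by the tail is attached to
  the next letter, and \<open>x \<otimes> b\<close> is split as \<open>b' \<otimes> t\<close>. Each
  letter changes only by factors from \<open>B\<close> on both sides; the \<open>list_all2\<close>
  clauses record this, since types and degrees will be read off the original word.\<close>

lemma transversal_form:
  assumes "alt ws"
  shows "\<exists>b \<in> B. \<exists>ts. alt ts \<and> set ts \<subseteq> T \<and> wprod ws = b \<otimes> wprod ts \<and>
    list_all2 (\<lambda>x t. (\<exists>b1 \<in> B. \<exists>b2 \<in> B. t = b1 \<otimes> x \<otimes> b2)) ws ts \<and>
    list_all2 (\<lambda>x t. (x \<in> A) = (t \<in> A)) ws ts"
  using assms
proof (induction ws)
  case Nil
  then show ?case using subgroup.one_closed[OF B] by (intro bexI[of _ \<one>] exI[of _ "[]"]) auto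
next
  case (Cons x ws)
  then have x: "x \<in> (A - E) \<union> (E - A)" "x \<in> carrier G" and ws: "alt ws"
    using alt_carrier[OF Cons.prems] by (auto simp: alt_Cons)
  obtain b ts where b: "b \<in> B" "alt ts" "set ts \<subseteq> T" "wprod ws = b \<otimes> wprod ts"
    "list_all2 (\<lambda>x t. (\<exists>b1 \<in> B. \<exists>b2 \<in> B. t = b1 \<otimes> x \<otimes> b2)) ws ts"
    "list_all2 (\<lambda>x t. (x \<in> A) = (t \<in> A)) ws ts"
    using Cons.IH[OF ws] by blast
  obtain b' t where t: "b' \<in> B" "t \<in> T" "x \<otimes> b = b' \<otimes> t"
    using T_exists[OF B_letter_right(1)[OF b(1) x(1)]] by blast
  have tl: "t \<in> (A - E) \<union> (E - A)" using t T_letters by blast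
  have car: "b \<in> carrier G" "b' \<in> carrier G" "t \<in> carrier G" using b t tl in_carrier by auto
  have ty: "(x \<in> A) = (t \<in> A)"
    using B_letter_right(2)[OF b(1) x(1)] B_letter_left(2)[OF t(1) tl] t(3) by simp
  have "alt (t # ts)"
  proof (cases ws)
    case Nil
    then show ?thesis using b tl by (simp add: alt_Cons)
  next
    case (Cons y ys)
    then obtain t' ts' where ts: "ts = t' # ts'" "(y \<in> A) = (t' \<in> A)"
      using b(6) by (auto simp: list_all2_Cons1)
    then show ?thesis using b tl Cons.prems \<open>alt (x # ws)\<close> ty Cons by (auto simp: alt_Cons)
  qed
  moreover have "wprod (x # ws) = b' \<otimes> wprod (t # ts)"
    using b t x car by (simp flip: m_assoc)
  moreover have "t = inv b' \<otimes> x \<otimes> b" using t car x by (simp add: m_assoc)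
  moreover have "inv b' \<in> B" using t(1) subgroup.m_inv_closed[OF B] by blast
  ultimately show ?case using b t ty
    by (intro bexI[of _ b'] exI[of _ "t # ts"]) auto
qed

text \<open>Compare the last letters \<open>x\<close> and \<open>y\<close>. If
  \<open>x \<otimes> inv y\<close> were not in \<open>B\<close>, then \<open>ts\<close>, this
  quotient (one merged letter or two letters, according to type) and the inverse of
  \<open>us\<close> would form a nonempty alternating word with product in \<open>B\<close>, against
  \<open>free\<close>. So \<open>x = y\<close> by \<open>T_unique\<close>, and the letters
  cancel.\<close>

lemma transversal_unique:
  assumes "b \<in> B" "b' \<in> B" "alt ts" "alt ts'" "set ts \<subseteq> T" "set ts' \<subseteq> T"
    "b \<otimes> wprod ts = b' \<otimes> wprod ts'"
  shows "b = b' \<and> ts = ts'"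
  using assms(3-)
proof (induction ts arbitrary: ts' rule: rev_induct)
  case Nil
  have car: "b \<in> carrier G" "b' \<in> carrier G" using assms in_carrier by auto
  have "wprod ts' = inv b' \<otimes> b" using Nil car by (metis alt_wprod_closed cancel_simps(2) r_one wprod_simps(1))
  then have "wprod ts' \<in> B" using assms(1,2) B by (metis subgroup.m_closed subgroup.m_inv_closed)
  then have "ts' = []" using alt_not_B Nil by blast
  then show ?case using Nil car by simp
next
  case (snoc x ts)
  have car: "b \<in> carrier G" "b' \<in> carrier G" using assms in_carrier by auto
  have ts: "alt ts" "x \<in> (A - E) \<union> (E - A)" "set ts \<subseteq> T" "x \<in> T"
    using snoc.prems by (auto simp: alt_append alt_Cons)
  have carts: "set ts \<subseteq> carrier G" "x \<in> carrier G" using alt_carrier[OF snoc.prems(1)] by auto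
  show ?case
  proof (cases ts' rule: rev_cases)
    case Nil
    have "wprod (ts @ [x]) = inv b \<otimes> b'" using snoc.prems car Nil
      by (metis alt_wprod_closed cancel_simps(2) r_one wprod_simps(1))
    then have "wprod (ts @ [x]) \<in> B" using assms(1,2) B by (metis subgroup.m_closed subgroup.m_inv_closed)
    then show ?thesis using alt_not_B snoc.prems(1) by blast
  next
    case (snoc us y)
    have us: "alt us" "y \<in> (A - E) \<union> (E - A)" "set us \<subseteq> T" "y \<in> T"
      using snoc.prems(2,4) snoc by (auto simp: alt_append alt_Cons)
    have carus: "set us \<subseteq> carrier G" "y \<in> carrier G" using alt_carrier[OF snoc.prems(2)] snoc by auto
    have eq: "b \<otimes> (wprod ts \<otimes> x) = b' \<otimes> (wprod us \<otimes> y)"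
      using snoc.prems(5) snoc carts carus by (simp add: wprod_append)
    let ?us = "map (\<lambda>x. inv x) (rev us)"
    have us': "alt ?us" "wprod ?us = inv (wprod us)" "set ?us \<subseteq> carrier G"
      using alt_inv[OF us(1)] wprod_inv[OF carus(1)] carus by auto
    have hdus: "us \<noteq> [] \<Longrightarrow> (hd ?us \<in> A) \<noteq> (y \<in> A)"
    proof -
      assume ne: "us \<noteq> []"
      then have "hd ?us = inv (last us)" by (simp add: hd_map hd_rev)
      moreover have "(last us \<in> A) \<noteq> (y \<in> A)" using ne snoc.prems(2) snoc by (auto simp: alt_append)
      ultimately show ?thesis using letter_inv(2)[OF alt_last[OF us(1) ne]] by simp
    qed
    have bb: "inv b \<otimes> b' \<in> B" using assms(1,2) B by (metis subgroup.m_closed subgroup.m_inv_closed)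
    have x': "wprod ts \<otimes> x = inv b \<otimes> b' \<otimes> (wprod us \<otimes> y)"
    proof -
      have "inv b \<otimes> (b \<otimes> (wprod ts \<otimes> x)) = inv b \<otimes> (b' \<otimes> (wprod us \<otimes> y))" using eq by simp
      then show ?thesis using car carts carus by (simp add: m_assoc)
    qed
    have prod: "wprod ts \<otimes> x \<otimes> inv y \<otimes> inv (wprod us) = inv b \<otimes> b'"
      unfolding x' using car carts carus by (simp add: m_assoc)
    have lt: "ts = [] \<or> (last ts \<in> A) \<noteq> (x \<in> A)" using snoc.prems(1) by (simp add: alt_append)
    have hu: "?us = [] \<or> (hd ?us \<in> A) \<noteq> (y \<in> A)" using hdus by (cases "us = []") simp_all
    have xy: "x \<otimes> inv y \<in> B"
    proof (rule ccontr)
      assume nB: "x \<otimes> inv y \<notin> B"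
      show False
      proof (cases "(x \<in> A) = (y \<in> A)")
        case True
        have "(x \<in> A) = (inv y \<in> A)" using True letter_inv(2)[OF us(2)] by simp
        note l = same_type_mult[OF ts(2) letter_inv(1)[OF us(2)] this nB]
        have "alt (ts @ (x \<otimes> inv y) # ?us)"
          unfolding alt_append alt_Cons list.sel using ts(1) l lt hu us'(1) True by blast
        moreover have "wprod (ts @ (x \<otimes> inv y) # ?us) = inv b \<otimes> b'"
          using prod carts carus us' by (simp add: wprod_append m_assoc)
        ultimately show False using alt_not_B bb by (metis append_is_Nil_conv list.distinct(1))
      next
        case False
        have "alt (ts @ x # inv y # ?us)"
          unfolding alt_append alt_Cons list.sel using ts(1,2) letter_inv[OF us(2)] lt hu us'(1) False by blast
        moreover have "wprod (ts @ x # inv y # ?us) = inv b \<otimes> b'"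
          using prod carts carus us' by (simp add: wprod_append m_assoc)
        ultimately show False using alt_not_B bb by (metis append_is_Nil_conv list.distinct(1))
      qed
    qed
    then have "x = y" using T_unique ts us by blast
    then have "b \<otimes> wprod ts \<otimes> x = b' \<otimes> wprod us \<otimes> x" using eq car carts carus by (simp add: m_assoc)
    then have "b \<otimes> wprod ts = b' \<otimes> wprod us" using car carts carus by simp
    then show ?thesis using snoc.IH[OF ts(1) us(1) ts(3) us(3)] snoc \<open>x = y\<close> by simp
  qed
qed

section \<open>Conjugates of alternating words\<close>

lemma B_right_word:
  assumes "b \<in> B" "c \<in> B" "alt hs"
  shows "\<exists>b' \<in> B. \<exists>hs'. alt hs' \<and> length hs' = length hs \<and> b \<otimes> wprod hs \<otimes> c = b' \<otimes> wprod hs'"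
proof (cases hs rule: rev_cases)
  case Nil
  then show ?thesis using assms in_carrier subgroup.m_closed[OF B assms(1,2)]
    by (intro bexI[of _ "b \<otimes> c"] exI[of _ "[]"]) auto
next
  case (snoc xs x)
  then show ?thesis using alt_B_right[OF assms(2), of xs x] assms in_carrier alt_carrier[OF assms(3)]
    by (intro bexI[of _ b] exI[of _ "xs @ [x \<otimes> c]"]) (auto simp: m_assoc)
qed

text \<open>A word of odd length has equal types at both ends, so \<open>hs\<close> in front and its
  inverse behind attach without any cancellation.\<close>

lemma conj_alt_odd:
  assumes hs: "alt hs" and v: "alt v" "v \<noteq> []" "odd (length v)"
    and ty: "hs = [] \<or> (last hs \<in> A) \<noteq> (hd v \<in> A)"
  shows "\<exists>ws. alt ws \<and> odd (length ws) \<and> length ws \<ge> length v \<and>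
    wprod hs \<otimes> wprod v \<otimes> inv (wprod hs) = wprod ws"
proof -
  let ?h = "map (\<lambda>x. inv x) (rev hs)"
  have "(last v \<in> A) = (hd v \<in> A)" using alt_parity[OF v(1,2)] v(3) by simp
  moreover have "hs \<noteq> [] \<Longrightarrow> hd ?h \<in> A \<longleftrightarrow> last hs \<in> A"
    using letter_inv(2)[OF alt_last[OF hs]] by (simp add: hd_map hd_rev)
  ultimately have "alt (hs @ v @ ?h)"
    using hs v ty alt_inv[OF hs] by (auto simp: alt_append)
  moreover have "wprod (hs @ v @ ?h) = wprod hs \<otimes> wprod v \<otimes> inv (wprod hs)"
    using alt_carrier[OF hs] alt_carrier[OF v(1)] alt_carrier[OF alt_inv[OF hs]]
    by (simp add: wprod_append wprod_inv m_assoc)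
  ultimately show ?thesis using v by (intro exI[of _ "hs @ v @ ?h"]) simp
qed

text \<open>The ends of the even word \<open>w\<close> have different types, so the last letter
  \<open>c\<close> of \<open>hs\<close> meets a letter of its own type at exactly one end. If the
  two cancel up to \<open>B\<close>, the effect is a rotation of \<open>w\<close>, with a shorter
  \<open>hs\<close> left. Otherwise they merge, the word becomes odd, and all further letters only
  lengthen it.\<close>

lemma conj_cyclic_aux:
  assumes "alt w" "even (length w)" "w \<noteq> []" "alt hs" "b \<in> B"
  shows "(\<exists>c \<in> B. \<exists>k. b \<otimes> wprod hs \<otimes> wprod w \<otimes> inv (b \<otimes> wprod hs) = c \<otimes> wprod (rotate k w) \<otimes> inv c) \<or>
    (\<exists>c \<in> B. \<exists>ws. alt ws \<and> odd (length ws) \<and> 3 \<le> length ws \<and>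
      b \<otimes> wprod hs \<otimes> wprod w \<otimes> inv (b \<otimes> wprod hs) = c \<otimes> wprod ws \<otimes> inv c)"
  using assms
proof (induction "length hs" arbitrary: hs b w rule: less_induct)
  case less
  note w = less.prems(1-3) and hs = less.prems(4) and b = less.prems(5)
  have carb: "b \<in> carrier G" using b in_carrier by auto
  have carw: "set w \<subseteq> carrier G" using alt_carrier[OF w(1)] .
  show ?case
  proof (cases hs rule: rev_cases)
    case Nil
    then show ?thesis using carb b by (intro disjI1 bexI[of _ b] exI[of _ 0]) auto
  next
    case (snoc hs' c)
    have hs': "alt hs'" "c \<in> (A - E) \<union> (E - A)" "hs' = [] \<or> (last hs' \<in> A) \<noteq> (c \<in> A)"
      using hs snoc by (auto simp: alt_append alt_Cons)
    have carh: "set hs' \<subseteq> carrier G" "c \<in> carrier G" using alt_carrier[OF hs] snoc by auto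
    have len: "length w \<ge> 2" using w by (cases w; cases "tl w") auto
    have ends: "(hd w \<in> A) \<noteq> (last w \<in> A)" using alt_parity[OF w(1,3)] w(2) by simp
    have h: "wprod hs = wprod hs' \<otimes> c" using snoc carh by (simp add: wprod_append)
    have odd_case: ?thesis
      if v: "alt v" "v \<noteq> []" "odd (length v)" "3 \<le> length v" "(hd v \<in> A) = (c \<in> A)"
        "c \<otimes> wprod w \<otimes> inv c = wprod v" for v
    proof -
      have "\<exists>ws. alt ws \<and> odd (length ws) \<and> length ws \<ge> length v \<and>
          wprod hs' \<otimes> wprod v \<otimes> inv (wprod hs') = wprod ws"
        using hs' v by (intro conj_alt_odd) auto
      then obtain ws where ws: "alt ws" "odd (length ws)" "length ws \<ge> length v"
        "wprod hs' \<otimes> wprod v \<otimes> inv (wprod hs') = wprod ws" by blast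
      have "b \<otimes> wprod hs \<otimes> wprod w \<otimes> inv (b \<otimes> wprod hs) = b \<otimes> wprod ws \<otimes> inv b"
        unfolding h ws(4)[symmetric] v(6)[symmetric]
        using carb carh carw by (simp add: m_assoc inv_mult_group)
      then show ?thesis using ws v(4) b by (intro disjI2 bexI[of _ b] exI[of _ ws]) auto
    qed
    \<comment> \<open>The factor \<open>c0\<close> left over by the rotation is moved into
      \<open>hs'\<close> without changing its length, so the induction on \<open>length hs\<close>
      applies to the rotated word.\<close>
    have rot_case: ?thesis
      if r: "w' = rotate k w" "c0 \<in> B" "c \<otimes> wprod w \<otimes> inv c = c0 \<otimes> wprod w' \<otimes> inv c0" "alt w'" for w' k c0
    proof -
      have carc: "c0 \<in> carrier G" using r in_carrier by auto
      obtain b' hs'' where b': "b' \<in> B" "alt hs''" "length hs'' = length hs'"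
        "b \<otimes> wprod hs' \<otimes> c0 = b' \<otimes> wprod hs''"
        using B_right_word[OF b r(2) hs'(1)] by blast
      have w': "even (length w')" "w' \<noteq> []" "set w' \<subseteq> carrier G"
        using w r alt_carrier[OF r(4)] by (auto simp: r(1))
      have e: "b \<otimes> wprod hs \<otimes> wprod w \<otimes> inv (b \<otimes> wprod hs) =
          b' \<otimes> wprod hs'' \<otimes> wprod w' \<otimes> inv (b' \<otimes> wprod hs'')"
      proof -
        have "b \<otimes> wprod hs \<otimes> wprod w \<otimes> inv (b \<otimes> wprod hs) =
            b \<otimes> wprod hs' \<otimes> (c \<otimes> wprod w \<otimes> inv c) \<otimes> inv (b \<otimes> wprod hs')"
          unfolding h using carb carh carw by (simp add: m_assoc inv_mult_group)
        also have "\<dots> = (b \<otimes> wprod hs' \<otimes> c0) \<otimes> wprod w' \<otimes> inv (b \<otimes> wprod hs' \<otimes> c0)"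
          unfolding r(3) using carb carh carc w'(3) by (simp add: m_assoc inv_mult_group)
        finally show ?thesis unfolding b'(4) .
      qed
      have "length hs'' < length hs" using b' snoc by simp
      from less.hyps[OF this r(4) w'(1,2) b'(2,1)] show ?thesis
        unfolding e r(1) rotate_rotate by blast
    qed
    show ?thesis
    proof (cases "(c \<in> A) = (last w \<in> A)")
      case True
      obtain v z where vz: "w = v @ [z]" using w(3) by (cases w rule: rev_cases) auto
      have vne: "v \<noteq> []" using len vz by auto
      have z: "z \<in> (A - E) \<union> (E - A)" "alt v" "(last v \<in> A) \<noteq> (z \<in> A)" "(c \<in> A) = (z \<in> A)"
        "(hd v \<in> A) \<noteq> (z \<in> A)"
        using w vz vne True ends by (auto simp: alt_append alt_Cons)
      have carz: "z \<in> carrier G" "set v \<subseteq> carrier G" using carw vz by auto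
      show ?thesis
      proof (cases "c \<otimes> inv z \<in> B")
        case True
        have "z # v = rotate (length v) w" unfolding vz by (simp add: rotate_append)
        moreover have "c \<otimes> wprod w \<otimes> inv c = (c \<otimes> inv z) \<otimes> wprod (z # v) \<otimes> inv (c \<otimes> inv z)"
          using carz carh by (simp add: vz wprod_append m_assoc inv_mult_group)
        moreover have "alt (z # v)" using z by (simp add: alt_Cons)
        ultimately show ?thesis using rot_case True by blast
      next
        case False
        have "inv (c \<otimes> inv z) \<notin> B" using False carh carz B
          by (metis inv_closed inv_inv m_closed subgroup.m_inv_closed)
        then have zc: "z \<otimes> inv c \<notin> B" using carh carz by (simp add: inv_mult_group)
        have l: "z \<otimes> inv c \<in> (A - E) \<union> (E - A)" "z \<otimes> inv c \<in> A \<longleftrightarrow> z \<in> A"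
          using same_type_mult[OF z(1) letter_inv(1)[OF hs'(2)] _ zc] letter_inv(2)[OF hs'(2)] z by auto
        have "alt (c # v @ [z \<otimes> inv c])"
          using l z hs' vne by (auto simp: alt_append alt_Cons)
        moreover have "c \<otimes> wprod w \<otimes> inv c = wprod (c # v @ [z \<otimes> inv c])"
          using carz carh by (simp add: vz wprod_append m_assoc)
        moreover have "odd (length (c # v @ [z \<otimes> inv c]))" "3 \<le> length (c # v @ [z \<otimes> inv c])"
          using w(2) len vz by auto
        ultimately show ?thesis using odd_case[of "c # v @ [z \<otimes> inv c]"] by simp
      qed
    next
      case False
      obtain z v where vz: "w = z # v" using w(3) by (cases w) auto
      have vne: "v \<noteq> []" using len vz by auto
      have z: "z \<in> (A - E) \<union> (E - A)" "alt v" "(hd v \<in> A) \<noteq> (z \<in> A)" "(c \<in> A) = (z \<in> A)"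
        "(last v \<in> A) \<noteq> (z \<in> A)"
        using w vz vne False ends by (auto simp: alt_Cons)
      have carz: "z \<in> carrier G" "set v \<subseteq> carrier G" using carw vz by auto
      show ?thesis
      proof (cases "c \<otimes> z \<in> B")
        case True
        have "v @ [z] = rotate 1 w" unfolding vz by simp
        moreover have "c \<otimes> wprod w \<otimes> inv c = (c \<otimes> z) \<otimes> wprod (v @ [z]) \<otimes> inv (c \<otimes> z)"
          using carz carh by (simp add: vz wprod_append m_assoc inv_mult_group)
        moreover have "alt (v @ [z])" using z by (simp add: alt_append alt_Cons)
        ultimately show ?thesis using rot_case True by blast
      next
        case cz: False
        have l: "c \<otimes> z \<in> (A - E) \<union> (E - A)" "c \<otimes> z \<in> A \<longleftrightarrow> c \<in> A"
          using same_type_mult[OF hs'(2) z(1) z(4) cz] by auto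
        have "alt ((c \<otimes> z) # v @ [inv c])"
          using l z hs' vne letter_inv[OF hs'(2)] by (auto simp: alt_append alt_Cons)
        moreover have "c \<otimes> wprod w \<otimes> inv c = wprod ((c \<otimes> z) # v @ [inv c])"
          using carz carh by (simp add: vz wprod_append m_assoc)
        moreover have "odd (length ((c \<otimes> z) # v @ [inv c]))" "3 \<le> length ((c \<otimes> z) # v @ [inv c])"
          using w(2) len vz by auto
        ultimately show ?thesis using odd_case[of "(c \<otimes> z) # v @ [inv c]"] l by simp
      qed
    qed
  qed
qed

lemma conj_cyclic:
  assumes "alt w" "even (length w)" "w \<noteq> []" "h \<in> carrier G"
  shows "(\<exists>c \<in> B. \<exists>k. h \<otimes> wprod w \<otimes> inv h = c \<otimes> wprod (rotate k w) \<otimes> inv c) \<or>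
    (\<exists>c \<in> B. \<exists>ws. alt ws \<and> odd (length ws) \<and> 3 \<le> length ws \<and> h \<otimes> wprod w \<otimes> inv h = c \<otimes> wprod ws \<otimes> inv c)"
  using conj_cyclic_aux[OF assms(1-3)] reduced_exists[OF assms(4)] by auto

lemma alt_rotate:
  assumes "alt w" "even (length w)"
  shows "alt (rotate k w)"
proof (induction k)
  case (Suc k)
  show ?case
  proof (cases "rotate k w")
    case (Cons x xs)
    have "even (length (x # xs))" using assms(2) Cons by (metis length_rotate)
    moreover have alt: "alt (x # xs)" using Suc Cons by simp
    ultimately have "(x \<in> A) \<noteq> (last (x # xs) \<in> A)"
      using alt_parity[of "x # xs"] by simp
    then have "xs = [] \<or> (last xs \<in> A) \<noteq> (x \<in> A)" by (cases "xs = []") auto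
    then have "alt (xs @ [x])" using alt alt_Nil unfolding alt_append alt_Cons list.sel by blast
    then show ?thesis using Cons by simp
  qed (use Suc in simp)
qed (use assms in simp)

text \<open>In a word of odd length above one, conjugation by the last letter brings it to the
  front, where it meets a letter of its own type. Either the two merge and the word becomes even, or
  their product lies in \<open>B\<close> and the word is shorter by two.\<close>

lemma conj_factor_or_cyclic:
  assumes "g \<in> carrier G"
  shows "\<exists>h \<in> carrier G. h \<otimes> g \<otimes> inv h \<in> A \<union> E \<or>
    (\<exists>w. alt w \<and> even (length w) \<and> w \<noteq> [] \<and> h \<otimes> g \<otimes> inv h = wprod w)"
proof -
  have "\<exists>h \<in> carrier G. h \<otimes> (b \<otimes> wprod ws) \<otimes> inv h \<in> A \<union> E \<or>
    (\<exists>w. alt w \<and> even (length w) \<and> w \<noteq> [] \<and> h \<otimes> (b \<otimes> wprod ws) \<otimes> inv h = wprod w)"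
    if "b \<in> B" "alt ws" for b ws
    using that
  proof (induction "length ws" arbitrary: b ws rule: less_induct)
    case less
    have carb: "b \<in> carrier G" using less.prems in_carrier by auto
    show ?case
    proof (cases ws)
      case Nil
      then show ?thesis using less.prems carb by (intro bexI[of _ \<one>]) auto
    next
      case (Cons x0 xs)
      define x where "x = b \<otimes> x0"
      have g: "alt (x # xs)" "b \<otimes> wprod ws = wprod (x # xs)"
        using alt_B_left[of b x0 xs] less.prems Cons by (simp_all add: x_def)
      have carx: "x \<in> carrier G" "set xs \<subseteq> carrier G" using alt_carrier[OF g(1)] by auto
      have x: "x \<in> (A - E) \<union> (E - A)" using g(1) by (simp add: alt_Cons)
      consider "xs = []" | "even (length (x # xs))" | "xs \<noteq> []" "odd (length (x # xs))" by auto
      then show ?thesis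
      proof cases
        case 1
        then show ?thesis using g x carx by (intro bexI[of _ \<one>]) auto
      next
        case 2
        then show ?thesis unfolding g(2) using g(1) carx
          by (intro bexI[of _ \<one>] disjI2 exI[of _ "x # xs"]) auto
      next
        case 3
        obtain v z where vz: "xs = v @ [z]" using 3 by (cases xs rule: rev_cases) auto
        have carz: "z \<in> carrier G" "set v \<subseteq> carrier G" using carx vz by auto
        have z: "z \<in> (A - E) \<union> (E - A)" "alt v" using g(1) vz by (auto simp: alt_Cons alt_append)
        have ty: "(z \<in> A) = (x \<in> A)" using alt_parity[OF g(1)] 3 vz by simp
        have conj: "z \<otimes> wprod (x # xs) \<otimes> inv z = (z \<otimes> x) \<otimes> wprod v"
          using carx carz by (simp add: vz wprod_append m_assoc)
        show ?thesis
        proof (cases "z \<otimes> x \<in> B")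
          case True
          have "length v < length ws" using vz Cons by simp
          from less.hyps[OF this True z(2)] obtain h where h: "h \<in> carrier G"
            "h \<otimes> (z \<otimes> x \<otimes> wprod v) \<otimes> inv h \<in> A \<union> E \<or>
             (\<exists>w. alt w \<and> even (length w) \<and> w \<noteq> [] \<and> h \<otimes> (z \<otimes> x \<otimes> wprod v) \<otimes> inv h = wprod w)" by blast
          have "h \<otimes> (z \<otimes> x \<otimes> wprod v) \<otimes> inv h = (h \<otimes> z) \<otimes> (b \<otimes> wprod ws) \<otimes> inv (h \<otimes> z)"
            unfolding g(2) conj[symmetric] using h carx carz by (simp add: m_assoc inv_mult_group)
          then show ?thesis using h carz by (metis m_closed)
        next
          case False
          have l: "z \<otimes> x \<in> (A - E) \<union> (E - A)" "z \<otimes> x \<in> A \<longleftrightarrow> z \<in> A"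
            using same_type_mult[OF z(1) x ty False] by auto
          have "alt ((z \<otimes> x) # v)" using l ty g(1) z vz by (auto simp: alt_Cons)
          moreover have "even (length ((z \<otimes> x) # v))" using 3 vz by simp
          moreover have "z \<otimes> (b \<otimes> wprod ws) \<otimes> inv z = wprod ((z \<otimes> x) # v)"
            unfolding g(2) conj by simp
          ultimately show ?thesis using carz by (metis list.distinct(1))
        qed
      qed
    qed
  qed
  then show ?thesis using reduced_exists[OF assms] by blast
qed

text \<open>Different types at the two ends allow copies of \<open>w\<close> to be concatenated, so
  a power is again the product of a nonempty alternating word and avoids \<open>B\<close>.\<close>

lemma cyclic_power_ne_one:
  assumes "alt w" "even (length w)" "w \<noteq> []" "n > 0"
  shows "wprod w [^] (n::nat) \<noteq> \<one>"
proof -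
  have "alt (concat (replicate k w)) \<and> wprod (concat (replicate k w)) = wprod w [^] k" for k
  proof (induction k)
    case (Suc k)
    have ends: "(hd w \<in> A) \<noteq> (last w \<in> A)" using alt_parity[OF assms(1,3)] assms(2) by simp
    have "k > 0 \<Longrightarrow> hd (concat (replicate k w)) = hd w" using assms(3) by (cases k) auto
    then have "alt (w @ concat (replicate k w))"
      using assms(1) Suc ends by (cases "k = 0") (auto simp: alt_append)
    moreover have "wprod (w @ concat (replicate k w)) = wprod w \<otimes> wprod w [^] k"
      using Suc alt_carrier[OF assms(1)] alt_carrier[OF conjunct1[OF Suc]] by (simp add: wprod_append)
    moreover have "wprod w \<otimes> wprod w [^] k = wprod w [^] Suc k"
      using assms(1) by (metis alt_wprod_closed nat_pow_Suc2)
    ultimately show ?case by simp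
  qed simp
  moreover have "concat (replicate n w) \<noteq> []" using assms(3,4) by (cases n) auto
  ultimately show ?thesis using alt_not_B subgroup.one_closed[OF B] by metis
qed

lemma finite_order_conj_factor:
  assumes g: "g \<in> carrier G" and "g [^] (n::nat) = \<one>" "n > 0"
  shows "\<exists>h \<in> carrier G. h \<otimes> g \<otimes> inv h \<in> A \<union> E"
proof -
  obtain h where h: "h \<in> carrier G" and "h \<otimes> g \<otimes> inv h \<in> A \<union> E \<or>
    (\<exists>w. alt w \<and> even (length w) \<and> w \<noteq> [] \<and> h \<otimes> g \<otimes> inv h = wprod w)"
    using conj_factor_or_cyclic[OF g] by blast
  then consider "h \<otimes> g \<otimes> inv h \<in> A \<union> E" | w where "alt w" "even (length w)" "w \<noteq> []" "h \<otimes> g \<otimes> inv h = wprod w"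
    by blast
  then show ?thesis
  proof cases
    case 2
    have "wprod w [^] n = \<one>" using conj_pow[OF h g, of n] assms h 2 by simp
    then show ?thesis using cyclic_power_ne_one 2 assms by blast
  qed (use h in blast)
qed

end

section \<open>Normal forms\<close>

lemma aff_eq_elementary: "aff a b 0 d u v = elementary_map a [:u, b:] d v"
  by (simp add: aff_def elementary_map_def in_y_eq)

lemma degree_fst_elementary:
  "degree P \<ge> 1 \<Longrightarrow> degree (fst (elementary_map \<alpha> P \<beta> v)) = degree P"
proof -
  assume P: "degree P \<ge> 1"
  have d: "degree (in_y P) = degree P"
    unfolding in_y_def by (rule degree_map_poly) simp
  have "const2 \<alpha> * X2 = [:[:0, \<alpha>:]:]" by (simp add: const2_def X2_def)
  then have "degree (const2 \<alpha> * X2) < degree (in_y P)" using P d by simp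
  then show ?thesis using d by (simp add: elementary_map_def degree_add_eq_right)
qed

lemma degree_fst_aff: "degree (fst (aff a b c d u v)) \<le> 1"
  by (simp add: aff_expand)

lemma aff_mem_elementary_iff:
  assumes "a * d - b * c \<noteq> 0"
  shows "aff a b c d u v \<in> elementary_maps \<longleftrightarrow> c = 0"
proof
  assume "aff a b c d u v \<in> elementary_maps"
  then show "c = 0" by (auto simp: elementary_maps_def aff_expand elementary_expand)
next
  assume "c = 0"
  then show "aff a b c d u v \<in> elementary_maps"
    using assms unfolding elementary_maps_def by (auto simp: aff_eq_elementary)
qed

lemma elementary_mem_affine_iff:
  assumes "\<alpha> * \<beta> \<noteq> 0"
  shows "elementary_map \<alpha> P \<beta> v \<in> affine_maps \<longleftrightarrow> degree P \<le> 1"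
proof
  assume "elementary_map \<alpha> P \<beta> v \<in> affine_maps"
  then have "degree (fst (elementary_map \<alpha> P \<beta> v)) \<le> 1"
    using degree_fst_aff by (auto simp: affine_maps_aff)
  then show "degree P \<le> 1" using degree_fst_elementary[of P \<alpha> \<beta> v] by (cases "degree P \<ge> 1") auto
next
  assume "degree P \<le> 1"
  then have "P = [:coeff P 0, coeff P 1:]"
    by (intro poly_eqI) (auto simp: coeff_pCons coeff_eq_0 split: nat.split)
  then have "elementary_map \<alpha> P \<beta> v = aff \<alpha> (coeff P 1) 0 \<beta> (coeff P 0) v"
    by (metis aff_eq_elementary)
  then show "elementary_map \<alpha> P \<beta> v \<in> affine_maps"
    using assms by (simp add: aff_in_affine_maps)
qed

lemma basic_maps_iff: "f \<in> basic_maps \<longleftrightarrow> (\<exists>a b d u v. a * d \<noteq> 0 \<and> f = aff a b 0 d u v)"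
proof
  assume "f \<in> basic_maps"
  then obtain a b c d u v where f: "f = aff a b c d u v" "a * d - b * c \<noteq> 0" "f \<in> elementary_maps"
    by (auto simp: basic_maps_def affine_maps_aff)
  then have c: "c = 0" using aff_mem_elementary_iff[OF f(2)] by simp
  then have "a * d \<noteq> 0" using f by simp
  then show "\<exists>a b d u v. a * d \<noteq> 0 \<and> f = aff a b 0 d u v" using f(1) c by blast
next
  assume "\<exists>a b d u v. a * d \<noteq> 0 \<and> f = aff a b 0 d u v"
  then obtain a b d u v where f: "a * d \<noteq> 0" "f = aff a b 0 d u v" by blast
  then have "f \<in> affine_maps" by (simp add: aff_in_affine_maps)
  moreover have "f \<in> elementary_maps" using f by (simp add: aff_mem_elementary_iff)
  ultimately show "f \<in> basic_maps" by (simp add: basic_maps_def)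
qed

lemma affine_not_elementary:
  "f \<in> affine_maps - elementary_maps \<longleftrightarrow>
    (\<exists>a b c d u v. a * d - b * c \<noteq> 0 \<and> c \<noteq> 0 \<and> f = aff a b c d u v)"
proof
  assume f: "f \<in> affine_maps - elementary_maps"
  then obtain a b c d u v where "f = aff a b c d u v" "a * d - b * c \<noteq> 0" by (auto simp: affine_maps_aff)
  then show "\<exists>a b c d u v. a * d - b * c \<noteq> 0 \<and> c \<noteq> 0 \<and> f = aff a b c d u v"
    using f aff_mem_elementary_iff[of a d b c u v] by blast
qed (auto simp: aff_in_affine_maps aff_mem_elementary_iff)

lemma elementary_not_affine:
  "f \<in> elementary_maps - affine_maps \<longleftrightarrow>
    (\<exists>\<alpha> P \<beta> v. \<alpha> * \<beta> \<noteq> 0 \<and> degree P \<ge> 2 \<and> f = elementary_map \<alpha> P \<beta> v)"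
proof
  assume f: "f \<in> elementary_maps - affine_maps"
  then obtain \<alpha> P \<beta> v where e: "f = elementary_map \<alpha> P \<beta> v" "\<alpha> * \<beta> \<noteq> 0" by (auto simp: elementary_maps_def)
  then have "degree P \<ge> 2" using f elementary_mem_affine_iff[OF e(2), of P v] by simp
  then show "\<exists>\<alpha> P \<beta> v. \<alpha> * \<beta> \<noteq> 0 \<and> degree P \<ge> 2 \<and> f = elementary_map \<alpha> P \<beta> v" using e by blast
next
  assume "\<exists>\<alpha> P \<beta> v. \<alpha> * \<beta> \<noteq> 0 \<and> degree P \<ge> 2 \<and> f = elementary_map \<alpha> P \<beta> v"
  then obtain \<alpha> P \<beta> v where e: "\<alpha> * \<beta> \<noteq> 0" "degree P \<ge> 2" "f = elementary_map \<alpha> P \<beta> v" by blast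
  then show "f \<in> elementary_maps - affine_maps"
    using elementary_mem_affine_iff[OF e(1), of P v] by (auto simp: elementary_maps_def)
qed

section \<open>The representatives in \<open>I_maps\<close> and \<open>J_maps\<close>\<close>

lemma shear_elementary: "shear P = elementary_map 1 ([:0, 0, 1:] * P) 1 0"
  by (simp add: shear_def elementary_map_def in_y_eq power2_eq_square algebra_simps)

lemma degree_y2_mult: "P \<noteq> 0 \<Longrightarrow> degree ([:0, 0, 1:] * P) = 2 + degree P" for P :: "'a::field poly"
  by (subst degree_mult_eq) auto

lemma shear_inject: "shear P = shear Q \<longleftrightarrow> P = Q" for P Q :: "'a::field poly"
  unfolding shear_elementary elementary_eq_iff by (metis mult_left_cancel pCons_eq_0_iff zero_neq_one)

lemma I_maps_aff: "I_maps = {aff 0 1 1 \<beta> 0 0 | \<beta>. True}"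
  by (simp add: I_maps_def linear_map_matrix22)

lemma I_maps_letters: "I_maps \<subseteq> affine_maps - elementary_maps"
  by (auto simp: I_maps_aff aff_in_affine_maps aff_mem_elementary_iff)

lemma J_maps_letters: "J_maps \<subseteq> elementary_maps - affine_maps"
proof
  fix f :: "'a pmap" assume "f \<in> J_maps"
  then obtain P where P: "f = shear P" "P \<noteq> 0" by (auto simp: J_maps_def)
  have "degree ([:0, 0, 1:] * P) \<ge> 2" by (simp only: degree_y2_mult[OF P(2)] le_add1)
  then show "f \<in> elementary_maps - affine_maps"
    unfolding elementary_not_affine P(1) shear_elementary by (metis mult_1 zero_neq_one)
qed

lemma degree_fst_shear: "P \<noteq> 0 \<Longrightarrow> degree (fst (shear P)) = 2 + degree P" for P :: "'a::field poly"
  unfolding shear_elementary using degree_fst_elementary degree_y2_mult by (metis le_add1 one_add_one le_trans)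

lemma J_degree_eq:
  assumes "e \<in> J_maps"
  shows "J_degree e = degree (fst e)"
proof -
  obtain P where P: "e = shear P" "P \<noteq> 0" using assms by (auto simp: J_maps_def)
  have "J_degree e = 2 + degree P"
    unfolding J_degree_def P(1) by (rule the_equality) (use P in \<open>auto simp: shear_inject\<close>)
  moreover have "degree (fst e) = 2 + degree P" unfolding P(1) by (rule degree_fst_shear[OF P(2)])
  ultimately show ?thesis by simp
qed

text \<open>Basic maps on either side act on the polynomial of an elementary letter by scaling, by
  an invertible linear substitution for \<open>y\<close> and by terms of degree at most one. This
  invariance on double cosets is why \<open>pol_deg\<close> can be read off any alternating
  word.\<close>

lemma degree_fst_basic_comp:
  assumes x: "x \<in> elementary_maps - affine_maps" and b: "b1 \<in> basic_maps" "b2 \<in> basic_maps"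
  shows "degree (fst (pmap_comp (pmap_comp b1 x) b2)) = degree (fst x)"
proof -
  obtain \<alpha> P \<beta> v where e: "\<alpha> * \<beta> \<noteq> 0" "degree P \<ge> 2" "x = elementary_map \<alpha> P \<beta> v"
    using x unfolding elementary_not_affine by blast
  obtain a1 c1 d1 u1 v1 where b1: "a1 * d1 \<noteq> 0" "b1 = elementary_map a1 [:u1, c1:] d1 v1"
    using b(1) unfolding basic_maps_iff aff_eq_elementary by blast
  obtain a2 c2 d2 u2 v2 where b2: "a2 * d2 \<noteq> 0" "b2 = elementary_map a2 [:u2, c2:] d2 v2"
    using b(2) unfolding basic_maps_iff aff_eq_elementary by blast
  have "degree (pcompose [:u1, c1:] [:v, \<beta>:]) \<le> 1"
    by (rule order_trans[OF degree_pcompose_le]) simp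
  then have 1: "degree (smult a1 P + pcompose [:u1, c1:] [:v, \<beta>:]) = degree P"
    using e b1 by (subst degree_add_eq_left) auto
  have "degree (smult (a1 * \<alpha>) [:u2, c2:]) \<le> 1" by simp
  moreover have 2: "degree (pcompose (smult a1 P + pcompose [:u1, c1:] [:v, \<beta>:]) [:v2, d2:]) = degree P"
    using 1 b2 by (simp add: degree_pcompose)
  ultimately have "degree (smult (a1 * \<alpha>) [:u2, c2:] +
      pcompose (smult a1 P + pcompose [:u1, c1:] [:v, \<beta>:]) [:v2, d2:]) = degree P"
    using e by (subst degree_add_eq_right) auto
  then show ?thesis
    unfolding e(3) b1(2) b2(2) elementary_comp
    using e(2) by (subst (1 2) degree_fst_elementary) auto
qed

lemma letters_transversal_exists:
  assumes "x \<in> (affine_maps - elementary_maps) \<union> (elementary_maps - affine_maps)"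
  shows "\<exists>b \<in> basic_maps. \<exists>t \<in> I_maps \<union> J_maps. x = pmap_comp b t"
proof (cases "x \<in> affine_maps - elementary_maps")
  case True
  then obtain a b c d u v where x: "a * d - b * c \<noteq> 0" "c \<noteq> 0" "x = aff a b c d u v"
    unfolding affine_not_elementary by blast
  \<comment> \<open>A Bruhat decomposition: the lower row \<open>(c, d)\<close> is \<open>c\<close>
    times the lower row \<open>(1, d / c)\<close> of the representative, and the rest is
    triangular.\<close>
  have "x = pmap_comp (aff (b - a * (d / c)) a 0 c u v) (aff 0 1 1 (d / c) 0 0)"
    using x by (simp add: aff_comp aff_eq_iff)
  moreover have "(b - a * (d / c)) * c \<noteq> 0"
    using x by (auto simp: algebra_simps)
  then have "aff (b - a * (d / c)) a 0 c u v \<in> basic_maps" unfolding basic_maps_iff by blast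
  moreover have "aff 0 1 1 (d / c) 0 0 \<in> I_maps \<union> J_maps" by (auto simp: I_maps_aff)
  ultimately show ?thesis by blast
next
  case False
  then have "x \<in> elementary_maps - affine_maps" using assms by blast
  then obtain \<alpha> P \<beta> v where e: "\<alpha> * \<beta> \<noteq> 0" "degree P \<ge> 2" "x = elementary_map \<alpha> P \<beta> v"
    unfolding elementary_not_affine by blast
  obtain p0 p1 P2 where P: "P = pCons p0 (pCons p1 P2)" by (metis pCons_cases)
  have P2: "P2 \<noteq> 0" using e(2) P by (auto split: if_splits)
  \<comment> \<open>The terms of degree at most one go into the basic factor; since that factor is
    applied last and scales by \<open>\<alpha>\<close>, the shear carries
    \<open>1 / \<alpha>\<close>.\<close>
  have "smult \<alpha> ([:0, 0, 1:] * smult (1 / \<alpha>) P2) + [:p0, p1:] = P"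
    using e(1) by (simp add: P)
  then have "x = pmap_comp (aff \<alpha> p1 0 \<beta> p0 v) (shear (smult (1 / \<alpha>) P2))"
    unfolding e(3) shear_elementary aff_eq_elementary elementary_comp elementary_eq_iff by simp
  moreover have "aff \<alpha> p1 0 \<beta> p0 v \<in> basic_maps" using e(1) unfolding basic_maps_iff by blast
  moreover have "shear (smult (1 / \<alpha>) P2) \<in> J_maps" using P2 e(1) by (auto simp: J_maps_def)
  ultimately show ?thesis by blast
qed

lemma letters_transversal_unique:
  assumes t: "t \<in> I_maps \<union> J_maps" "t' \<in> I_maps \<union> J_maps" and b: "b \<in> basic_maps" and eq: "t = pmap_comp b t'"
  shows "t = t'"
proof -
  obtain a c d u v where b': "a * d \<noteq> 0" "b = aff a c 0 d u v" using b unfolding basic_maps_iff by blast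
  have bA: "b \<in> affine_maps" "b \<in> elementary_maps" using b by (auto simp: basic_maps_def)
  have A: "t' \<in> affine_maps \<Longrightarrow> t \<in> affine_maps"
    using subgroup.m_closed[OF affine_subgroup bA(1)] eq by simp
  have E: "t' \<in> elementary_maps \<Longrightarrow> t \<in> elementary_maps"
    using subgroup.m_closed[OF elementary_subgroup bA(2)] eq by simp
  consider "t \<in> I_maps" "t' \<in> I_maps" | "t \<in> J_maps" "t' \<in> J_maps"
    using t A E I_maps_letters J_maps_letters by blast
  then show ?thesis
  proof cases
    case 1
    then obtain \<beta> \<beta>' where tt: "t = aff 0 1 1 \<beta> 0 0" "t' = aff 0 1 1 \<beta>' 0 0" by (auto simp: I_maps_aff)
    show ?thesis using eq unfolding tt b' aff_comp aff_eq_iff by auto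
  next
    case 2
    then obtain P P' where tt: "t = shear P" "t' = shear P'" by (auto simp: J_maps_def)
    have "a = 1" "[:0, 0, 1:] * P = smult a ([:0, 0, 1:] * P') + [:u, c:]"
      using eq unfolding tt b' shear_elementary aff_eq_elementary elementary_comp elementary_eq_iff by simp_all
    then have "P = P'" by simp
    then show ?thesis using tt by simp
  qed
qed

text \<open>
  Composition with \<open>(X2 * Y2, Y2)\<close> turns the total degree into the degree in the outer variable.
\<close>

lemma degrees_of_word:
  assumes "set ws \<subseteq> (affine_maps - elementary_maps) \<union> (elementary_maps - affine_maps)"
    and "successively (\<lambda>x y. (x \<in> affine_maps) \<noteq> (y \<in> affine_maps)) ws" and "ws \<noteq> []"
  defines "g \<equiv> \<lambda>ws. pmap_comp (comp_list ws) (X2 * Y2, Y2 :: 'a::field poly poly)"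
  shows "(hd ws \<in> affine_maps \<longrightarrow> degree (fst (g ws)) \<le> degree (snd (g ws)) \<and> 1 \<le> degree (snd (g ws)) \<and>
      (length ws \<ge> 2 \<longrightarrow> 2 \<le> degree (snd (g ws)))) \<and>
    (hd ws \<notin> affine_maps \<longrightarrow> degree (snd (g ws)) < degree (fst (g ws)) \<and> 1 \<le> degree (snd (g ws)))"
  using assms(1-3)
proof (induction ws)
  case (Cons w ws)
  let ?g = "g ws"
  have gw: "g (w # ws) = pmap_comp w ?g" by (simp add: g_def pmap_comp_assoc)
  show ?case
  proof (cases "w \<in> affine_maps")
    case True
    then have "w \<in> affine_maps - elementary_maps" using Cons.prems by auto
    then obtain a b c d u v where w: "a * d - b * c \<noteq> 0" "c \<noteq> 0" "w = aff a b c d u v"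
      unfolding affine_not_elementary by blast
    have g': "g (w # ws) = (const2 a * fst ?g + const2 b * snd ?g + const2 u, const2 c * fst ?g + const2 d * snd ?g + const2 v)"
      using gw by (simp only: w(3) pmap_comp_aff)
    show ?thesis
    proof (cases "ws = []")
      case True
      have "?g = (X2 * Y2, Y2)" by (simp add: g_def True)
      then have "g (w # ws) = ([:[:u:], [:b, a:]:], [:[:v:], [:d, c:]:])"
        unfolding g' by (simp add: const2_def X2_def Y2_def)
      then show ?thesis using w True \<open>w \<in> affine_maps\<close> by simp
    next
      case False
      then have "hd ws \<notin> affine_maps" using Cons.prems \<open>w \<in> affine_maps\<close> by (auto simp: successively_Cons)
      then have IH: "degree (snd ?g) < degree (fst ?g)" "1 \<le> degree (snd ?g)"
        using Cons False by (auto simp: successively_Cons)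
      have dc: "degree (const2 k * p) \<le> degree p" for k and p :: "'a poly poly"
        by (simp add: const2_def)
      have c0: "degree (const2 k :: 'a poly poly) = 0" for k by (simp add: const2_def)
      have "degree (const2 a * fst ?g + const2 b * snd ?g + const2 u) \<le> degree (fst ?g)"
        using IH dc[of a "fst ?g"] dc[of b "snd ?g"] by (intro degree_add_le) (auto simp: c0)
      moreover have "degree (const2 c * fst ?g) = degree (fst ?g)"
        using w(2) by (simp add: const2_def)
      then have "degree (const2 c * fst ?g + const2 d * snd ?g + const2 v) = degree (fst ?g)"
        using IH dc[of d "snd ?g"] by (simp add: degree_add_eq_left c0)
      ultimately show ?thesis using IH \<open>w \<in> affine_maps\<close> unfolding g' by simp
    qed
  next
    case False
    then have "w \<in> elementary_maps - affine_maps" using Cons.prems by auto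
    then obtain \<alpha> P \<beta> v where w: "\<alpha> * \<beta> \<noteq> 0" "degree P \<ge> 2" "w = elementary_map \<alpha> P \<beta> v"
      unfolding elementary_not_affine by blast
    have g': "g (w # ws) = (const2 \<alpha> * fst ?g + subst_x P (snd ?g), const2 \<beta> * snd ?g + const2 v)"
      using gw by (simp only: w(3) pmap_comp_elementary)
    have IH: "degree (fst ?g) \<le> degree (snd ?g)" "1 \<le> degree (snd ?g)"
    proof -
      have "degree (fst ?g) \<le> degree (snd ?g) \<and> 1 \<le> degree (snd ?g)"
      proof (cases "ws = []")
        case True
        have "?g = (X2 * Y2, Y2)" by (simp add: g_def True)
        then show ?thesis by (simp add: X2_def Y2_def)
      next
        case F: False
        then have "hd ws \<in> affine_maps" using Cons.prems False by (auto simp: successively_Cons)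
        then show ?thesis using Cons F by (auto simp: successively_Cons)
      qed
      then show "degree (fst ?g) \<le> degree (snd ?g)" "1 \<le> degree (snd ?g)" by auto
    qed
    have dP: "degree (subst_x P (snd ?g)) = degree (snd ?g) * degree P"
      using IH by (intro degree_subst_x) simp
    have gt: "degree (snd ?g) < degree (snd ?g) * degree P"
      using IH(2) w(2) by simp
    have "degree (const2 \<alpha> * fst ?g) \<le> degree (snd ?g)" using IH(1) by (simp add: const2_def)
    then have "degree (const2 \<alpha> * fst ?g + subst_x P (snd ?g)) = degree (snd ?g) * degree P"
      using dP le_less_trans[OF _ gt] by (subst degree_add_eq_right) (simp_all only:)
    moreover have "degree (const2 \<beta> * snd ?g) = degree (snd ?g)"
      using w(1) by (simp add: const2_def)
    then have "degree (const2 \<beta> * snd ?g + const2 v) = degree (snd ?g)"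
      using IH(2) by (subst degree_add_eq_left) (auto simp: const2_def)
    ultimately show ?thesis using gt IH(2) False unfolding g' by simp
  qed
qed simp

text \<open>After composition with \<open>(X2 * Y2, Y2)\<close> both components of a basic map have
  degree 1. By \<open>degrees_of_word\<close> an elementary first letter makes the two degrees
  differ, and an affine one followed by further letters makes the second at least 2. A single letter
  is not basic by assumption.\<close>

lemma word_not_basic:
  fixes ws :: "'a::field pmap list"
  assumes "ws \<noteq> []" "set ws \<subseteq> (affine_maps - elementary_maps) \<union> (elementary_maps - affine_maps)"
    and "successively (\<lambda>x y. (x \<in> affine_maps) \<noteq> (y \<in> affine_maps)) ws"
  shows "comp_list ws \<notin> basic_maps"
proof
  assume "comp_list ws \<in> basic_maps"
  then obtain a b d u v where f: "a * d \<noteq> 0" "comp_list ws = aff a b 0 d u v"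
    unfolding basic_maps_iff by blast
  have "pmap_comp (comp_list ws) (X2 * Y2, Y2) = ([:[:u:], [:b, a:]:], [:[:v:], [:d:]:])"
    unfolding f(2) pmap_comp_aff by (simp add: const2_def X2_def Y2_def)
  then have dg: "degree (fst (pmap_comp (comp_list ws) (X2 * Y2, Y2))) = 1"
    "degree (snd (pmap_comp (comp_list ws) (X2 * Y2, Y2))) = 1" using f(1) by simp_all
  note D = degrees_of_word[OF assms(2,3,1)]
  show False
  proof (cases "hd ws \<in> affine_maps")
    case True
    then have "\<not> length ws \<ge> 2" using D dg by auto
    then obtain w where "ws = [w]" using assms(1) by (cases ws; cases "tl ws") auto
    then show False using assms(2) \<open>comp_list ws \<in> basic_maps\<close> by (auto simp: basic_maps_def)
  next
    case False
    then show False using D dg by auto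
  qed
qed

text \<open>\<open>generated\<close> is tameness and \<open>free\<close> is the degree argument; the
  transversal consists of the factors allowed in normal forms.\<close>

interpretation am: amalgam "GA2 :: 'a::field pmap monoid" affine_maps elementary_maps "I_maps \<union> J_maps"
proof (intro amalgam.intro amalgam_axioms.intro)
  show "group (GA2 :: 'a pmap monoid)" by (rule group_GA2)
  show "subgroup affine_maps (GA2 :: 'a pmap monoid)" by (rule affine_subgroup)
  show "subgroup elementary_maps (GA2 :: 'a pmap monoid)" by (rule elementary_subgroup)
  show "I_maps \<union> J_maps \<subseteq> (affine_maps - elementary_maps) \<union> (elementary_maps - affine_maps :: 'a pmap set)"
    using I_maps_letters J_maps_letters by blast
  show "\<exists>b\<in>affine_maps \<inter> elementary_maps. \<exists>t\<in>I_maps \<union> J_maps. x = b \<star> t"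
    if "x \<in> (affine_maps - elementary_maps) \<union> (elementary_maps - affine_maps)" for x :: "'a pmap"
    using letters_transversal_exists[OF that] by (simp add: basic_maps_def)
  show "t = t'" if t: "t \<in> I_maps \<union> J_maps" "t' \<in> I_maps \<union> J_maps"
    "t \<star> ginv t' \<in> affine_maps \<inter> elementary_maps" for t t' :: "'a pmap"
  proof (rule letters_transversal_unique[OF t(1,2)])
    show "t \<star> ginv t' \<in> basic_maps" using t(3) by (simp add: basic_maps_def)
    have "t \<in> carrier GA2" "t' \<in> carrier GA2"
      using t I_maps_letters J_maps_letters affine_maps_carrier elementary_maps_carrier by blast+
    then have "t = t \<star> ginv t' \<star> t'"
      by (metis GA2.inv_closed GA2.l_inv GA2.m_assoc GA2.r_one)
    then show "t = pmap_comp (t \<star> ginv t') t'" by simp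
  qed
  show "\<exists>ws. set ws \<subseteq> affine_maps \<union> elementary_maps \<and> g = foldr (\<otimes>\<^bsub>GA2\<^esub>) ws \<one>\<^bsub>GA2\<^esub>"
    if g: "g \<in> carrier GA2" for g :: "'a pmap"
  proof -
    obtain q where "inverse_pair g q" using g unfolding carrier_GA2 by blast
    then have "tame g" by (rule tame_inverse_pair)
    then show ?thesis unfolding tame_def comp_list_def .
  qed
  show "foldr (\<otimes>\<^bsub>GA2\<^esub>) ws \<one>\<^bsub>GA2\<^esub> \<notin> affine_maps \<inter> elementary_maps"
    if "ws \<noteq> []" "set ws \<subseteq> (affine_maps - elementary_maps) \<union> (elementary_maps - affine_maps)"
      "successively (\<lambda>x y. (x \<in> affine_maps) \<noteq> (y \<in> affine_maps)) ws" for ws :: "'a pmap list"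
    using word_not_basic[OF that] unfolding comp_list_def basic_maps_def .
qed

section \<open>Length and poly-degree of words\<close>

lemmas grp = GA2.m_assoc GA2.m_closed GA2.inv_closed GA2.inv_inv GA2.inv_mult_group GA2.cancel_simps
  GA2.l_inv GA2.r_inv GA2.r_one GA2.l_one GA2.one_closed

lemma wprod_comp_list: "am.wprod = comp_list"
  by (rule ext) (simp only: am.wprod_def comp_list_def)

lemma alternating_iff: "alternating ws \<longleftrightarrow> set ws \<subseteq> I_maps \<union> J_maps \<and> am.alt ws"
proof -
  have key: "(g \<in> I_maps \<and> h \<in> J_maps \<or> g \<in> J_maps \<and> h \<in> I_maps) \<longleftrightarrow> (g \<in> affine_maps) \<noteq> (h \<in> affine_maps)"
    if "g \<in> I_maps \<union> J_maps" "h \<in> I_maps \<union> J_maps" for g h :: "'a pmap"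
    using that I_maps_letters J_maps_letters by blast
  then have "set ws \<subseteq> I_maps \<union> J_maps \<Longrightarrow>
      successively (\<lambda>g h. g \<in> I_maps \<and> h \<in> J_maps \<or> g \<in> J_maps \<and> h \<in> I_maps) ws =
      successively (\<lambda>g h. (g \<in> affine_maps) \<noteq> (h \<in> affine_maps)) ws"
    by (rule successively_cong) (erule (1) subsetD, erule (1) subsetD, rule refl)
  then show ?thesis
    using am.T_letters unfolding alternating_def am.alt_def by blast
qed

lemma normal_form_eq:
  assumes "b \<in> basic_maps" "am.alt ts" "set ts \<subseteq> I_maps \<union> J_maps"
  shows "normal_form (pmap_comp b (comp_list ts)) = (b, ts)"
  unfolding normal_form_def
proof (rule the_equality)
  show "is_normal_form (pmap_comp b (comp_list ts)) (b, ts)"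
    using assms by (simp add: is_normal_form_def alternating_iff)
  show "nf = (b, ts)" if nf: "is_normal_form (pmap_comp b (comp_list ts)) nf" for nf
  proof -
    obtain b' ts' where nf': "nf = (b', ts')" by (cases nf)
    have "b' = b \<and> ts' = ts"
    proof (rule am.transversal_unique)
      show "b' \<in> affine_maps \<inter> elementary_maps" "am.alt ts'" "set ts' \<subseteq> I_maps \<union> J_maps"
        using nf nf' by (auto simp: is_normal_form_def alternating_iff basic_maps_def)
      show "b' \<star> am.wprod ts' = b \<star> am.wprod ts"
        using nf nf' by (simp add: is_normal_form_def wprod_comp_list)
    qed (use assms in \<open>auto simp: basic_maps_def\<close>)
    then show ?thesis using nf' by simp
  qed
qed

text \<open>Replacing the letters by representatives multiplies each of them by basic maps on both
  sides. This preserves the number of letters, their types and, for elementary letters, the degree,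
  so no normal form has to be computed.\<close>

lemma normal_form_of_word:
  assumes b: "b \<in> basic_maps" and ws: "am.alt ws"
  shows "nf_length (pmap_comp b (comp_list ws)) = length ws"
    and "pol_deg (pmap_comp b (comp_list ws)) = map (\<lambda>x. degree (fst x)) (filter (\<lambda>x. x \<notin> affine_maps) ws)"
proof -
  obtain b' ts where t: "b' \<in> basic_maps" "am.alt ts" "set ts \<subseteq> I_maps \<union> J_maps"
    "comp_list ws = pmap_comp b' (comp_list ts)"
    "list_all2 (\<lambda>x t. (\<exists>b1 \<in> basic_maps. \<exists>b2 \<in> basic_maps. t = pmap_comp (pmap_comp b1 x) b2)) ws ts"
    "list_all2 (\<lambda>x t. (x \<in> affine_maps) = (t \<in> affine_maps)) ws ts"
    using am.transversal_form[OF ws] unfolding basic_maps_def wprod_comp_list GA2_simps by blast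
  have "b \<star> b' \<in> basic_maps"
    using subgroup.m_closed[OF am.B] b t(1) unfolding basic_maps_def by blast
  then have bb: "pmap_comp b b' \<in> basic_maps" by simp
  have nf: "normal_form (pmap_comp b (comp_list ws)) = (pmap_comp b b', ts)"
    unfolding t(4) pmap_comp_assoc[symmetric] by (rule normal_form_eq[OF bb t(2,3)])
  show "nf_length (pmap_comp b (comp_list ws)) = length ws"
    unfolding nf_length_def nf using list_all2_lengthD[OF t(5)] by simp
  have "map J_degree (filter (\<lambda>h. h \<in> J_maps) ts) = map (\<lambda>x. degree (fst x)) (filter (\<lambda>x. x \<notin> affine_maps) ws)"
    using t(5,6,3) ws
  proof (induction ws ts rule: list_all2_induct)
    case Nil
    then show ?case by simp
  next
    case (Cons x xs t ts)
    have IH: "map J_degree (filter (\<lambda>h. h \<in> J_maps) ts) = map (\<lambda>x. degree (fst x)) (filter (\<lambda>x. x \<notin> affine_maps) xs)"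
      using Cons by (auto simp: am.alt_Cons)
    have tx: "(x \<in> affine_maps) = (t \<in> affine_maps)" "t \<in> I_maps \<union> J_maps" using Cons.prems by auto
    then have tJ: "t \<in> J_maps \<longleftrightarrow> x \<notin> affine_maps" using I_maps_letters J_maps_letters by blast
    have "J_degree t = degree (fst x)" if "x \<notin> affine_maps"
    proof -
      have "x \<in> elementary_maps - affine_maps" using Cons.prems that by (auto simp: am.alt_Cons)
      moreover obtain b1 b2 where "b1 \<in> basic_maps" "b2 \<in> basic_maps" "t = pmap_comp (pmap_comp b1 x) b2"
        using Cons.hyps(1) by blast
      ultimately have "degree (fst t) = degree (fst x)" using degree_fst_basic_comp by blast
      then show ?thesis using J_degree_eq[of t] tJ that by simp
    qed
    then show ?case using IH tJ by simp
  qed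
  then show "pol_deg (pmap_comp b (comp_list ws)) = map (\<lambda>x. degree (fst x)) (filter (\<lambda>x. x \<notin> affine_maps) ws)"
    unfolding pol_deg_def nf by simp
qed

lemma basic_id: "pmap_id \<in> basic_maps"
  using subgroup.one_closed[OF am.B] by (simp add: basic_maps_def)

lemma cyclically_reduced_word:
  assumes "am.alt w" "even (length w)" "w \<noteq> []"
  shows "cyclically_reduced (comp_list w)"
  using normal_form_of_word(1)[OF basic_id assms(1)] assms am.alt_wprod_closed[OF assms(1)]
  by (simp add: cyclically_reduced_def wprod_comp_list)

text \<open>Positive length provides a first letter that absorbs the basic factor.\<close>

lemma cyclically_reducedE:
  assumes "cyclically_reduced g"
  obtains w where "am.alt w" "even (length w)" "w \<noteq> []" "g = comp_list w"
proof -
  have g: "g \<in> carrier GA2" using assms by (simp add: cyclically_reduced_def)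
  obtain b ws where bw: "b \<in> basic_maps" "am.alt ws" "g = pmap_comp b (comp_list ws)"
    using am.reduced_exists[OF g] unfolding basic_maps_def wprod_comp_list GA2_simps by blast
  have len: "even (length ws)" "length ws > 0"
    using assms normal_form_of_word(1)[OF bw(1,2)] bw(3) by (simp_all add: cyclically_reduced_def)
  then obtain x xs where x: "ws = x # xs" by (cases ws) auto
  have "am.alt ((b \<star> x) # xs)" "am.wprod ((b \<star> x) # xs) = b \<star> am.wprod (x # xs)"
    using am.alt_B_left[of b x xs] bw x by (simp_all add: basic_maps_def)
  then show ?thesis using that[of "(b \<star> x) # xs"] len x bw by (simp add: wprod_comp_list)
qed

section \<open>Conjugates of words\<close>

text \<open>The degree sequence of an arbitrary alternating word, whose letters need not be
  representatives.\<close>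

definition pol_word :: "'a::field pmap list \<Rightarrow> nat list" where
  "pol_word ws = map (\<lambda>x. degree (fst x)) (filter (\<lambda>x. x \<notin> affine_maps) ws)"

lemma pol_word_append: "pol_word (xs @ ys) = pol_word xs @ pol_word ys"
  by (simp add: pol_word_def)

lemma basic_inv: "c \<in> basic_maps \<Longrightarrow> ginv c \<in> basic_maps"
  using subgroup.m_inv_closed[OF am.B] unfolding basic_maps_def .

lemma basic_carrier: "c \<in> basic_maps \<Longrightarrow> c \<in> carrier GA2"
  using affine_maps_carrier unfolding basic_maps_def by blast

text \<open>\<open>c\<close> becomes the basic factor in front, and \<open>ginv c\<close> is
  absorbed by the last letter without changing its type or degree.\<close>

lemma normal_form_of_conjugate_word:
  assumes c: "c \<in> basic_maps" and ws: "am.alt ws" "ws \<noteq> []"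
  shows "nf_length (c \<star> am.wprod ws \<star> ginv c) = length ws"
    and "pol_deg (c \<star> am.wprod ws \<star> ginv c) = pol_word ws"
proof -
  obtain xs x where x: "ws = xs @ [x]" using ws(2) by (cases ws rule: rev_cases) auto
  define y where "y = x \<star> ginv c"
  have ic: "ginv c \<in> affine_maps \<inter> elementary_maps" using basic_inv[OF c] by (simp add: basic_maps_def)
  have y: "am.alt (xs @ [y])" "am.wprod (xs @ [y]) = am.wprod ws \<star> ginv c"
    using am.alt_B_right[OF ic, of xs x] ws x by (simp_all only: y_def)
  have xl: "x \<in> (affine_maps - elementary_maps) \<union> (elementary_maps - affine_maps)"
    using am.alt_last[OF ws] x by simp
  have "(y \<in> affine_maps) = (x \<in> affine_maps)"
    unfolding y_def by (rule am.B_letter_right(2)[OF ic xl])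
  moreover have "degree (fst y) = degree (fst x)" if "x \<notin> affine_maps"
    using degree_fst_basic_comp[of x pmap_id "ginv c"] xl that basic_id basic_inv[OF c]
    by (simp add: y_def)
  ultimately have "pol_word [y] = pol_word [x]" by (simp add: pol_word_def)
  then have p: "pol_word (xs @ [y]) = pol_word ws" by (simp only: x pol_word_append)
  have e: "c \<star> am.wprod ws \<star> ginv c = pmap_comp c (comp_list (xs @ [y]))"
    unfolding wprod_comp_list[symmetric] y(2) by (simp add: pmap_comp_assoc)
  show "nf_length (c \<star> am.wprod ws \<star> ginv c) = length ws"
    unfolding e normal_form_of_word(1)[OF c y(1)] by (simp add: x)
  show "pol_deg (c \<star> am.wprod ws \<star> ginv c) = pol_word ws"
    unfolding e normal_form_of_word(2)[OF c y(1)] pol_word_def[symmetric] by (rule p)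
qed

text \<open>Of the two outcomes of \<open>conj_cyclic\<close>, the word of odd length is excluded by
  the even length of a cyclically reduced element.\<close>

lemma cyclically_reduced_conjugate:
  assumes w: "am.alt w" "even (length w)" "w \<noteq> []" and h: "h \<in> carrier GA2"
    and cr: "cyclically_reduced (h \<star> am.wprod w \<star> ginv h)"
  shows "\<exists>c \<in> basic_maps. \<exists>k. h \<star> am.wprod w \<star> ginv h =
    c \<star> am.wprod (rotate k w) \<star> ginv c"
proof -
  have "False" if "c \<in> basic_maps" "am.alt ws" "odd (length ws)" "3 \<le> length ws"
    "h \<star> am.wprod w \<star> ginv h = c \<star> am.wprod ws \<star> ginv c" for c ws
  proof -
    have "ws \<noteq> []" using that by auto
    from normal_form_of_conjugate_word(1)[OF that(1,2) this] show False using cr that(3,5)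
      by (simp only: cyclically_reduced_def simp_thms)
  qed
  then show ?thesis using am.conj_cyclic[OF w h] unfolding basic_maps_def by blast
qed

text \<open>Affine maps have length at most one, whereas both outcomes of \<open>conj_cyclic\<close>
  keep at least two letters.\<close>

lemma affine_not_conjugate_cyclic:
  assumes w: "am.alt w" "even (length w)" "w \<noteq> []" and h: "h \<in> carrier GA2"
  shows "h \<star> am.wprod w \<star> ginv h \<notin> affine_maps"
proof
  let ?a = "h \<star> am.wprod w \<star> ginv h"
  assume a: "?a \<in> affine_maps"
  have "nf_length ?a \<le> 1"
  proof (cases "?a \<in> elementary_maps")
    case True
    then have "?a \<in> basic_maps" using a by (simp add: basic_maps_def)
    from normal_form_of_word(1)[OF this am.alt_Nil] show ?thesis by simp
  next
    case False
    then have "am.alt [?a]" using a by (simp only: am.alt_Cons am.alt_Nil) blast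
    from normal_form_of_word(1)[OF basic_id this] show ?thesis by simp
  qed
  moreover have "nf_length ?a \<ge> 2"
  proof -
    have l2: "length w \<ge> 2" using w by (cases w; cases "tl w") auto
    obtain c k where "c \<in> basic_maps" "?a = c \<star> am.wprod (rotate k w) \<star> ginv c \<or>
      (\<exists>ws. am.alt ws \<and> odd (length ws) \<and> 3 \<le> length ws \<and> ?a = c \<star> am.wprod ws \<star> ginv c)"
      using am.conj_cyclic[OF w h] unfolding basic_maps_def by blast
    then obtain ws where "c \<in> basic_maps" "am.alt ws" "length ws \<ge> 2"
      "?a = c \<star> am.wprod ws \<star> ginv c"
      using am.alt_rotate[OF w(1,2)] l2 by (metis One_nat_def Suc_1 Suc_leD length_rotate numeral_3_eq_3)
    then show ?thesis using normal_form_of_conjugate_word(1)[of c ws] by (cases ws) simp_all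
  qed
  ultimately show False by simp
qed

lemma filter_rotate: "\<exists>j. filter P (rotate k xs) = rotate j (filter P xs)"
proof -
  define n where "n = k mod length xs"
  have "filter P (rotate k xs) = filter P (drop n xs) @ filter P (take n xs)"
    by (simp add: rotate_drop_take n_def)
  also have "\<dots> = rotate (length (filter P (take n xs))) (filter P (take n xs) @ filter P (drop n xs))"
    by (simp add: rotate_append)
  also have "filter P (take n xs) @ filter P (drop n xs) = filter P xs"
    by (simp flip: filter_append)
  finally show ?thesis by blast
qed

text \<open>The amount of rotation changes because affine letters carry no degree. Hence the
  poly-degree of a cyclically reduced conjugate is obtained up to rotation.\<close>

lemma pol_word_rotate: "\<exists>j. pol_word (rotate k ws) = rotate j (pol_word ws)"
proof -
  obtain j where "filter (\<lambda>x. x \<notin> affine_maps) (rotate k ws) = rotate j (filter (\<lambda>x. x \<notin> affine_maps) ws)"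
    using filter_rotate by blast
  then show ?thesis unfolding pol_word_def by (intro exI[of _ j]) (simp add: rotate_map)
qed

section \<open>The Jacobian determinant\<close>

text \<open>The chain rule for any derivation that kills the constants, so that one proof covers
  both partial derivatives.\<close>

lemma derivation_subst:
  fixes D :: "'a::field poly poly \<Rightarrow> 'a poly poly"
  assumes add: "\<And>p q. D (p + q) = D p + D q" and mult: "\<And>p q. D (p * q) = D p * q + p * D q"
    and const: "\<And>c. D (const2 c) = 0"
  shows "D (subst2 P g) = subst2 (map_poly pderiv P) g * D (fst g) + subst2 (pderiv P) g * D (snd g)"
proof -
  have D0: "D 0 = 0" using const[of 0] by simp
  have x: "D (subst_x q A) = subst_x (pderiv q) A * D A" for q A
    by (induction q) (simp_all add: D0 add mult const pderiv_pCons algebra_simps)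
  show ?thesis
    by (induction P) (simp_all add: D0 add mult x pderiv_pCons map_poly_pCons algebra_simps)
qed

definition jac :: "'a::field pmap \<Rightarrow> 'a poly poly" where
  "jac f = map_poly pderiv (fst f) * pderiv (snd f) - pderiv (fst f) * map_poly pderiv (snd f)"

lemma det_jacobian: "det (jacobian_matrix f) = jac f"
  by (simp add: det_2 jacobian_matrix_def jac_def)

lemma pderiv_x_derivation:
  fixes p q :: "'a::field poly poly"
  shows "map_poly pderiv (p + q) = map_poly pderiv p + map_poly pderiv q"
    and "map_poly pderiv (p * q) = map_poly pderiv p * q + p * map_poly pderiv q"
    and "map_poly pderiv (const2 c) = (0 :: 'a poly poly)"
proof -
  show add: "map_poly pderiv (p + q) = map_poly pderiv p + map_poly pderiv q" for p q :: "'a poly poly"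
    by (rule poly_eqI) (simp add: coeff_map_poly pderiv_add)
  have sm: "map_poly pderiv (smult c q) = smult (pderiv c) q + smult c (map_poly pderiv q)" for c and q :: "'a poly poly"
    by (rule poly_eqI) (simp add: coeff_map_poly pderiv_mult)
  show "map_poly pderiv (p * q) = map_poly pderiv p * q + p * map_poly pderiv q"
    by (induction p) (simp_all add: add sm map_poly_pCons algebra_simps)
  show "map_poly pderiv (const2 c) = (0 :: 'a poly poly)"
    by (simp add: const2_def map_poly_pCons)
qed

lemma jac_comp: "jac (pmap_comp f g) = subst2 (jac f) g * jac g"
proof -
  have y: "pderiv (subst2 P g) = subst2 (map_poly pderiv P) g * pderiv (fst g) + subst2 (pderiv P) g * pderiv (snd g)" for P
    by (rule derivation_subst) (simp_all add: pderiv_add pderiv_mult const2_def pderiv_pCons algebra_simps)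
  have x: "map_poly pderiv (subst2 P g) = subst2 (map_poly pderiv P) g * map_poly pderiv (fst g) +
      subst2 (pderiv P) g * map_poly pderiv (snd g)" for P
    by (rule derivation_subst) (simp_all only: pderiv_x_derivation)
  show ?thesis
    unfolding jac_def pmap_comp_def fst_conv snd_conv x y subst2_diff subst2_simps
    by (simp add: algebra_simps)
qed

lemma jac_aff: "jac (aff a b c d u v) = const2 (a * d - b * c)"
  by (simp add: jac_def aff_expand map_poly_pCons pderiv_pCons) (simp add: const2_def)

lemma jac_id: "jac pmap_id = 1"
  by (simp add: pmap_id_aff jac_aff)

text \<open>By the chain rule the determinant has an inverse in \<open>K[x, y]\<close>, and units
  there are constants; \<open>poly_mult_eq_1_const\<close> removes one variable at a time.\<close>

lemma jac_const:
  fixes f :: "'a::field pmap"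
  assumes "f \<in> carrier GA2"
  obtains k where "jac f = const2 k"
proof -
  obtain q where "inverse_pair f q" using assms by (auto simp only: carrier_GA2)
  then have 1: "subst2 (jac q) f * jac f = 1"
    by (metis inverse_pair_def jac_comp jac_id)
  then obtain c where c: "jac f = [:c:]" by (rule poly_mult_eq_1_const)
  obtain c' where c': "subst2 (jac q) f = [:c':]" using 1 by (metis mult.commute poly_mult_eq_1_const)
  have "c' * c = 1" using 1 unfolding c c' by (simp add: one_pCons mult.commute)
  then obtain k where "c = [:k:]" by (rule poly_mult_eq_1_const)
  then show ?thesis using that[of k] c by (simp add: const2_def)
qed

lemma jac_mult: "f \<in> carrier GA2 \<Longrightarrow> jac (f \<star> g) = jac f * jac g"
  by (metis GA2_simps(1) jac_comp jac_const subst2_const2)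

lemma jac_inv: "f \<in> carrier GA2 \<Longrightarrow> jac f * jac (ginv f) = 1"
  by (metis GA2.r_inv GA2_simps(2) jac_id jac_mult)

lemma jac_conj:
  assumes "h \<in> carrier GA2" "f \<in> carrier GA2"
  shows "jac (h \<star> f \<star> ginv h) = jac f"
proof -
  have "jac (h \<star> f \<star> ginv h) = jac h * jac f * jac (ginv h)"
    using assms by (simp only: jac_mult GA2.m_closed)
  also have "\<dots> = jac f * (jac h * jac (ginv h))" by (simp only: mult_ac)
  finally show ?thesis using jac_inv[OF assms(1)] by simp
qed

section \<open>Evaluation at points\<close>

lemma eval_pmap_comp: "eval_pmap (pmap_comp f g) p = eval_pmap f (eval_pmap g p)"
proof -
  have x: "poly (poly (subst_x q A) [:snd p:]) (fst p) = poly q (poly (poly A [:snd p:]) (fst p))" for q A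
    by (induction q) (simp_all add: const2_def)
  have "poly (poly (subst2 P g) [:snd p:]) (fst p) =
      poly (poly P [:snd (eval_pmap g p):]) (fst (eval_pmap g p))" for P
    by (induction P) (simp_all add: x, simp_all add: eval_pmap_def)
  then show ?thesis
    unfolding eval_pmap_def[of f] eval_pmap_def[of "pmap_comp f g"] by (simp add: pmap_comp_def)
qed

lemma eval_pmap_id: "eval_pmap pmap_id p = p"
  by (simp add: eval_pmap_def pmap_id_def X2_def Y2_def)

lemma eval_pmap_inv:
  assumes "f \<in> carrier GA2"
  shows "eval_pmap (ginv f) (eval_pmap f p) = p"
  using GA2.l_inv[OF assms] by (simp add: eval_pmap_id flip: eval_pmap_comp)

lemma eval_aff_linear: "eval_pmap (aff a b c d 0 0) (0, 0) = (0, 0)"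
  by (simp add: eval_pmap_def aff_expand)

lemma eval_shear: "eval_pmap (shear P) (0, 0) = (0, 0)"
  by (simp add: eval_pmap_def shear_def X2_def Y2_def)

lemma eval_comp_list: "(\<And>w. w \<in> set ws \<Longrightarrow> eval_pmap w p = p) \<Longrightarrow> eval_pmap (comp_list ws) p = p"
  by (induction ws) (simp_all add: eval_pmap_comp eval_pmap_id)

lemma has_fixed_point_conj:
  assumes "h \<in> carrier GA2" "f \<in> carrier GA2" "eval_pmap (h \<star> f \<star> ginv h) p = p"
  shows "has_fixed_point f"
proof -
  let ?q = "eval_pmap (ginv h) p"
  have "eval_pmap h (eval_pmap f ?q) = p" using assms(3) by (simp add: eval_pmap_comp)
  then have "eval_pmap f ?q = ?q" using eval_pmap_inv[OF assms(1), of "eval_pmap f ?q"] by simp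
  then show ?thesis unfolding has_fixed_point_def by blast
qed

section \<open>Maps commuting with the central symmetry\<close>

text \<open>The map \<open>-1\<close>, which is the square of \<open>R1\<close> and of every
  \<open>R2 \<alpha> \<gamma>\<close> with \<open>\<gamma> \<noteq> 0\<close>.\<close>

definition central :: "'a::field pmap" where
  "central = aff (- 1) 0 0 (- 1) 0 0"

lemma central_central: "pmap_comp central central = pmap_id"
  by (simp add: central_def aff_comp pmap_id_aff)

lemma central_basic: "central \<in> basic_maps"
proof -
  have "(- 1) * (- 1) \<noteq> (0::'a)" by simp
  then show ?thesis unfolding basic_maps_iff central_def by blast
qed

lemma central_carrier: "central \<in> carrier GA2"
  by (rule basic_carrier[OF central_basic])

abbreviation "symmetric f \<equiv> pmap_comp f central = pmap_comp central f"

lemma symmetric_linear: "symmetric (aff a b c d 0 0)"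
  by (simp add: central_def aff_comp)

lemma central_shear:
  "pmap_comp central (pmap_comp (shear P) central) = shear (- pcompose P [:0, - 1:])"
proof -
  have c: "central = elementary_map (- 1) 0 (- 1) (0 :: 'a)"
    unfolding central_def aff_eq_elementary by simp
  have "pcompose ([:0, 0, 1:] * P) [:0, - 1:] = [:0, 0, 1:] * pcompose P [:0, - 1:]"
    by (simp add: pcompose_mult pcompose_pCons)
  then show ?thesis
    unfolding c shear_elementary elementary_comp elementary_eq_iff by simp
qed

lemma symmetric_iff: "symmetric f \<longleftrightarrow> pmap_comp central (pmap_comp f central) = f"
  by (metis central_central pmap_comp_assoc pmap_comp_id(1))

lemma symmetric_shear_iff: "symmetric (shear P) \<longleftrightarrow> odd_poly P"
  unfolding symmetric_iff central_shear shear_inject odd_poly_def by (metis minus_minus)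

lemma symmetric_comp: "symmetric f \<Longrightarrow> symmetric g \<Longrightarrow> symmetric (pmap_comp f g)"
  by (metis pmap_comp_assoc)

lemma symmetric_inv:
  assumes "f \<in> carrier GA2" "symmetric f"
  shows "symmetric (ginv f)"
proof -
  have "f \<star> central = central \<star> f" using assms by simp
  then have "ginv f \<star> central = central \<star> ginv f"
    using assms(1) central_carrier by (metis GA2.inv_closed GA2.inv_solve_left GA2.inv_solve_right' GA2.m_assoc GA2.m_closed)
  then show ?thesis by simp
qed

lemma symmetric_comp_list: "(\<And>w. w \<in> set ws \<Longrightarrow> symmetric w) \<Longrightarrow> symmetric (comp_list ws)"
  by (induction ws) (simp_all add: symmetric_comp)

text \<open>Conjugation by a basic map with translation part \<open>(u, v)\<close> turns
  \<open>-1\<close> into the point reflection in \<open>(u, v)\<close>, whose constants are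
  \<open>2 * u\<close> and \<open>2 * v\<close>; the conjugate of \<open>f\<close> commutes with the
  conjugate of \<open>-1\<close>.\<close>

lemma symmetric_conj_basic:
  fixes c :: "'a::field pmap"
  assumes c: "c \<in> basic_maps" and f: "f \<in> carrier GA2" "symmetric f"
  shows "\<exists>u v. (c \<star> f \<star> ginv c) \<star> neg_map u v =
    neg_map u v \<star> (c \<star> f \<star> ginv c)"
proof -
  obtain a b d u v where cc: "c = aff a b 0 d u v" using c unfolding basic_maps_iff by blast
  have n: "neg_map (2 * u) (2 * v) = aff (- 1) 0 0 (- 1) (2 * u) (2 * v)"
    by (simp add: neg_map_def aff_def const2_uminus)
  let ?n = "neg_map (2 * u) (2 * v)"
  have "c \<star> central = ?n \<star> c"
    unfolding n by (simp add: cc central_def aff_comp aff_eq_iff)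
  moreover have car: "c \<in> carrier GA2" "(central :: 'a pmap) \<in> carrier GA2" using basic_carrier[OF c] central_carrier by simp_all
  moreover have "- 1 * - 1 - 0 * 0 \<noteq> (0 :: 'a)" by simp
  then have cn: "?n \<in> carrier GA2" unfolding n by (intro affine_maps_carrier aff_in_affine_maps)
  ultimately have n': "?n = c \<star> central \<star> ginv c"
    by (metis GA2.inv_solve_right GA2.m_closed)
  have fc: "f \<star> central = central \<star> f" using f by simp
  have "(c \<star> f \<star> ginv c) \<star> ?n = c \<star> (f \<star> central) \<star> ginv c"
    unfolding n' using car(1) f(1)
    by (simp only: grp central_carrier)
  also have "\<dots> = ?n \<star> (c \<star> f \<star> ginv c)"
    unfolding n' fc using car(1) f(1)
    by (simp only: grp central_carrier)
  finally show ?thesis by blast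
qed

section \<open>The words of the reversible form\<close>

lemma R1_aff: "R1 = aff 0 (- 1) 1 0 0 0"
  by (simp add: R1_def linear_map_matrix22)

lemma R2_aff: "R2 \<alpha> \<gamma> = aff \<alpha> (- (\<alpha>\<^sup>2 + 1) / \<gamma>) \<gamma> (- \<alpha>) 0 0"
  by (simp add: R2_def linear_map_matrix22)

lemma R1_letter: "R1 \<in> affine_maps - elementary_maps"
  by (simp add: R1_aff aff_in_affine_maps aff_mem_elementary_iff)

lemma R2_letter: "\<gamma> \<noteq> 0 \<Longrightarrow> R2 \<alpha> \<gamma> \<in> affine_maps - elementary_maps"
proof -
  assume g: "\<gamma> \<noteq> 0"
  have "\<alpha> * - \<alpha> - - (\<alpha>\<^sup>2 + 1) / \<gamma> * \<gamma> \<noteq> 0" using g by (simp add: power2_eq_square)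
  then show ?thesis using g by (simp add: R2_aff aff_in_affine_maps aff_mem_elementary_iff)
qed

lemma jac_R1: "jac R1 = 1"
  by (simp add: R1_aff jac_aff)

lemma jac_R2: "\<gamma> \<noteq> 0 \<Longrightarrow> jac (R2 \<alpha> \<gamma>) = 1"
  unfolding R2_aff jac_aff by (simp add: power2_eq_square)

lemma half_word_1: "half_word 1 a e = [e 1]"
  by (simp add: half_word_def)

lemma half_word_Suc: "1 \<le> m \<Longrightarrow> half_word (Suc m) a e = e (Suc m) # a m # half_word m a e"
  by (simp add: half_word_def)

lemma odd_J_subset: "odd_J_maps \<subseteq> J_maps"
  by (auto simp: odd_J_maps_def J_maps_def)

lemma half_word_alt:
  assumes "1 \<le> m" "\<And>i. i \<in> {1..<m} \<Longrightarrow> a i \<in> I_maps" "\<And>i. i \<in> {1..m} \<Longrightarrow> e i \<in> J_maps"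
  shows "am.alt (half_word m a e) \<and> half_word m a e \<noteq> [] \<and> hd (half_word m a e) \<notin> affine_maps \<and>
    last (half_word m a e) \<notin> affine_maps \<and>
    pol_word (half_word m a e) = map (\<lambda>i. J_degree (e i)) (rev [1..<Suc m])"
  using assms
proof (induction m rule: nat_induct_at_least)
  case base
  then have "e 1 \<in> J_maps" by simp
  then have "e 1 \<in> elementary_maps - affine_maps" "J_degree (e 1) = degree (fst (e 1))"
    using J_maps_letters J_degree_eq by blast+
  then show ?case unfolding half_word_1 by (simp add: am.alt_Cons pol_word_def)
next
  case (Suc m)
  have IH: "am.alt (half_word m a e)" "half_word m a e \<noteq> []" "hd (half_word m a e) \<notin> affine_maps"
    "last (half_word m a e) \<notin> affine_maps"
    "pol_word (half_word m a e) = map (\<lambda>i. J_degree (e i)) (rev [1..<Suc m])"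
    using Suc by auto
  have "e (Suc m) \<in> J_maps" "a m \<in> I_maps" using Suc by auto
  then have "e (Suc m) \<in> elementary_maps - affine_maps" "J_degree (e (Suc m)) = degree (fst (e (Suc m)))"
    "a m \<in> affine_maps - elementary_maps"
    using J_maps_letters I_maps_letters J_degree_eq by blast+
  then show ?case using IH Suc.hyps unfolding half_word_Suc[OF Suc.hyps]
    by (simp add: am.alt_Cons pol_word_def)
qed

lemma set_half_word:
  assumes "1 \<le> m"
  shows "set (half_word m a e) = a ` {1..<m} \<union> e ` {1..m}"
proof -
  have "{1..m} = insert m {1..<m}" using assms by auto
  then show ?thesis by (auto simp: half_word_def)
qed

definition rev_word where
  "rev_word m a e \<alpha> \<gamma> =
    half_word m a e @ [R1] @ map (\<lambda>g. ginv g) (rev (half_word m a e)) @ [R2 \<alpha> \<gamma>]"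

lemma reversible_form_word: "reversible_form m a e \<alpha> \<gamma> = am.wprod (rev_word m a e \<alpha> \<gamma>)"
  by (simp only: reversible_form_def rev_word_def wprod_comp_list)

lemma degree_fst_inv_J:
  assumes "e \<in> J_maps"
  shows "ginv e \<in> J_maps" "degree (fst (ginv e)) = degree (fst e)"
proof -
  obtain P where P: "e = shear P" "P \<noteq> 0" using assms by (auto simp: J_maps_def)
  have "pmap_comp (shear P) (shear (- P)) = pmap_id" "pmap_comp (shear (- P)) (shear P) = pmap_id"
    unfolding shear_elementary elementary_comp pmap_id_elementary elementary_eq_iff by simp_all
  then have i: "ginv e = shear (- P)" using P inverse_pair_inv by (metis inverse_pair_def)
  then show 1: "ginv e \<in> J_maps" using P by (auto simp: J_maps_def)
  show "degree (fst (ginv e)) = degree (fst e)"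
    using degree_fst_shear[of P] degree_fst_shear[of "- P"] P i by simp
qed

lemma admissible_letters:
  assumes "admissible m a e \<gamma>"
  shows "1 \<le> m" "\<gamma> \<noteq> 0" "\<And>i. i \<in> {1..<m} \<Longrightarrow> a i \<in> I_maps" "\<And>i. i \<in> {1..m} \<Longrightarrow> e i \<in> odd_J_maps"
    "\<And>i. i \<in> {1..m} \<Longrightarrow> e i \<in> J_maps"
  using assms odd_J_subset by (auto simp: admissible_def)

text \<open>\<open>half_word\<close> and its reversed inverse begin and end with elementary letters,
  so \<open>R1\<close> and \<open>R2\<close> fit in between, and the word alternates even
  cyclically. Inversion keeps the degree of a shear, which makes the second half of the degrees the
  mirror image of the first.\<close>

lemma rev_word_alt:
  fixes \<gamma> :: "'a::field"
  assumes "admissible m a e \<gamma>"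
  shows "am.alt (rev_word m a e \<alpha> \<gamma>)" "even (length (rev_word m a e \<alpha> \<gamma>))" "rev_word m a e \<alpha> \<gamma> \<noteq> []"
    "pol_word (rev_word m a e \<alpha> \<gamma>) = mirror_list m (\<lambda>i. J_degree (e i))"
proof -
  note adm = admissible_letters[OF assms]
  let ?H = "half_word m a e"
  let ?H' = "map (\<lambda>g. ginv g) (rev ?H)"
  have H: "am.alt ?H" "?H \<noteq> []" "hd ?H \<notin> affine_maps" "last ?H \<notin> affine_maps"
    "pol_word ?H = map (\<lambda>i. J_degree (e i)) (rev [1..<Suc m])"
    using half_word_alt[of m a e, OF adm(1,3,5)] by blast+
  have H': "am.alt ?H'" by (rule am.alt_inv[OF H(1)])
  have "hd ?H' = ginv (last ?H)" "last ?H' = ginv (hd ?H)"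
    using H(2) by (simp_all add: hd_map hd_rev last_map last_rev)
  moreover have "hd ?H \<in> (affine_maps - elementary_maps) \<union> (elementary_maps - affine_maps)"
    using H(1,2) by (cases ?H) (simp_all add: am.alt_Cons)
  ultimately have ends: "hd ?H' \<notin> affine_maps" "last ?H' \<notin> affine_maps"
    using am.letter_inv(2) am.alt_last[OF H(1,2)] H(3,4) by metis+
  have "am.alt ([R1] @ ?H' @ [R2 \<alpha> \<gamma>])"
    unfolding am.alt_append am.alt_Cons using H' ends R1_letter[where 'a = 'a] R2_letter[OF adm(2)] H(2) am.alt_Nil by auto
  then show "am.alt (rev_word m a e \<alpha> \<gamma>)"
    unfolding rev_word_def am.alt_append[of ?H] using H R1_letter[where 'a = 'a] by simp
  show "even (length (rev_word m a e \<alpha> \<gamma>))" "rev_word m a e \<alpha> \<gamma> \<noteq> []"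
    by (simp_all add: rev_word_def)
  have "set ws \<subseteq> I_maps \<union> J_maps \<Longrightarrow> pol_word (map (\<lambda>g. ginv g) (rev ws)) = rev (pol_word ws)" for ws :: "'a pmap list"
  proof (induction ws)
    case (Cons x ws)
    have "pol_word [ginv x] = pol_word [x]"
    proof (cases "x \<in> J_maps")
      case True
      then show ?thesis using degree_fst_inv_J[OF True] J_maps_letters by (auto simp: pol_word_def)
    next
      case False
      then have "x \<in> affine_maps" using Cons.prems I_maps_letters by auto
      then show ?thesis using subgroup.m_inv_closed[OF affine_subgroup] by (simp add: pol_word_def)
    qed
    moreover have "rev (pol_word (x # ws)) = rev (pol_word ws) @ pol_word [x]"
      by (simp add: pol_word_def)
    ultimately show ?case using Cons by (simp add: pol_word_append)
  qed (simp add: pol_word_def)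
  moreover have "set ?H \<subseteq> I_maps \<union> J_maps" unfolding set_half_word[OF adm(1)] using adm(3,5) by blast
  ultimately have "pol_word ?H' = rev (pol_word ?H)" by blast
  moreover have "pol_word [R1 :: 'a pmap] = []" "pol_word [R2 \<alpha> \<gamma>] = []"
    using R1_letter[where 'a = 'a] R2_letter[OF adm(2)] by (auto simp: pol_word_def)
  ultimately show "pol_word (rev_word m a e \<alpha> \<gamma>) = mirror_list m (\<lambda>i. J_degree (e i))"
    unfolding rev_word_def pol_word_append H(5) mirror_list_def by (simp add: rev_map)
qed

lemma rev_word_symmetric:
  assumes "admissible m a e \<gamma>"
  shows "w \<in> set (half_word m a e) \<Longrightarrow> symmetric w" "w \<in> set (rev_word m a e \<alpha> \<gamma>) \<Longrightarrow> symmetric w"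
    "w \<in> set (rev_word m a e \<alpha> \<gamma>) \<Longrightarrow> eval_pmap w (0, 0) = (0, 0)"
proof -
  note adm = admissible_letters[OF assms]
  have h: "w \<in> I_maps \<union> odd_J_maps" if "w \<in> set (half_word m a e)" for w
    using that adm(3,4) unfolding set_half_word[OF adm(1)] by blast
  have hs: "symmetric w \<and> eval_pmap w (0, 0) = (0, 0) \<and> w \<in> carrier GA2" if "w \<in> set (half_word m a e)" for w
  proof (cases "w \<in> I_maps")
    case True
    then obtain \<beta> where "w = aff 0 1 1 \<beta> 0 0" unfolding I_maps_aff by blast
    moreover have "w \<in> carrier GA2" using True I_maps_letters affine_maps_carrier by blast
    ultimately show ?thesis using symmetric_linear eval_aff_linear by metis
  next
    case False
    then have "w \<in> odd_J_maps" using h[OF that] by blast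
    moreover from this have "w \<in> carrier GA2" using odd_J_subset J_maps_letters elementary_maps_carrier by blast
    moreover obtain P where "w = shear P" "odd_poly P"
      using \<open>w \<in> odd_J_maps\<close> unfolding odd_J_maps_def by blast
    ultimately show ?thesis using symmetric_shear_iff eval_shear by metis
  qed
  then show "w \<in> set (half_word m a e) \<Longrightarrow> symmetric w" by blast
  have ih: "symmetric (ginv w) \<and> eval_pmap (ginv w) (0, 0) = (0, 0)" if "w \<in> set (half_word m a e)" for w
    using hs[OF that] symmetric_inv eval_pmap_inv by metis
  have "symmetric w \<and> eval_pmap w (0, 0) = (0, 0)" if "w \<in> set (rev_word m a e \<alpha> \<gamma>)" for w
  proof -
    consider "w \<in> set (half_word m a e)" | "w = R1" | "w = R2 \<alpha> \<gamma>"
      | w' where "w' \<in> set (half_word m a e)" "w = ginv w'"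
    proof -
      have "set (rev_word m a e \<alpha> \<gamma>) = set (half_word m a e) \<union> {R1} \<union>
          (\<lambda>g. ginv g) ` set (half_word m a e) \<union> {R2 \<alpha> \<gamma>}"
        unfolding rev_word_def by auto
      then show ?thesis using \<open>w \<in> set (rev_word m a e \<alpha> \<gamma>)\<close> that by blast
    qed
    then show ?thesis
      by cases (use hs ih in \<open>simp_all add: R1_aff R2_aff symmetric_linear eval_aff_linear\<close>)
  qed
  then show "w \<in> set (rev_word m a e \<alpha> \<gamma>) \<Longrightarrow> symmetric w"
    "w \<in> set (rev_word m a e \<alpha> \<gamma>) \<Longrightarrow> eval_pmap w (0, 0) = (0, 0)" by blast+
qed

lemma R1_R1: "pmap_comp R1 R1 = central"
  by (simp add: R1_aff central_def aff_comp)

text \<open>Trace 0 and determinant 1 give the square \<open>-1\<close> by Cayley-Hamilton.\<close>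

lemma R2_R2: "\<gamma> \<noteq> 0 \<Longrightarrow> pmap_comp (R2 \<alpha> \<gamma>) (R2 \<alpha> \<gamma>) = central"
  by (simp add: R2_aff central_def aff_comp aff_eq_iff power2_eq_square field_simps)

text \<open>This exhibits the form as a product of a conjugate of \<open>R1\<close> and
  \<open>R2 \<alpha> \<gamma>\<close>; as \<open>W\<close> commutes with \<open>-1\<close>, both
  factors have the square \<open>-1\<close>.\<close>

lemma reversible_form_split:
  assumes "admissible m a e \<gamma>"
  defines "W \<equiv> am.wprod (half_word m a e)"
  shows "W \<in> carrier GA2" "symmetric W"
    "reversible_form m a e \<alpha> \<gamma> = W \<star> R1 \<star> ginv W \<star> R2 \<alpha> \<gamma>"
proof -
  note adm = admissible_letters[OF assms(1)]
  have alt: "am.alt (half_word m a e)" using half_word_alt[of m a e, OF adm(1,3,5)] by blast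
  show W: "W \<in> carrier GA2" unfolding W_def by (rule am.alt_wprod_closed[OF alt])
  show "symmetric W"
    unfolding W_def wprod_comp_list by (rule symmetric_comp_list) (rule rev_word_symmetric(1)[OF assms(1)])
  have "ginv W = am.wprod (map (\<lambda>g. ginv g) (rev (half_word m a e)))"
    unfolding W_def by (rule am.wprod_inv[OF am.alt_carrier[OF alt], symmetric])
  then show "reversible_form m a e \<alpha> \<gamma> = W \<star> R1 \<star> ginv W \<star> R2 \<alpha> \<gamma>"
    unfolding reversible_form_def W_def wprod_comp_list
    by (simp add: comp_list_append pmap_comp_assoc)
qed

section \<open>Conjugacy\<close>

lemma conjugateE:
  assumes "conjugate f g"
  obtains h where "h \<in> carrier GA2" "f \<in> carrier GA2" "g = h \<star> f \<star> ginv h"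
  using assms by (auto simp: conjugate_def)

lemma conjugate_sym: "conjugate f g \<Longrightarrow> conjugate g f"
proof -
  assume "conjugate f g"
  then obtain h where h: "h \<in> carrier GA2" "f \<in> carrier GA2" "g \<in> carrier GA2"
    "g = h \<star> f \<star> ginv h" unfolding conjugate_def by blast
  have "f = ginv h \<star> g \<star> ginv (ginv h)"
    unfolding h(4) using h(1,2)
    by (simp only: grp)
  then show ?thesis using h unfolding conjugate_def by (metis GA2.inv_closed)
qed

lemma conjugate_trans: "conjugate f g \<Longrightarrow> conjugate g k \<Longrightarrow> conjugate f k"
proof -
  assume "conjugate f g" "conjugate g k"
  then obtain h h' where h: "h \<in> carrier GA2" "f \<in> carrier GA2" "g = h \<star> f \<star> ginv h"
    "h' \<in> carrier GA2" "k \<in> carrier GA2" "k = h' \<star> g \<star> ginv h'" unfolding conjugate_def by blast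
  have "k = (h' \<star> h) \<star> f \<star> ginv (h' \<star> h)"
    unfolding h(6) h(3) using h(1,2,4)
    by (simp only: GA2.m_assoc GA2.m_closed GA2.inv_closed GA2.inv_mult_group)
  then show ?thesis using h unfolding conjugate_def by (metis GA2.m_closed)
qed

section \<open>Elements of order four\<close>

lemma affine_order_4:
  fixes x :: "'a::field pmap"
  assumes two: "(2::'a) \<noteq> 0" and no_i: "\<And>z::'a. z * z \<noteq> - 1"
    and xA: "x \<in> affine_maps" and ord: "GA2.ord x = 4"
  shows "\<exists>a c u v. c \<noteq> 0 \<and> x = aff a (- (a\<^sup>2 + 1) / c) c (- a) u v"
proof -
  have x: "pmap_comp (pmap_comp x x) (pmap_comp x x) = pmap_id" "pmap_comp x x \<noteq> pmap_id"
    using ord GA2.ord_4_iff[OF affine_maps_carrier[OF xA]] by simp_all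
  obtain a b c d u v where xx: "x = aff a b c d u v" "a * d - b * c \<noteq> 0"
    using xA by (auto simp: affine_maps_aff)
  define p q r s u' v' where "p = a * a + b * c" and "q = a * b + b * d" and "r = c * a + d * c"
    and "s = c * b + d * d" and "u' = a * u + b * v + u" and "v' = c * u + d * v + v"
  have y: "pmap_comp x x = aff p q r s u' v'"
    unfolding xx(1) aff_comp p_def q_def r_def s_def u'_def v'_def ..
  have yy: "p * p + q * r = 1" "p * q + q * s = 0" "r * p + s * r = 0" "r * q + s * s = 1"
    "p * u' + q * v' + u' = 0" "r * u' + s * v' + v' = 0"
    using x(1) unfolding y aff_comp pmap_id_aff aff_eq_iff by blast+
  \<comment> \<open>\<open>D\<close> is the determinant of the linear part of the square of
    \<open>x\<close>, hence a square in \<open>K\<close>. The fourth power gives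
    \<open>D * D = 1\<close>, and \<open>D = - 1\<close> would provide a square root of
    \<open>-1\<close>.\<close>
  define D where "D = p * s - q * r"
  have D: "D = (a * d - b * c) * (a * d - b * c)"
    by (simp add: D_def p_def q_def r_def s_def algebra_simps)
  have "D * D = (p * p + q * r) * (r * q + s * s) - (p * q + q * s) * (r * p + s * r)"
    by (simp add: D_def algebra_simps)
  then have "(D - 1) * (D + 1) = 0" unfolding yy by (simp add: algebra_simps)
  then have D1: "D = 1" using no_i[of "a * d - b * c"] D by (auto simp: eq_neg_iff_add_eq_0)
  have m1: "(1::'a) \<noteq> - 1" using two by (metis add.inverse_inverse add_eq_0_iff one_add_one)
  \<comment> \<open>Trace zero would give \<open>D = - (p * p + q * r) = - 1\<close>. A nonzero
    trace makes the linear part of the square diagonal.\<close>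
  have "p + s \<noteq> 0"
  proof
    assume "p + s = 0"
    then have "s = - p" by (simp add: add_eq_0_iff)
    then have "D = - (p * p + q * r)" by (simp add: D_def)
    then show False using D1 m1 yy(1) by simp
  qed
  moreover have "q * (p + s) = 0" "r * (p + s) = 0" using yy(2,3) by (simp_all add: algebra_simps)
  ultimately have qr: "q = 0" "r = 0" by simp_all
  have ps: "p * s = 1" "p * p = 1" using D1 yy(1) qr by (simp_all add: D_def)
  then have sp: "s = p" by (metis mult.assoc mult.left_neutral mult.right_neutral)
  \<comment> \<open>Otherwise the square of \<open>x\<close> is a translation whose double is
    trivial, so by \<open>two\<close> it is itself trivial, against order four.\<close>
  have "p \<noteq> 1"
  proof
    assume "p = 1"
    then have "2 * u' = 0" "2 * v' = 0" using yy(5,6) qr sp by simp_all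
    then have "pmap_comp x x = pmap_id"
      unfolding y pmap_id_aff aff_eq_iff using two qr sp \<open>p = 1\<close> by simp
    then show False using x(2) by simp
  qed
  moreover have "(p - 1) * (p + 1) = 0" using ps by (simp add: algebra_simps)
  ultimately have p: "p = - 1" by (auto simp: eq_neg_iff_add_eq_0)
  have c: "c \<noteq> 0" using p no_i[of a] by (auto simp: p_def)
  have "c * (a + d) = 0" using qr by (simp add: r_def algebra_simps)
  then have d: "d = - a" using c by (simp add: eq_neg_iff_add_eq_0 add.commute)
  have "b * c = - (a\<^sup>2 + 1)" using p by (simp add: p_def power2_eq_square algebra_simps eq_neg_iff_add_eq_0)
  then have "b = - (a\<^sup>2 + 1) / c" using c by (simp add: nonzero_eq_divide_eq)
  then show ?thesis using xx(1) c d by blast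
qed

lemma affine_order_4_conj_R1:
  fixes a :: "'a::field"
  assumes two: "(2::'a) \<noteq> 0" and c: "c \<noteq> 0" and x: "x = aff a (- (a\<^sup>2 + 1) / c) c (- a) u v"
  shows "\<exists>b \<in> basic_maps. pmap_comp x b = pmap_comp b R1"
proof -
  \<comment> \<open>\<open>(s, t)\<close> is the fixed point of \<open>x\<close>: the linear part
    \<open>M\<close> has \<open>M^2 = -1\<close>, so \<open>(1 - M) (1 + M) = 2\<close>, and the
    equation \<open>(1 - M) (s, t) = (u, v)\<close> is solved by
    \<open>(1 + M) (u, v) / 2\<close>.\<close>
  define s t where "s = ((1 + a) * u - (a\<^sup>2 + 1) / c * v) / 2" and "t = (c * u + (1 - a) * v) / 2"
  have s2: "2 * s = (1 + a) * u - (a\<^sup>2 + 1) / c * v" and t2: "2 * t = c * u + (1 - a) * v"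
    using two by (simp_all add: s_def t_def)
  define k where "k = (a\<^sup>2 + 1) / c"
  have k: "k * c = a * a + 1" using c by (simp add: k_def power2_eq_square)
  have "2 * (a * s - k * t + u - s) = (a - 1) * (2 * s) - k * (2 * t) + 2 * u" by (simp add: algebra_simps)
  also have "\<dots> = u * (a * a + 1 - k * c)" unfolding s2 t2 k_def[symmetric] by (simp add: algebra_simps)
  finally have "2 * (a * s - k * t + u - s) = 0" unfolding k by simp
  then have "a * s - k * t + u - s = 0" using two by (simp only: mult_eq_0_iff simp_thms)
  then have 1: "a * s - k * t + u = s" by simp
  have "2 * (c * s - a * t + v - t) = c * (2 * s) - (a + 1) * (2 * t) + 2 * v" by (simp add: algebra_simps)
  also have "\<dots> = v * (a * a + 1 - k * c)" unfolding s2 t2 k_def[symmetric] by (simp add: algebra_simps)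
  finally have "2 * (c * s - a * t + v - t) = 0" unfolding k by simp
  then have "c * s - a * t + v - t = 0" using two by (simp only: mult_eq_0_iff simp_thms)
  then have 2: "c * s - a * t + v = t" by simp
  have x': "x = aff a (- k) c (- a) u v" unfolding x k_def by (simp only: minus_divide_left)
  \<comment> \<open>The linear part has the columns \<open>e1\<close> and \<open>M e1\<close>, a
    basis in which \<open>M\<close> acts as \<open>R1\<close>; being triangular it is basic.\<close>
  have "pmap_comp x (aff 1 a 0 c s t) = pmap_comp (aff 1 a 0 c s t) R1"
    unfolding x' R1_aff aff_comp aff_eq_iff using 1 2 by (simp add: k)
  moreover have "aff 1 a 0 c s t \<in> basic_maps" unfolding basic_maps_iff using c by (metis mult_1)
  ultimately show ?thesis by blast
qed

text \<open>Both multipliers satisfy \<open>z^4 = 1\<close>, hence \<open>z^2 = 1\<close> in the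
  absence of a square root of \<open>-1\<close>. The square is then \<open>x + Q(y), y + w\<close>;
  its own square being trivial gives \<open>2 w = 0\<close> and then \<open>2 Q = 0\<close>, so it
  is already the identity.\<close>

lemma elementary_order_4:
  fixes x :: "'a::field pmap"
  assumes two: "(2::'a) \<noteq> 0" and no_i: "\<And>z::'a. z * z \<noteq> - 1"
    and xE: "x \<in> elementary_maps"
  shows "GA2.ord x \<noteq> 4"
proof
  assume "GA2.ord x = 4"
  then have x: "pmap_comp (pmap_comp x x) (pmap_comp x x) = pmap_id" "pmap_comp x x \<noteq> pmap_id"
    using GA2.ord_4_iff[OF elementary_maps_carrier[OF xE]] by simp_all
  obtain \<alpha> P \<beta> v where xx: "x = elementary_map \<alpha> P \<beta> v"
    using xE by (auto simp: elementary_maps_def)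
  define Q w where "Q = smult \<alpha> P + pcompose P [:v, \<beta>:]" and "w = \<beta> * v + v"
  have y: "pmap_comp x x = elementary_map (\<alpha> * \<alpha>) Q (\<beta> * \<beta>) w"
    unfolding xx elementary_comp Q_def w_def ..
  have yy: "\<alpha> * \<alpha> * (\<alpha> * \<alpha>) = 1" "smult (\<alpha> * \<alpha>) Q + pcompose Q [:w, \<beta> * \<beta>:] = 0"
    "\<beta> * \<beta> * (\<beta> * \<beta>) = 1" "\<beta> * \<beta> * w + w = 0"
    using x(1) unfolding y elementary_comp pmap_id_elementary elementary_eq_iff by blast+
  have sq: "z * z = 1" if "z * z * (z * z) = 1" for z :: 'a
  proof -
    have "(z * z - 1) * (z * z + 1) = 0" using that by (simp add: algebra_simps)
    then show ?thesis using no_i[of z] by (auto simp: eq_neg_iff_add_eq_0)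
  qed
  have ab: "\<alpha> * \<alpha> = 1" "\<beta> * \<beta> = 1" using sq yy by blast+
  have "2 * w = 0" using yy(4) ab by simp
  then have w: "w = 0" using two by simp
  have "smult 2 Q = Q + Q" by (metis one_add_one smult_1_left smult_add_left)
  then have "smult 2 Q = 0" using yy(2) ab w by simp
  then have "Q = 0" using two by simp
  then show False using x(2) unfolding y pmap_id_elementary by (simp add: ab w)
qed

section \<open>From a reversor of order four to the normal form\<close>

text \<open>Conjugation by \<open>-1\<close> permutes the representatives and keeps their types, so
  applied letter by letter it carries normal forms to normal forms.\<close>

lemma central_flip:
  assumes "t \<in> I_maps \<union> J_maps"
  defines "t' \<equiv> pmap_comp central (pmap_comp t central)"
  shows "t' \<in> I_maps \<union> J_maps" "t' \<in> affine_maps \<longleftrightarrow> t \<in> affine_maps"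
proof -
  have "t' \<in> I_maps \<and> t \<in> I_maps \<or> t' \<in> J_maps \<and> t \<in> J_maps"
  proof (cases "t \<in> I_maps")
    case True
    then obtain \<beta> where "t = aff 0 1 1 \<beta> 0 0" unfolding I_maps_aff by blast
    then have "symmetric t" using symmetric_linear by metis
    then have "t' = t" unfolding t'_def symmetric_iff .
    then show ?thesis using True by simp
  next
    case False
    then obtain P where P: "t = shear P" "P \<noteq> 0" using assms(1) unfolding J_maps_def by blast
    have "t' = shear (- pcompose P [:0, - 1:])" unfolding t'_def P central_shear ..
    moreover have "pcompose P [:0, - 1:] \<noteq> 0" using P(2) by (simp add: pcompose_eq_0_iff)
    then have "- pcompose P [:0, - 1:] \<noteq> 0" by simp
    ultimately have "t' \<in> J_maps" unfolding J_maps_def by blast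
    then show ?thesis using False assms(1) by blast
  qed
  then show "t' \<in> I_maps \<union> J_maps" "t' \<in> affine_maps \<longleftrightarrow> t \<in> affine_maps"
    using I_maps_letters J_maps_letters by blast+
qed

text \<open>Multiplying \<open>eq\<close> by \<open>-1\<close> on the left gives one element in two
  normal forms: the letters conjugated by \<open>-1\<close>, and the original letters with a
  translation as basic factor. Uniqueness removes the translation and fixes every letter.\<close>

lemma word_central_commute:
  fixes ts :: "'a::field pmap list"
  assumes ts: "am.alt ts" "set ts \<subseteq> I_maps \<union> J_maps"
    and eq: "pmap_comp (comp_list ts) central = pmap_comp (aff (- 1) 0 0 (- 1) u v) (comp_list ts)"
  shows "u = 0 \<and> v = 0 \<and> (\<forall>t \<in> set ts. symmetric t)"
proof -
  let ?f = "\<lambda>t. pmap_comp central (pmap_comp t central) :: 'a pmap"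
  have comp: "comp_list (map ?f ws) = pmap_comp central (pmap_comp (comp_list ws) central)" for ws
  proof (induction ws)
    case Nil
    then show ?case by (simp add: central_central)
  next
    case (Cons w ws)
    have "comp_list (map ?f (w # ws)) =
        pmap_comp central (pmap_comp w (pmap_comp (pmap_comp central central) (pmap_comp (comp_list ws) central)))"
      using Cons by (simp add: pmap_comp_assoc)
    then show ?case by (simp add: central_central pmap_comp_assoc)
  qed
  have alt: "am.alt (map ?f ts) \<and> set (map ?f ts) \<subseteq> I_maps \<union> J_maps"
    using ts
  proof (induction ts)
    case (Cons t ts)
    have t: "t \<in> I_maps \<union> J_maps" and IH: "am.alt (map ?f ts)" "set (map ?f ts) \<subseteq> I_maps \<union> J_maps"
      using Cons by (simp_all add: am.alt_Cons)
    have l: "?f t \<in> (affine_maps - elementary_maps) \<union> (elementary_maps - affine_maps)"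
      using central_flip(1)[OF t] am.T_letters by blast
    have "map ?f ts = [] \<or> (?f t \<in> affine_maps) \<noteq> (hd (map ?f ts) \<in> affine_maps)"
    proof (cases ts)
      case (Cons s ss)
      have "s \<in> I_maps \<union> J_maps" "(t \<in> affine_maps) \<noteq> (s \<in> affine_maps)"
        using Cons.prems \<open>set (t # ts) \<subseteq> I_maps \<union> J_maps\<close> \<open>am.alt (t # ts)\<close> Cons by (simp_all add: am.alt_Cons)
      then show ?thesis using Cons central_flip(2)[OF t] central_flip(2)[of s] by simp
    qed simp
    then have "am.alt (?f t # map ?f ts)" unfolding am.alt_Cons using l IH(1) by blast
    then show ?case using IH(2) central_flip(1)[OF t] by simp
  qed simp
  have b: "aff 1 0 0 1 (- u) (- v) \<in> basic_maps"
    unfolding basic_maps_iff by (metis mult_1 zero_neq_one)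
  have "comp_list (map ?f ts) = pmap_comp (pmap_comp central (aff (- 1) 0 0 (- 1) u v)) (comp_list ts)"
    unfolding comp eq by (simp add: pmap_comp_assoc)
  also have "pmap_comp central (aff (- 1) 0 0 (- 1) u v) = aff 1 0 0 1 (- u) (- v)"
    by (simp add: central_def aff_comp)
  finally have "pmap_id \<star> am.wprod (map ?f ts) = aff 1 0 0 1 (- u) (- v) \<star> am.wprod ts"
    by (simp add: wprod_comp_list)
  then have "pmap_id = aff 1 0 0 1 (- u) (- v) \<and> map ?f ts = ts"
    using am.transversal_unique basic_id b alt ts unfolding basic_maps_def by blast
  then have uv: "u = 0 \<and> v = 0" and m: "map ?f ts = ts" unfolding pmap_id_aff aff_eq_iff by simp_all
  have "map ?f ts = map id ts" using m by simp
  then have "\<forall>t \<in> set ts. ?f t = t" unfolding map_eq_conv by simp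
  then show ?thesis using uv symmetric_iff by blast
qed

lemma half_word_exists:
  assumes "am.alt ws" "set ws \<subseteq> I_maps \<union> J_maps" "ws \<noteq> []" "hd ws \<notin> affine_maps" "last ws \<notin> affine_maps"
  shows "\<exists>m a e. 1 \<le> m \<and> ws = half_word m a e \<and> (\<forall>i \<in> {1..<m}. a i \<in> I_maps) \<and> (\<forall>i \<in> {1..m}. e i \<in> J_maps)"
  using assms
proof (induction "length ws" arbitrary: ws rule: less_induct)
  case less
  obtain x ys where x: "ws = x # ys" using less.prems(3) by (cases ws) auto
  have xJ: "x \<in> J_maps" using less.prems x I_maps_letters by auto
  show ?case
  proof (cases ys)
    case Nil
    then have "ws = half_word 1 (\<lambda>_. x) (\<lambda>_. x)" unfolding half_word_1 x by simp
    then show ?thesis using xJ by (intro exI[of _ 1] exI[of _ "\<lambda>_. x"]) auto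
  next
    case (Cons y zs)
    have y: "y \<in> affine_maps" "y \<in> I_maps \<union> J_maps" using less.prems x Cons by (auto simp: am.alt_Cons)
    then have yI: "y \<in> I_maps" using J_maps_letters by blast
    have zs: "zs \<noteq> []" using y less.prems(5) x Cons by auto
    then have "am.alt zs" "set zs \<subseteq> I_maps \<union> J_maps" "hd zs \<notin> affine_maps" "last zs \<notin> affine_maps" "length zs < length ws"
      using less.prems x Cons y by (auto simp: am.alt_Cons)
    then obtain m a e where m: "1 \<le> m" "zs = half_word m a e" "\<forall>i \<in> {1..<m}. a i \<in> I_maps" "\<forall>i \<in> {1..m}. e i \<in> J_maps"
      using less.hyps[of zs] zs by blast
    \<comment> \<open>The indices differ by one because \<open>half_word\<close> has one affine
      letter less than elementary ones.\<close>
    let ?a = "a(m := y)" and ?e = "e(Suc m := x)"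
    have "half_word m ?a ?e = half_word m a e"
      unfolding half_word_def by (auto intro!: arg_cong[of _ _ concat])
    then have "ws = half_word (Suc m) ?a ?e" unfolding half_word_Suc[OF m(1)] using x Cons m(2) by simp
    moreover have "\<forall>i \<in> {1..<Suc m}. ?a i \<in> I_maps" using m(3) yI by simp
    moreover have "\<forall>i \<in> {1..Suc m}. ?e i \<in> J_maps" using m(4) xJ by simp
    ultimately show ?thesis by (metis le_SucI m(1))
  qed
qed

lemma affine_wprod: "set ws \<subseteq> affine_maps \<Longrightarrow> am.wprod ws \<in> affine_maps"
proof (induction ws)
  case Nil
  then show ?case using subgroup.one_closed[OF affine_subgroup] by simp
next
  case (Cons w ws)
  then show ?case using subgroup.m_closed[OF affine_subgroup, of w "am.wprod ws"] by simp
qed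

text \<open>
  Write \<open>g = \<alpha>\<^sub>0 W a\<close> with affine \<open>\<alpha>\<^sub>0\<close>, \<open>a\<close> and a word \<open>W\<close> that begins and ends in \<open>J_maps\<close>. The
  conjugate of \<open>\<xi>\<close> by \<open>a\<close> is a conjugate of \<open>R\<^sub>1\<close> by an element \<open>b\<close> of \<open>basic_maps\<close>, and moving \<open>b\<close> to
  the left through \<open>W\<close> changes the letters of \<open>W\<close> but not their types. The uniqueness of normal
  forms then forces the new letters to commute with \<open>- 1\<close>.
\<close>

lemma reversible_normalisation:
  fixes \<xi> \<zeta> g :: "'a::field pmap"
  assumes two: "(2::'a) \<noteq> 0" and no_i: "\<And>z::'a. z * z \<noteq> - 1"
    and g: "g \<in> carrier GA2" "g \<notin> affine_maps"
    and xi: "\<xi> \<in> affine_maps" "GA2.ord \<xi> = 4"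
    and zeta: "\<zeta> \<in> affine_maps" "GA2.ord \<zeta> = 4"
    and sq: "\<zeta> \<star> \<zeta> = g \<star> (\<xi> \<star> \<xi>) \<star> ginv g"
  shows "\<exists>m a e \<alpha> \<gamma>. admissible m a e \<gamma> \<and>
    conjugate (g \<star> \<xi> \<star> ginv g \<star> \<zeta>) (reversible_form m a e \<alpha> \<gamma>)"
proof -
  note Acl = subgroup.m_closed[OF affine_subgroup] subgroup.m_inv_closed[OF affine_subgroup]
  let ?A = "affine_maps :: 'a pmap set"
  let ?isA = "\<lambda>x. x \<in> ?A"
  obtain b0 ts where ts: "b0 \<in> basic_maps" "am.alt ts" "g = b0 \<star> am.wprod ts"
    using am.reduced_exists[OF g(1)] unfolding basic_maps_def by blast
  define L D where "L = takeWhile ?isA ts" and "D = dropWhile ?isA ts"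
  define R W where "R = rev (takeWhile ?isA (rev D))" and "W = rev (dropWhile ?isA (rev D))"
  have tsD: "ts = L @ D" by (simp add: L_def D_def)
  have DW: "D = W @ R" unfolding R_def W_def by (simp flip: rev_append)
  have LR: "set L \<subseteq> ?A" "set R \<subseteq> ?A" by (auto simp: L_def R_def dest: set_takeWhileD)
  have alts: "am.alt L" "am.alt W" "am.alt R" using ts(2) unfolding tsD DW am.alt_append by blast+
  have LRA: "am.wprod L \<in> ?A" "am.wprod R \<in> ?A" using LR affine_wprod by blast+
  have b0A: "b0 \<in> ?A" using ts(1) by (simp add: basic_maps_def)
  have carB: "x \<in> carrier GA2" if "x \<in> basic_maps" for x :: "'a pmap" using that by (rule basic_carrier)
  have carW: "am.wprod W \<in> carrier GA2" using alts(2) by simp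
  have "am.wprod ts = am.wprod L \<star> (am.wprod W \<star> am.wprod R)"
    unfolding tsD DW wprod_comp_list by (simp add: comp_list_append)
  then have g1: "g = (b0 \<star> am.wprod L) \<star> am.wprod W \<star> am.wprod R"
    unfolding ts(3) using alts carB[OF ts(1)]
    by (simp only: GA2.m_assoc GA2.m_closed am.alt_wprod_closed)
  define \<alpha>0 a' where "\<alpha>0 = b0 \<star> am.wprod L" and "a' = am.wprod R"
  have A0: "\<alpha>0 \<in> ?A" "a' \<in> ?A" unfolding \<alpha>0_def a'_def using Acl(1)[OF b0A LRA(1)] LRA(2) by blast+
  have g2: "g = \<alpha>0 \<star> am.wprod W \<star> a'" unfolding \<alpha>0_def a'_def by (rule g1)
  have Wne: "W \<noteq> []"
  proof
    assume "W = []"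
    then have "g = \<alpha>0 \<star> a'" unfolding g2 by simp
    then show False using Acl(1)[OF A0] g(2) by simp
  qed
  have Wends: "hd W \<notin> ?A" "last W \<notin> ?A"
  proof -
    have "dropWhile ?isA (rev D) \<noteq> []" using Wne by (simp add: W_def)
    from hd_dropWhile[OF this] show "last W \<notin> ?A" using Wne by (simp add: W_def last_rev)
    have "D \<noteq> []" using Wne DW by simp
    then have "dropWhile ?isA ts \<noteq> []" by (simp add: D_def)
    from hd_dropWhile[OF this] have "hd D \<notin> ?A" by (simp add: D_def)
    then show "hd W \<notin> ?A" using Wne DW by simp
  qed
  have car: "\<alpha>0 \<in> carrier GA2" "a' \<in> carrier GA2" "\<xi> \<in> carrier GA2" "\<zeta> \<in> carrier GA2"
    using A0 xi(1) zeta(1) affine_maps_carrier by blast+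
  define \<xi>' where "\<xi>' = a' \<star> \<xi> \<star> ginv a'"
  have xi'A: "\<xi>' \<in> ?A" unfolding \<xi>'_def using A0(2) xi(1) Acl by blast
  have "GA2.ord \<xi>' = 4" unfolding \<xi>'_def GA2.ord_conj[OF car(2,3)] by (rule xi(2))
  then obtain p c u v where pc: "c \<noteq> 0" "\<xi>' = aff p (- (p\<^sup>2 + 1) / c) c (- p) u v"
    using affine_order_4[OF two no_i xi'A] by blast
  obtain b where b: "b \<in> basic_maps" "\<xi>' \<star> b = b \<star> R1"
    using affine_order_4_conj_R1[OF two pc] unfolding GA2_simps by blast
  have R1c: "(R1 :: 'a pmap) \<in> carrier GA2" using R1_letter affine_maps_carrier by blast
  obtain W0 x where W0: "W = W0 @ [x]" using Wne by (cases W rule: rev_cases) auto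
  have bB: "b \<in> affine_maps \<inter> elementary_maps" using b(1) by (simp add: basic_maps_def)
  define W1 where "W1 = W0 @ [x \<star> b]"
  have W1: "am.alt W1" "am.wprod W1 = am.wprod W \<star> b"
    using am.alt_B_right[OF bB, of W0 x] alts(2) unfolding W1_def W0 by blast+
  have xt: "(x \<star> b \<in> ?A) = (x \<in> ?A)"
    using am.B_letter_right(2)[OF bB] am.alt_last[OF alts(2) Wne] W0 by simp
  have W1ends: "W1 \<noteq> []" "hd W1 \<notin> ?A" "last W1 \<notin> ?A"
    using Wends xt unfolding W1_def W0 by (cases W0; simp)+
  obtain b' W' where W': "b' \<in> basic_maps" "am.alt W'" "set W' \<subseteq> I_maps \<union> J_maps"
    "am.wprod W1 = b' \<star> am.wprod W'" "list_all2 (\<lambda>x t. (x \<in> ?A) = (t \<in> ?A)) W1 W'"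
    using am.transversal_form[OF W1(1)] unfolding basic_maps_def by blast
  have len: "length W' = length W1" using list_all2_lengthD[OF W'(5)] by simp
  have W'ne: "W' \<noteq> []" using len W1ends(1) by auto
  have W'ends: "hd W' \<notin> ?A" "last W' \<notin> ?A"
  proof -
    have "(W1 ! i \<in> ?A) = (W' ! i \<in> ?A)" if "i < length W1" for i
      using list_all2_nthD[OF W'(5) that] .
    then show "hd W' \<notin> ?A" "last W' \<notin> ?A"
      using W1ends W'ne len by (simp_all add: hd_conv_nth last_conv_nth)
  qed
  \<comment> \<open>The factor \<open>b'\<close> pushed out of the word on the left is affine and
    joins \<open>\<alpha>0\<close>; \<open>\<beta>\<close> will be conjugated into
    \<open>\<zeta>\<close>. On the right, \<open>\<kappa>\<close> conjugates \<open>\<xi>\<close> to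
    \<open>R1\<close>.\<close>
  define V \<beta> \<kappa> where "V = am.wprod W'" and "\<beta> = \<alpha>0 \<star> b'" and "\<kappa> = ginv b \<star> a'"
  have Vc: "V \<in> carrier GA2" unfolding V_def using W'(2) by simp
  have bc: "b \<in> carrier GA2" "b' \<in> carrier GA2" using b(1) W'(1) carB by blast+
  have \<beta>A: "\<beta> \<in> ?A"
    unfolding \<beta>_def using Acl(1)[OF A0(1), of b'] W'(1) by (simp only: basic_maps_def Int_iff)
  have \<beta>c: "\<beta> \<in> carrier GA2" using \<beta>A affine_maps_carrier by blast
  have \<kappa>c: "\<kappa> \<in> carrier GA2" unfolding \<kappa>_def using bc car by (simp only: grp)
  have Wb: "am.wprod W \<star> b = b' \<star> V" using W1(2) W'(4) unfolding V_def by simp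
  have g3: "g = \<beta> \<star> V \<star> \<kappa>"
  proof -
    have "\<beta> \<star> V \<star> \<kappa> = \<alpha>0 \<star> (b' \<star> V) \<star> \<kappa>"
      unfolding \<beta>_def using car bc Vc \<kappa>c by (simp only: GA2.m_assoc GA2.m_closed)
    also have "\<dots> = \<alpha>0 \<star> (am.wprod W \<star> b) \<star> \<kappa>" unfolding Wb ..
    also have "\<dots> = g" unfolding \<kappa>_def g2 using car bc carW by (simp only: grp)
    finally show ?thesis ..
  qed
  have R1k: "R1 = \<kappa> \<star> \<xi> \<star> ginv \<kappa>"
  proof -
    have "\<kappa> \<star> \<xi> \<star> ginv \<kappa> = ginv b \<star> (\<xi>' \<star> b)"
      unfolding \<kappa>_def \<xi>'_def using car bc by (simp only: grp)
    also have "\<dots> = R1" unfolding b(2) using bc R1c by (simp only: grp)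
    finally show ?thesis ..
  qed
  define \<zeta>' where "\<zeta>' = ginv \<beta> \<star> \<zeta> \<star> \<beta>"
  have z'A: "\<zeta>' \<in> ?A" unfolding \<zeta>'_def using \<beta>A zeta(1) Acl by blast
  have z'c: "\<zeta>' \<in> carrier GA2" using z'A affine_maps_carrier by blast
  have conj: "ginv \<beta> \<star> (g \<star> \<xi> \<star> ginv g \<star> \<zeta>) \<star> ginv (ginv \<beta>)
      = V \<star> R1 \<star> ginv V \<star> \<zeta>'"
    unfolding R1k g3 \<zeta>'_def using \<beta>c Vc \<kappa>c car by (simp only: grp)
  \<comment> \<open>The hypothesis \<open>sq\<close> in the new frame: \<open>\<zeta>'\<close> and
    \<open>V \<star> R1 \<star> ginv V\<close> have the same square.\<close>
  have z'2: "\<zeta>' \<star> \<zeta>' = V \<star> central \<star> ginv V"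
  proof -
    have "\<zeta>' \<star> \<zeta>' = ginv \<beta> \<star> (\<zeta> \<star> \<zeta>) \<star> \<beta>"
      unfolding \<zeta>'_def using \<beta>c car by (simp only: grp)
    also have "\<dots> = V \<star> (R1 \<star> R1) \<star> ginv V"
      unfolding sq R1k g3 using \<beta>c Vc \<kappa>c car by (simp only: grp)
    finally show ?thesis by (simp add: R1_R1)
  qed
  have centc: "(central :: 'a pmap) \<in> carrier GA2" by (rule central_carrier)
  have Vz: "V \<star> central = \<zeta>' \<star> \<zeta>' \<star> V"
    unfolding z'2 using Vc centc by (simp only: grp)
  have "GA2.ord \<zeta>' = 4"
    using GA2.ord_conj[OF GA2.inv_closed[OF \<beta>c] car(4)] zeta(2) \<beta>c unfolding \<zeta>'_def by (simp only: GA2.inv_inv)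
  then obtain \<alpha> \<gamma> u1 v1 where z': "\<gamma> \<noteq> 0" "\<zeta>' = aff \<alpha> (- (\<alpha>\<^sup>2 + 1) / \<gamma>) \<gamma> (- \<alpha>) u1 v1"
    using affine_order_4[OF two no_i z'A] by blast
  have zz: "pmap_comp \<zeta>' \<zeta>' = aff (- 1) 0 0 (- 1)
      (\<alpha> * u1 + (- (\<alpha>\<^sup>2 + 1) / \<gamma>) * v1 + u1) (\<gamma> * u1 + (- \<alpha>) * v1 + v1)"
    unfolding z'(2) aff_comp aff_eq_iff using z'(1) by (simp add: power2_eq_square)
  have "pmap_comp (comp_list W') central = pmap_comp (pmap_comp \<zeta>' \<zeta>') (comp_list W')"
    using Vz unfolding V_def wprod_comp_list GA2_simps .
  from word_central_commute[OF W'(2,3) this[unfolded zz]]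
  have u0: "\<alpha> * u1 + (- (\<alpha>\<^sup>2 + 1) / \<gamma>) * v1 + u1 = 0" "\<gamma> * u1 + (- \<alpha>) * v1 + v1 = 0"
    and sym: "\<forall>t \<in> set W'. symmetric t" by blast+
  \<comment> \<open>For the linear part \<open>M\<close> of \<open>\<zeta>'\<close> the equations
    \<open>u0\<close> say \<open>(1 + M) (u1, v1) = 0\<close>, and \<open>det (1 + M) = 2\<close>.
    So \<open>\<zeta>'\<close> is linear.\<close>
  have "v1 = 0 \<and> u1 = 0"
  proof -
    define k where "k = (\<alpha>\<^sup>2 + 1) / \<gamma>"
    have k: "k * \<gamma> = \<alpha> * \<alpha> + 1" using z'(1) by (simp add: k_def power2_eq_square)
    have mk: "- (\<alpha>\<^sup>2 + 1) / \<gamma> = - k" by (simp only: k_def minus_divide_left)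
    have "(\<alpha> + 1) * u1 - k * v1 = 0" "\<gamma> * u1 - (\<alpha> - 1) * v1 = 0"
      using u0[unfolded mk] by (simp_all add: algebra_simps)
    then have e1: "(\<alpha> + 1) * u1 = k * v1" and e2: "\<gamma> * u1 = (\<alpha> - 1) * v1" by simp_all
    have "(\<alpha> + 1) * (\<gamma> * u1) = k * \<gamma> * v1" using e1 by (simp add: algebra_simps)
    then have "(\<alpha> + 1) * ((\<alpha> - 1) * v1) = (\<alpha> * \<alpha> + 1) * v1" unfolding e2 k .
    then have "2 * v1 = 0" by (simp add: algebra_simps)
    then have "v1 = 0" using two by simp
    then show ?thesis using e2 z'(1) by simp
  qed
  then have zR2: "\<zeta>' = R2 \<alpha> \<gamma>" unfolding z'(2) R2_aff by simp
  obtain m a e where m: "1 \<le> m" "W' = half_word m a e" "\<forall>i \<in> {1..<m}. a i \<in> I_maps" "\<forall>i \<in> {1..m}. e i \<in> J_maps"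
    using half_word_exists[OF W'(2,3) W'ne W'ends] by blast
  have "e i \<in> odd_J_maps" if i: "i \<in> {1..m}" for i
  proof -
    have "symmetric (e i)" using sym i unfolding m(2) set_half_word[OF m(1)] by blast
    moreover obtain P where "e i = shear P" "P \<noteq> 0" using m(4) i unfolding J_maps_def by blast
    ultimately show ?thesis unfolding odd_J_maps_def using symmetric_shear_iff by (metis (mono_tags, lifting) mem_Collect_eq)
  qed
  then have adm: "admissible m a e \<gamma>" using m z'(1) unfolding admissible_def by blast
  have rf: "reversible_form m a e \<alpha> \<gamma> = V \<star> R1 \<star> ginv V \<star> \<zeta>'"
    unfolding V_def m(2) zR2 by (rule reversible_form_split(3)[OF adm])
  have "conjugate (g \<star> \<xi> \<star> ginv g \<star> \<zeta>) (reversible_form m a e \<alpha> \<gamma>)"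
    unfolding conjugate_def
  proof (intro conjI bexI[of _ "ginv \<beta>"])
    show "g \<star> \<xi> \<star> ginv g \<star> \<zeta> \<in> carrier GA2" using g car by (simp only: grp)
    show "reversible_form m a e \<alpha> \<gamma> \<in> carrier GA2" unfolding rf using Vc R1c z'c by (simp only: grp)
    show "ginv \<beta> \<in> carrier GA2" using \<beta>c by (simp only: grp)
    show "reversible_form m a e \<alpha> \<gamma> = ginv \<beta> \<star> (g \<star> \<xi> \<star> ginv g \<star> \<zeta>) \<star> ginv (ginv \<beta>)"
      unfolding rf conj ..
  qed
  then show ?thesis using adm by blast
qed

text \<open>With \<open>X\<close> and \<open>Z\<close> both squaring to \<open>-1\<close>,
  \<open>ginv Z\<close> is \<open>-Z\<close>, and \<open>X (X Z) (ginv X) = -Z (ginv X)\<close> is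
  the inverse of \<open>X Z\<close>. So \<open>X\<close>, of order four, is a reversor of
  \<open>X Z\<close>, and conjugation transports it to \<open>f\<close>.\<close>

lemma reversible_form_reversor:
  fixes f :: "'a::field pmap"
  assumes two: "(2::'a) \<noteq> 0" and adm: "admissible m a e \<gamma>"
    and conj: "conjugate f (reversible_form m a e \<alpha> \<gamma>)"
  shows "has_reversor_of_order_4 f"
proof -
  define W where "W = am.wprod (half_word m a e)"
  define Z where "Z = R2 \<alpha> \<gamma>"
  define X where "X = W \<star> R1 \<star> ginv W"
  have g0: "\<gamma> \<noteq> 0" using admissible_letters(2)[OF adm] .
  have W: "W \<in> carrier GA2" "symmetric W" "reversible_form m a e \<alpha> \<gamma> = X \<star> Z"
    using reversible_form_split[OF adm] unfolding W_def X_def Z_def by blast+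
  have R1c: "(R1 :: 'a pmap) \<in> carrier GA2" using R1_letter affine_maps_carrier by blast
  have Zc: "Z \<in> carrier GA2" unfolding Z_def using R2_letter[OF g0] affine_maps_carrier by blast
  have centc: "(central :: 'a pmap) \<in> carrier GA2" by (rule central_carrier)
  have Xc: "X \<in> carrier GA2" unfolding X_def using W R1c by (simp only: grp)
  have Z2: "Z \<star> Z = central" unfolding Z_def by (simp add: R2_R2[OF g0])
  have "X \<star> X = W \<star> (R1 \<star> R1) \<star> ginv W"
    unfolding X_def using W(1) R1c by (simp only: grp)
  also have "R1 \<star> R1 = (central :: 'a pmap)" by (simp add: R1_R1)
  also have "W \<star> central = central \<star> W" using W(2) by simp
  finally have X2: "X \<star> X = central" using W(1) centc by (simp only: grp)
  have cc: "(central :: 'a pmap) \<star> central = \<one>\<^bsub>GA2\<^esub>" by (simp add: central_central)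
  have "(- 1 :: 'a) \<noteq> 1" using two by (metis add.right_inverse one_add_one)
  then have "(central :: 'a pmap) \<noteq> pmap_id" unfolding central_def pmap_id_aff aff_eq_iff by blast
  then have ordX: "GA2.ord X = 4" unfolding GA2.ord_4_iff[OF Xc] X2 cc by simp
  have "ginv Z = central \<star> Z"
  proof (rule GA2.inv_equality)
    have "central \<star> Z \<star> Z = central \<star> (Z \<star> Z)" using Zc centc by (simp only: grp)
    then show "central \<star> Z \<star> Z = \<one>\<^bsub>GA2\<^esub>" unfolding Z2 cc .
  qed (use Zc centc in \<open>simp_all only: grp\<close>)
  then have "X \<star> X \<star> Z = ginv Z" unfolding X2 by simp
  then have XF: "X \<star> (X \<star> Z) \<star> ginv X = ginv (X \<star> Z)"
    using Xc Zc by (simp only: GA2.m_assoc GA2.m_closed GA2.inv_mult_group flip: GA2.m_assoc)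
  obtain h where h: "h \<in> carrier GA2" "f \<in> carrier GA2" "X \<star> Z = h \<star> f \<star> ginv h"
    using conj unfolding W(3) by (rule conjugateE)
  define r where "r = ginv h \<star> X \<star> h"
  have rc: "r \<in> carrier GA2" unfolding r_def using h Xc by (simp only: grp)
  have "r \<star> f \<star> ginv r =
      ginv h \<star> (X \<star> (h \<star> f \<star> ginv h) \<star> ginv X) \<star> h"
    unfolding r_def using h(1,2) Xc by (simp only: grp)
  also have "\<dots> = ginv h \<star> ginv (h \<star> f \<star> ginv h) \<star> h"
    unfolding h(3)[symmetric] XF ..
  also have "\<dots> = ginv f" using h(1,2) by (simp only: grp)
  finally have rev: "reversor f r" unfolding reversor_def using rc by blast
  have "GA2.ord r = 4"
    using GA2.ord_conj[OF GA2.inv_closed[OF h(1)] Xc] ordX h(1) unfolding r_def by (simp only: GA2.inv_inv)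
  then show ?thesis unfolding has_reversor_of_order_4_def using rev by blast
qed

lemma reversor_reversible_form:
  fixes f :: "'a::field pmap"
  assumes two: "(2::'a) \<noteq> 0" and no_i: "\<And>z::'a. z * z \<noteq> - 1"
    and CR: "CR_element f" and rev: "has_reversor_of_order_4 f"
  shows "\<exists>m a e \<alpha> \<gamma>. admissible m a e \<gamma> \<and> conjugate f (reversible_form m a e \<alpha> \<gamma>)"
proof -
  obtain cr where cr: "cyclically_reduced cr" "conjugate f cr" using CR unfolding CR_element_def by blast
  obtain w where w: "am.alt w" "even (length w)" "w \<noteq> []" "cr = comp_list w"
    using cr(1) by (rule cyclically_reducedE)
  have fc: "f \<in> carrier GA2" using cr(2) unfolding conjugate_def by blast
  obtain r where r: "r \<in> carrier GA2" "r \<star> f \<star> ginv r = ginv f"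
    "GA2.ord r = 4"
    using rev unfolding has_reversor_of_order_4_def reversor_def by blast
  \<comment> \<open>\<open>X \<star> Z\<close> is the conjugate of \<open>f\<close> by
    \<open>r\<close>, and \<open>Z\<close> has the same square as \<open>r\<close> because the order
    of \<open>r\<close> is four.\<close>
  define X Z where "X = r \<star> f" and "Z = ginv r"
  have Xc: "X \<in> carrier GA2" and Zc: "Z \<in> carrier GA2" unfolding X_def Z_def using r(1) fc by (simp_all only: grp)
  have "X = ginv f \<star> r"
    unfolding r(2)[symmetric] X_def using r(1) fc by (simp only: grp)
  then have "f \<star> X = r" using r(1) fc by (simp only: grp)
  then have X2: "X \<star> X = r \<star> r"
    using r(1) fc Xc by (metis GA2.m_assoc X_def)
  have r4: "r \<star> r \<star> (r \<star> r) = \<one>\<^bsub>GA2\<^esub>" using r(3) GA2.ord_4_iff[OF r(1)] by blast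
  have Z2: "Z \<star> Z = r \<star> r"
  proof -
    have "r \<star> r = ginv (r \<star> r)"
      by (rule GA2.inv_equality[symmetric, OF r4]) (use r(1) in \<open>simp_all only: grp\<close>)
    also have "\<dots> = Z \<star> Z" unfolding Z_def using r(1) by (simp only: grp)
    finally show ?thesis ..
  qed
  have ordX: "GA2.ord X = 4" and ordZ: "GA2.ord Z = 4"
    using r(3) unfolding GA2.ord_4_iff[OF Xc] GA2.ord_4_iff[OF Zc] GA2.ord_4_iff[OF r(1)] X2 Z2 by blast+
  have order_4: "\<exists>h \<in> carrier GA2. h \<star> y \<star> ginv h \<in> affine_maps"
    if y: "y \<in> carrier GA2" "GA2.ord y = 4" for y :: "'a pmap"
  proof -
    have "y [^]\<^bsub>GA2\<^esub> (4::nat) = \<one>\<^bsub>GA2\<^esub>" unfolding GA2.pow_eq_id[OF y(1)] y(2) by simp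
    then obtain h where h: "h \<in> carrier GA2" "h \<star> y \<star> ginv h \<in> affine_maps \<union> elementary_maps"
      using am.finite_order_conj_factor[OF y(1), of 4] by auto
    have "h \<star> y \<star> ginv h \<notin> elementary_maps"
      using elementary_order_4[OF two no_i] GA2.ord_conj[OF h(1) y(1)] y(2) by metis
    then show ?thesis using h by blast
  qed
  obtain h1 where h1: "h1 \<in> carrier GA2" "h1 \<star> Z \<star> ginv h1 \<in> affine_maps"
    using order_4[OF Zc ordZ] by blast
  obtain h2 where h2: "h2 \<in> carrier GA2" "h2 \<star> X \<star> ginv h2 \<in> affine_maps"
    using order_4[OF Xc ordX] by blast
  \<comment> \<open>The two factors become affine after conjugation by different maps.
    \<open>g\<close> is the change of frame between them, and \<open>?F\<close> below is the
    conjugate of \<open>X \<star> Z\<close> by \<open>h1\<close>.\<close>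
  define \<xi> \<zeta> g where "\<xi> = h2 \<star> X \<star> ginv h2" and "\<zeta> = h1 \<star> Z \<star> ginv h1"
    and "g = h1 \<star> ginv h2"
  have gc: "g \<in> carrier GA2" unfolding g_def using h1 h2 by (simp only: grp)
  have ords: "GA2.ord \<xi> = 4" "GA2.ord \<zeta> = 4"
    unfolding \<xi>_def \<zeta>_def GA2.ord_conj[OF h2(1) Xc] GA2.ord_conj[OF h1(1) Zc] by (rule ordX ordZ)+
  have zeta2: "\<zeta> \<star> \<zeta> = g \<star> (\<xi> \<star> \<xi>) \<star> ginv g"
  proof -
    have "\<zeta> \<star> \<zeta> = h1 \<star> (r \<star> r) \<star> ginv h1"
      unfolding \<zeta>_def Z2[symmetric] using h1(1) Zc by (simp only: grp)
    also have "\<dots> = g \<star> (\<xi> \<star> \<xi>) \<star> ginv g"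
      unfolding g_def \<xi>_def X2[symmetric] using h1(1) h2(1) Xc by (simp only: grp)
    finally show ?thesis .
  qed
  let ?F = "g \<star> \<xi> \<star> ginv g \<star> \<zeta>"
  have F: "?F = (h1 \<star> r) \<star> f \<star> ginv (h1 \<star> r)"
    unfolding g_def \<xi>_def \<zeta>_def X_def Z_def using h1(1) h2(1) r(1) fc by (simp only: grp)
  have hr: "h1 \<star> r \<in> carrier GA2" using h1(1) r(1) by (simp only: grp)
  have Fc: "?F \<in> carrier GA2" unfolding F using hr fc by (simp only: GA2.m_closed GA2.inv_closed)
  have fF: "conjugate f ?F" unfolding conjugate_def using fc Fc F hr by blast
  \<comment> \<open>For affine \<open>g\<close> the product \<open>?F\<close> would be affine, which
    is impossible for a conjugate of the cyclically reduced \<open>cr\<close>.\<close>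
  have "g \<notin> affine_maps"
  proof
    assume g: "g \<in> affine_maps"
    note Acl = subgroup.m_closed[OF affine_subgroup] subgroup.m_inv_closed[OF affine_subgroup]
    have FA: "?F \<in> affine_maps"
      using Acl(1)[OF Acl(1)[OF Acl(1)[OF g h2(2)] Acl(2)[OF g]] h1(2)] unfolding \<xi>_def \<zeta>_def .
    obtain k where k: "k \<in> carrier GA2" "?F = k \<star> cr \<star> ginv k"
      using conjugate_trans[OF conjugate_sym[OF cr(2)] fF] by (rule conjugateE)
    show False using affine_not_conjugate_cyclic[OF w(1-3) k(1)] FA unfolding k(2) w(4) wprod_comp_list by blast
  qed
  then obtain m a e \<alpha> \<gamma> where "admissible m a e \<gamma>" "conjugate ?F (reversible_form m a e \<alpha> \<gamma>)"
    using reversible_normalisation[OF two no_i gc _ h2(2)[folded \<xi>_def] ords(1) h1(2)[folded \<zeta>_def] ords(2) zeta2] by blast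
  then show ?thesis using conjugate_trans[OF fF] by blast
qed

text \<open>Leading coefficients in \<open>P(-y) = -P(y)\<close> give
  \<open>(-1)^(degree P) = -1\<close>, so \<open>degree P\<close> is odd as
  \<open>2 \<noteq> 0\<close>; the factor \<open>y^2\<close> of the shear adds two.\<close>

lemma odd_J_degree:
  fixes e :: "'a::field pmap"
  assumes two: "(2::'a) \<noteq> 0" and e: "e \<in> odd_J_maps"
  shows "odd (J_degree e) \<and> 3 \<le> J_degree e"
proof -
  obtain P where P: "e = shear P" "P \<noteq> 0" "odd_poly P" using e by (auto simp: odd_J_maps_def)
  have "J_degree e = degree (fst e)" using e odd_J_subset J_degree_eq by blast
  also have "\<dots> = 2 + degree P" unfolding P(1) by (rule degree_fst_shear[OF P(2)])
  finally have d: "J_degree e = 2 + degree P" .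
  have "lead_coeff (pcompose P [:0, - 1:]) = lead_coeff P * (- 1) ^ degree P"
    by (subst lead_coeff_comp) auto
  moreover have "lead_coeff (pcompose P [:0, - 1:]) = - lead_coeff P"
    using P(3) unfolding odd_poly_def by simp
  ultimately have eq: "lead_coeff P * (- 1) ^ degree P = - lead_coeff P" by simp
  have "odd (degree P)"
  proof
    assume "even (degree P)"
    then have "2 * lead_coeff P = 0" using eq by simp
    then show False using two P(2) by simp
  qed
  then show ?thesis using d by (auto elim!: oddE)
qed

section \<open>The hypotheses on the field, and the invariants of conjugates\<close>

lemma CHAR_ne_2_imp: "CHAR('a) \<noteq> 2 \<Longrightarrow> (2::'a::field) \<noteq> 0"
proof
  assume "CHAR('a) \<noteq> 2" "(2::'a) = 0"
  then have "of_nat 2 = (0::'a)" by simp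
  then have "CHAR('a) dvd 2" by (simp only: of_nat_eq_0_iff_char_dvd)
  then have "CHAR('a) \<le> 2" "CHAR('a) \<noteq> 0" by (simp add: dvd_imp_le, metis dvd_0_left zero_neq_numeral)
  then have "CHAR('a) = Suc 0" using \<open>CHAR('a) \<noteq> 2\<close> by linarith
  then show False using CHAR_not_1[where 'a = 'a] by blast
qed

lemma no_primitive_4th_root_imp:
  fixes z :: "'a::field"
  assumes two: "(2::'a) \<noteq> 0" and no4: "\<not> (\<exists>z \<in> (roots_of_unity :: 'a set). primitive_root_of_unity 4 z)"
  shows "z * z \<noteq> - 1"
proof
  assume z: "z * z = - 1"
  have m1: "(- 1 :: 'a) \<noteq> 1" using two by (metis add.right_inverse one_add_one)
  have "z ^ 4 = (z * z) * (z * z)" by (simp add: power4_eq_xxxx mult.assoc)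
  then have z4: "z ^ 4 = 1" using z by simp
  have "z ^ k \<noteq> 1" if "0 < k" "k < 4" for k :: nat
  proof -
    have "k = 1 \<or> k = 2 \<or> k = 3" using that by auto
    moreover have "z \<noteq> 1" using z m1 by auto
    moreover have "z ^ 2 \<noteq> 1" using z m1 by (simp add: power2_eq_square)
    moreover have "z ^ 3 \<noteq> 1"
    proof
      assume "z ^ 3 = 1"
      then have "z * z * z = 1" by (simp only: power3_eq_cube)
      then have "- z = 1" unfolding z by simp
      then have "z * z = 1" by (metis minus_mult_minus mult_1)
      then show False using z m1 by (simp only:)
    qed
    ultimately show ?thesis by auto
  qed
  then have "primitive_root_of_unity 4 z" using z4 by (simp add: primitive_root_of_unity_def)
  moreover have "z \<in> roots_of_unity" using z4 unfolding roots_of_unity_def by (intro CollectI exI[of _ 4]) simp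
  ultimately show False using no4 by blast
qed

lemma reversible_form_cyclically_reduced:
  assumes adm: "admissible m a e \<gamma>"
  shows "cyclically_reduced (reversible_form m a e \<alpha> \<gamma>)"
    and "pol_deg (reversible_form m a e \<alpha> \<gamma>) = mirror_list m (\<lambda>i. J_degree (e i))"
proof -
  note w = rev_word_alt[OF adm]
  show "cyclically_reduced (reversible_form m a e \<alpha> \<gamma>)"
    unfolding reversible_form_word wprod_comp_list by (rule cyclically_reduced_word[OF w(1-3)])
  show "pol_deg (reversible_form m a e \<alpha> \<gamma>) = mirror_list m (\<lambda>i. J_degree (e i))"
    using normal_form_of_word(2)[OF basic_id w(1)] w(4)
    unfolding reversible_form_word wprod_comp_list pol_word_def by simp
qed

text \<open>The determinant and the existence of a fixed point are invariant under conjugation and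
  are read off the form, all of whose letters fix the origin. For the other two claims,
  \<open>f'\<close> is conjugate by a basic map to a rotation of the word, whose letters commute
  with \<open>-1\<close>.\<close>

lemma reversible_form_conjugate_invariants:
  fixes f :: "'a::field pmap"
  assumes adm: "admissible m a e \<gamma>" and conj: "conjugate f (reversible_form m a e \<alpha> \<gamma>)"
  shows "det (jacobian_matrix f) = 1" and "has_fixed_point f"
    and "\<lbrakk>cyclically_reduced f'; conjugate f f'\<rbrakk> \<Longrightarrow>
      \<exists>k. pol_deg f' = rotate k (mirror_list m (\<lambda>i. J_degree (e i)))"
    and "\<lbrakk>cyclically_reduced f'; conjugate f f'\<rbrakk> \<Longrightarrow>
      \<exists>u v. f' \<star> neg_map u v = neg_map u v \<star> f'"
proof -
  note w = rev_word_alt[OF adm, of \<alpha>]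
  let ?w = "rev_word m a e \<alpha> \<gamma>"
  obtain h where h: "h \<in> carrier GA2" "f \<in> carrier GA2" "reversible_form m a e \<alpha> \<gamma> = h \<star> f \<star> ginv h"
    using conj by (rule conjugateE)
  have g0: "\<gamma> \<noteq> 0" using admissible_letters(2)[OF adm] .
  obtain W where W: "W \<in> carrier GA2" "reversible_form m a e \<alpha> \<gamma> = W \<star> R1 \<star> ginv W \<star> R2 \<alpha> \<gamma>"
    using reversible_form_split[OF adm] by blast
  have R1c: "(R1 :: 'a pmap) \<in> carrier GA2" using R1_letter affine_maps_carrier by blast
  have WRc: "W \<star> R1 \<star> ginv W \<in> carrier GA2"
    using W(1) R1c by (simp only: GA2.m_closed GA2.inv_closed)
  have "jac f = jac (reversible_form m a e \<alpha> \<gamma>)" unfolding h(3) by (rule jac_conj[OF h(1,2), symmetric])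
  also have "\<dots> = 1"
    unfolding W(2) jac_mult[OF WRc] jac_conj[OF W(1) R1c] jac_R1 jac_R2[OF g0] by simp
  finally show "det (jacobian_matrix f) = 1" unfolding det_jacobian .
  have "eval_pmap (reversible_form m a e \<alpha> \<gamma>) (0, 0) = (0, 0)"
    unfolding reversible_form_word wprod_comp_list by (rule eval_comp_list) (rule rev_word_symmetric(3)[OF adm])
  then show "has_fixed_point f" unfolding h(3) by (rule has_fixed_point_conj[OF h(1,2)])
  have rot: "\<exists>c \<in> basic_maps. \<exists>k. f' = c \<star> am.wprod (rotate k ?w) \<star> ginv c"
    if f': "cyclically_reduced f'" "conjugate f f'" for f'
  proof -
    obtain k where k: "k \<in> carrier GA2" "f' = k \<star> reversible_form m a e \<alpha> \<gamma> \<star> ginv k"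
      using conjugate_trans[OF conjugate_sym[OF conj] f'(2)] by (rule conjugateE)
    show ?thesis
      using cyclically_reduced_conjugate[OF w(1-3) k(1)] f'(1) unfolding k(2) reversible_form_word by blast
  qed
  show "\<exists>k. pol_deg f' = rotate k (mirror_list m (\<lambda>i. J_degree (e i)))"
    if f': "cyclically_reduced f'" "conjugate f f'"
  proof -
    obtain c k where c: "c \<in> basic_maps" "f' = c \<star> am.wprod (rotate k ?w) \<star> ginv c"
      using rot[OF f'] by blast
    have "rotate k ?w \<noteq> []" using w(3) by simp
    then have "pol_deg f' = pol_word (rotate k ?w)"
      unfolding c(2) by (rule normal_form_of_conjugate_word(2)[OF c(1) am.alt_rotate[OF w(1,2)]])
    then show ?thesis using pol_word_rotate[of k ?w] unfolding w(4) by simp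
  qed
  show "\<exists>u v. f' \<star> neg_map u v = neg_map u v \<star> f'"
    if f': "cyclically_reduced f'" "conjugate f f'"
  proof -
    obtain c k where c: "c \<in> basic_maps" "f' = c \<star> am.wprod (rotate k ?w) \<star> ginv c"
      using rot[OF f'] by blast
    have "symmetric (comp_list (rotate k ?w))"
    proof (rule symmetric_comp_list)
      fix t assume "t \<in> set (rotate k ?w)"
      then have "t \<in> set ?w" by simp
      then show "symmetric t" by (rule rev_word_symmetric(2)[OF adm])
    qed
    moreover have "am.wprod (rotate k ?w) \<in> carrier GA2"
      by (rule am.alt_wprod_closed[OF am.alt_rotate[OF w(1,2)]])
    ultimately show ?thesis unfolding c(2) wprod_comp_list by (intro symmetric_conj_basic[OF c(1)])
  qed
qed

theorem proposition12:
  fixes f :: "'a::field pmap"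
  assumes char: "CHAR('a) \<noteq> 2"
    and roots: "{1, -1} \<subseteq> (roots_of_unity :: 'a set)"
    and no4: "\<not> (\<exists>z \<in> (roots_of_unity :: 'a set). primitive_root_of_unity 4 z)"
    and CR: "CR_element f"
  shows
    "(has_reversor_of_order_4 f \<longleftrightarrow>
       (\<exists>m a e \<alpha> \<gamma>. admissible m a e \<gamma> \<and> conjugate f (reversible_form m a e \<alpha> \<gamma>))) \<and>
     (\<forall>m a e (\<alpha>::'a) \<gamma>. admissible m a e \<gamma> \<longrightarrow>
       cyclically_reduced (reversible_form m a e \<alpha> \<gamma>) \<and>
       pol_deg (reversible_form m a e \<alpha> \<gamma>) = mirror_list m (\<lambda>i. J_degree (e i))) \<and>
     (R1 :: 'a pmap) \<in> affine_maps - basic_maps \<and>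
     (\<forall>(\<alpha>::'a) \<gamma>. \<gamma> \<noteq> 0 \<longrightarrow> R2 \<alpha> \<gamma> \<in> affine_maps - basic_maps) \<and>
     R2 0 1 = (R1 :: 'a pmap) \<and>
     (has_reversor_of_order_4 f \<longrightarrow>
       det (jacobian_matrix f) = 1 \<and>
       has_fixed_point f \<and>
       (\<exists>m n. 1 \<le> m \<and> (\<forall>i\<in>{1..m}. odd (n i) \<and> 3 \<le> n i) \<and>
         (\<forall>f'. cyclically_reduced f' \<and> conjugate f f' \<longrightarrow>
            (\<exists>k. pol_deg f' = rotate k (mirror_list m n)))) \<and>
       (\<forall>f'. cyclically_reduced f' \<and> conjugate f f' \<longrightarrow>
          (\<exists>u v. f' \<otimes>\<^bsub>GA2\<^esub> neg_map u v = neg_map u v \<otimes>\<^bsub>GA2\<^esub> f')))"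
proof -
  have two: "(2::'a) \<noteq> 0" by (rule CHAR_ne_2_imp[OF char])
  have no_i: "z * z \<noteq> - 1" for z :: 'a by (rule no_primitive_4th_root_imp[OF two no4])
  have iff: "has_reversor_of_order_4 f \<longleftrightarrow>
      (\<exists>m a e \<alpha> \<gamma>. admissible m a e \<gamma> \<and> conjugate f (reversible_form m a e \<alpha> \<gamma>))"
    using reversible_form_reversor[OF two] reversor_reversible_form[OF two no_i CR] by blast
  have inv: "det (jacobian_matrix f) = 1 \<and> has_fixed_point f \<and>
      (\<exists>m n. 1 \<le> m \<and> (\<forall>i\<in>{1..m}. odd (n i) \<and> 3 \<le> n i) \<and>
        (\<forall>f'. cyclically_reduced f' \<and> conjugate f f' \<longrightarrow> (\<exists>k. pol_deg f' = rotate k (mirror_list m n)))) \<and>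
      (\<forall>f'. cyclically_reduced f' \<and> conjugate f f' \<longrightarrow>
        (\<exists>u v. f' \<otimes>\<^bsub>GA2\<^esub> neg_map u v = neg_map u v \<otimes>\<^bsub>GA2\<^esub> f'))"
    if rev: "has_reversor_of_order_4 f"
  proof -
    obtain m a e \<alpha> \<gamma> where adm: "admissible m a e \<gamma>" and conj: "conjugate f (reversible_form m a e \<alpha> \<gamma>)"
      using rev iff by blast
    note inv = reversible_form_conjugate_invariants[OF adm conj]
    have "\<forall>i\<in>{1..m}. odd (J_degree (e i)) \<and> 3 \<le> J_degree (e i)"
      using odd_J_degree[OF two] admissible_letters(4)[OF adm] by blast
    then show ?thesis using inv admissible_letters(1)[OF adm]
      by (intro conjI exI[of _ m] exI[of _ "\<lambda>i. J_degree (e i)"]) blast+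
  qed
  show ?thesis
  proof (intro conjI)
    show "\<forall>m a e (\<alpha>::'a) \<gamma>. admissible m a e \<gamma> \<longrightarrow>
       cyclically_reduced (reversible_form m a e \<alpha> \<gamma>) \<and>
       pol_deg (reversible_form m a e \<alpha> \<gamma>) = mirror_list m (\<lambda>i. J_degree (e i))"
      by (intro allI impI conjI reversible_form_cyclically_reduced)
    show "(R1 :: 'a pmap) \<in> affine_maps - basic_maps"
      using R1_letter[where 'a = 'a] unfolding basic_maps_def by blast
    show "\<forall>(\<alpha>::'a) \<gamma>. \<gamma> \<noteq> 0 \<longrightarrow> R2 \<alpha> \<gamma> \<in> affine_maps - basic_maps"
      using R2_letter[where 'a = 'a] unfolding basic_maps_def by blast
    show "R2 0 1 = (R1 :: 'a pmap)" by (simp add: R1_aff R2_aff)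
  qed (use iff inv in blast)+
qed

end
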